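(* Let $\mathrm{k}$ be a field, let $m,m'\geqslant 1$, and let $R_m=\mathrm{k}[x_0,\ldots,x_m]$, $R_{m'}=\mathrm{k}[x_m,\ldots,x_{m+m'}]$, both regarded as subrings of $R=\mathrm{k}[x_0,\ldots,x_{m+m'}]$. Let $g:\mathbb{P}^m_{\mathrm{k}}\dashrightarrow\mathbb{P}^m_{\mathrm{k}}$ (resp. $g':\mathbb{P}^{m'}_{\mathrm{k}}\dashrightarrow\mathbb{P}^{m'}_{\mathrm{k}}$) be a determinantal map whose base ideal $I_g\subset R_m$ (resp. $I_{g'}\subset R_{m'}$) is the ideal of $m$-minors of a matrix $\Phi_g\in R_m^{(m+1)\times m}$ (resp. the ideal of $m'$-minors of a matrix $\Phi_{g'}\in R_{m'}^{(m'+1)\times m'}$). Let $\Phi_{[g|g']}\in R^{(m+m'+1)\times(m+m')}$ be the matrix, with rows indexed by $0,\ldots,m+m'$ and columns indexed by $1,\ldots,m+m'$, whose block on rows $0,\ldots,m$ and columns $1,\ldots,m$ is $\Phi_g$, whose block on rows $m,\ldots,m+m'$ and columns $m+1,\ldots,m+m'$ is $\Phi_{g'}$, and all of whose other entries are $0$ (so the two blocks overlap in the row of index $m$). Assume that the ideal of $(m+m')$-minors of $\Phi_{[g|g']}$ is the base ideal of a rational map $[g|g']:\mathbb{P}^{m+m'}_{\mathrm{k}}\dashrightarrow\mathbb{P}^{m+m'}_{\mathrm{k}}$. Suppose that the tensor product $\mathbb{F}_g\otimes\mathbb{F}_{g'}$ of a free resolution $\mathbb{F}_g$ of the graph of $g$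 and a free resolution $\mathbb{F}_{g'}$ of the graph of $g'$ is a free resolution of the graph of $[g|g']$. Then for every $k\in\{0,\ldots,m+m'\}$, $$d_k([g|g'])=\sum_{p=0}^{k}d_p(g)\,d_{k-p}(g'),$$ with the convention that $d_p(g)=0$ if $p>m$ and $d_p(g')=0$ if $p>m'$.
   Context: A rational map $f=(f_0:\ldots:f_n):\mathbb{P}^n_{\mathrm{k}}\dashrightarrow\mathbb{P}^n_{\mathrm{k}}$ is given by homogeneous polynomials $f_0,\ldots,f_n\in\mathrm{k}[\mathsf{x}_0,\ldots,\mathsf{x}_n]$ of the same degree without common factor; its base ideal is $I_f=(f_0,\ldots,f_n)$. The map $f$ is determinantal if $I_f$ is the ideal of $n$-minors of its minimal presentation matrix $\Phi_f$, which is then an $(n+1)\times n$ matrix. When the ideal of maximal minors of an $(n+1)\times n$ matrix $\Phi$ is said to be the base ideal of a map $f$, the components $f_0,\ldots,f_n$ of $f$ are the signed maximal minors of $\Phi$, so that $(f_0\;\ldots\;f_n)\Phi=0$. Projective degrees. Let $\mathsf{S}=\mathrm{k}[\mathsf{x}_0,\ldots,\mathsf{x}_n,\mathsf{y}_0,\ldots,\mathsf{y}_n]$ be bigraded by $\deg\mathsf{x}_i=(1,0)$, $\deg\mathsf{y}_i=(0,1)$. For a bigraded ideal $\mathcal{A}\subset\mathsf{S}$ write the Hilbert series of $\mathsf{S}/\mathcal{A}$ as $\frac{\mathrm{Num}_{\mathsf{S}/\mathcal{A}}(T_0,T_1)}{(1-T_0)^{n+1}(1-T_1)^{n+1}}$.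 If the subscheme $\mathbb{X}\subset\mathbb{P}^n_{\mathrm{k}}\times\mathbb{P}^n_{\mathrm{k}}$ defined by $\mathcal{A}$ has codimension $c$, then for $0\leqslant k\leqslant c$ let $\deg_{\mathbb{P}}^{c-k,k}\mathbb{X}$ be the coefficient of $T_0^{c-k}T_1^{k}$ in $\mathrm{Num}_{\mathsf{S}/\mathcal{A}}(1-T_0,1-T_1)$. The graph $\Gamma_f\subset\mathbb{P}^n_{\mathrm{k}}\times\mathbb{P}^n_{\mathrm{k}}$ of $f$ is the closure of $\{(x,f(x)) : x\in U\}$, where $U$ is a dense open set on which $f$ is regular; its ideal $I_{\Gamma_f}$ is the kernel of the map from $\mathsf{S}$ to the Rees algebra $\bigoplus_{k\ge 0}I_f^kt^k$ sending $\mathsf{y}_i\mapsto f_it$. The graph has codimension $n$, and the $k$-th projective degree of $f$ is $d_k(f):=\deg_{\mathbb{P}}^{n-k,k}\Gamma_f$ for $0\leqslant k\leqslant n$. (If $\mathrm{k}$ is algebraically closed, $d_k(f)$ is the length of the intersection of $\Gamma_f$ with $k$ general hyperplanes pulled back from the source and $n-k$ general hyperplanes pulled back from the target.) Free resolutions of graphs. Let $S=R[y_0,\ldots,y_{m+m'}]$, with $\deg x_i=(1,0)$ and $\deg y_i=(0,1)$. Here $\mathbb{P}^m_{\mathrm{k}}=\mathrm{Proj}(R_m)$ and $\mathbb{P}^{m'}_{\mathrm{k}}=\mathrm{Proj}(R_{m'})$; the ideal of the graph of $g$ is first taken in $R_m[y_0,\ldots,y_m]$ and the ideal of the graph of $g'$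 in $R_{m'}[y_m,\ldots,y_{m+m'}]$, and $I_{\Gamma_g},I_{\Gamma_{g'}}\subset S$ are their extensions to $S$. The ideal $I_{\Gamma_{[g|g']}}$ is taken in $S$. A free resolution of one of these graphs means a bigraded free resolution over $S$ of the quotient of $S$ by the corresponding ideal, and tensor products are taken over $S$. *)

theory Defs
  imports
    "HOL-Library.Poly_Mapping"
    "HOL-Library.Product_Plus"
    "HOL-Algebra.Ideal"
    "HOL-Algebra.Divisibility"
    "HOL-Computational_Algebra.Polynomial_FPS"
    "Jordan_Normal_Form.Determinant"
    "Jordan_Normal_Form.DL_Submatrix"
begin

section \<open>Bigraded polynomial rings\<close>

datatype var = Xvar nat | Yvar nat

type_synonym mon = "var \<Rightarrow>\<^sub>0 nat"

text \<open>
  The type \<open>'k mpoly\<close> is the polynomial ring over \<open>'k\<close> in all the variables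
  \<open>Xvar i\<close>, \<open>Yvar i\<close>. The rings that occur below are its subrings generated by finitely many
  variables, so that the inclusions between them are inclusions of carriers.
\<close>

type_synonym 'k mpoly = "mon \<Rightarrow>\<^sub>0 'k"

definition poly_ring :: "var set \<Rightarrow> 'k::field mpoly ring" where
  "poly_ring V = \<lparr>carrier = {p. \<forall>\<mu>\<in>Poly_Mapping.keys p. Poly_Mapping.keys \<mu> \<subseteq> V},
     monoid.mult = (*), one = 1, zero = 0, add = (+)\<rparr>"

definition const :: "'k::field \<Rightarrow> 'k mpoly" where
  "const c = Poly_Mapping.single 0 c"

definition kscale :: "'k::field \<Rightarrow> 'k mpoly \<Rightarrow> 'k mpoly" where
  "kscale c p = const c * p"

definition xdeg :: "mon \<Rightarrow> nat" where
  "xdeg \<mu> = (\<Sum>v\<in>Poly_Mapping.keys \<mu>.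
     case v of Xvar i \<Rightarrow> Poly_Mapping.lookup \<mu> v | Yvar i \<Rightarrow> 0)"

definition ydeg :: "mon \<Rightarrow> nat" where
  "ydeg \<mu> = (\<Sum>v\<in>Poly_Mapping.keys \<mu>.
     case v of Xvar i \<Rightarrow> 0 | Yvar i \<Rightarrow> Poly_Mapping.lookup \<mu> v)"

text \<open>
  Bidegrees are pairs of integers because generators of free modules may sit in negative
  bidegrees. The zero polynomial is homogeneous of every bidegree.
\<close>

definition bihomogeneous :: "'k::field mpoly \<Rightarrow> int \<times> int \<Rightarrow> bool" where
  "bihomogeneous p d \<longleftrightarrow> (\<forall>\<mu>\<in>Poly_Mapping.keys p. (int (xdeg \<mu>), int (ydeg \<mu>)) = d)"

definition homogeneous :: "'k::field mpoly \<Rightarrow> nat \<Rightarrow> bool" where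
  "homogeneous p d \<longleftrightarrow> bihomogeneous p (int d, 0)"

text \<open>
  The source and target variables of a map of \<open>n\<close>-dimensional projective spaces are
  numbered \<open>a, \<dots>, a + n\<close>; the offset \<open>a\<close> serves to let two such spaces share a variable.
\<close>

definition xvars :: "nat \<Rightarrow> nat \<Rightarrow> var set" where
  "xvars a n = Xvar ` {a..a+n}"

definition xyvars :: "nat \<Rightarrow> nat \<Rightarrow> var set" where
  "xyvars a n = Xvar ` {a..a+n} \<union> Yvar ` {a..a+n}"

section \<open>Rational maps, minors and determinantal maps\<close>

text \<open>
  A map is given by its components \<open>f 0, \<dots>, f n\<close>; \<open>f i\<close> corresponds to the target
  coordinate \<open>Yvar (a + i)\<close>. The last condition also excludes that all components vanish.
\<close>

definition rational_map :: "nat \<Rightarrow> nat \<Rightarrow> (nat \<Rightarrow> 'k::field mpoly) \<Rightarrow> bool" where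
  "rational_map a n f \<longleftrightarrow>
     (let R = poly_ring (xvars a n) in
       (\<forall>i\<le>n. f i \<in> carrier R) \<and>
       (\<exists>d. \<forall>i\<le>n. homogeneous (f i) d) \<and>
       (\<forall>h\<in>carrier R. (\<forall>i\<le>n. h divides\<^bsub>R\<^esub> f i) \<longrightarrow> h \<in> Units R))"

definition base_ideal :: "nat \<Rightarrow> nat \<Rightarrow> (nat \<Rightarrow> 'k::field mpoly) \<Rightarrow> 'k mpoly set" where
  "base_ideal a n f = Idl\<^bsub>poly_ring (xvars a n)\<^esub> (f ` {0..n})"

definition entries_in :: "var set \<Rightarrow> 'k::field mpoly mat \<Rightarrow> bool" where
  "entries_in V A \<longleftrightarrow> elements_mat A \<subseteq> carrier (poly_ring V)"

definition vec_in :: "var set \<Rightarrow> nat \<Rightarrow> 'k::field mpoly vec \<Rightarrow> bool" where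
  "vec_in V r w \<longleftrightarrow> w \<in> carrier_vec r \<and> (\<forall>j<r. w $ j \<in> carrier (poly_ring V))"

definition minors :: "nat \<Rightarrow> 'k::field mpoly mat \<Rightarrow> 'k mpoly set" where
  "minors r A = {det (submatrix A I J) | I J.
     I \<subseteq> {..<dim_row A} \<and> J \<subseteq> {..<dim_col A} \<and> card I = r \<and> card J = r}"

definition minors_ideal :: "nat \<Rightarrow> nat \<Rightarrow> 'k::field mpoly mat \<Rightarrow> 'k mpoly set" where
  "minors_ideal a n A = Idl\<^bsub>poly_ring (xvars a n)\<^esub> (minors n A)"

text \<open>
  With these signs \<open>(f\<^sub>0 \<dots> f\<^sub>n) A = 0\<close> for \<open>f\<^sub>i = signed_minor A i\<close>, by Laplace expansion.
\<close>

definition signed_minor :: "'k::field mpoly mat \<Rightarrow> nat \<Rightarrow> 'k mpoly" where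
  "signed_minor A i = (-1) ^ i * det (submatrix A ({..<dim_row A} - {i}) UNIV)"

definition map_of_minors ::
  "nat \<Rightarrow> nat \<Rightarrow> 'k::field mpoly mat \<Rightarrow> (nat \<Rightarrow> 'k mpoly) \<Rightarrow> bool" where
  "map_of_minors a n A f \<longleftrightarrow>
     A \<in> carrier_mat (n+1) n \<and> entries_in (xvars a n) A \<and>
     base_ideal a n f = minors_ideal a n A \<and> (\<forall>i\<le>n. f i = signed_minor A i)"

text \<open>
  \<open>A\<close> is the matrix of a minimal graded presentation \<open>R\<^sup>r \<rightarrow> R\<^sup>n\<^sup>+\<^sup>1 \<rightarrow> I\<^sub>f \<rightarrow> 0\<close> with respect to the
  generators \<open>f 0, \<dots>, f n\<close>: they generate \<open>I\<^sub>f\<close> irredundantly, and the columns of \<open>A\<close> are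
  homogeneous and generate the syzygies of \<open>f\<close> irredundantly. (For homogeneous generators,
  irredundant and minimal in number are the same.) Since the \<open>f i\<close> have the same degree, a
  syzygy is homogeneous when its entries have the same degree.
\<close>

definition minimal_presentation ::
  "nat \<Rightarrow> nat \<Rightarrow> (nat \<Rightarrow> 'k::field mpoly) \<Rightarrow> 'k mpoly mat \<Rightarrow> bool" where
  "minimal_presentation a n f A \<longleftrightarrow>
     (let V = xvars a n; r = dim_col A in
       dim_row A = n + 1 \<and> entries_in V A \<and>
       (\<forall>i\<le>n. f i \<notin> Idl\<^bsub>poly_ring V\<^esub> (f ` ({0..n} - {i}))) \<and>
       (\<forall>j<r. \<exists>e. \<forall>i\<le>n. homogeneous (A $$ (i, j)) e) \<and>
       (\<forall>v. vec_in V (n+1) v \<longrightarrow>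
          ((\<Sum>i\<le>n. f i * v $ i) = 0 \<longleftrightarrow> (\<exists>w. vec_in V r w \<and> v = A *\<^sub>v w))) \<and>
       (\<forall>j<r. \<nexists>w. vec_in V r w \<and> w $ j = 0 \<and> col A j = A *\<^sub>v w))"

definition determinantal :: "nat \<Rightarrow> nat \<Rightarrow> (nat \<Rightarrow> 'k::field mpoly) \<Rightarrow> bool" where
  "determinantal a n f \<longleftrightarrow> rational_map a n f \<and>
     (\<exists>A. A \<in> carrier_mat (n+1) n \<and> minimal_presentation a n f A \<and>
          base_ideal a n f = minors_ideal a n A)"

text \<open>The two blocks overlap in the row of index \<open>m\<close>; columns are numbered from \<open>0\<close>.\<close>

definition glued_matrix ::
  "nat \<Rightarrow> nat \<Rightarrow> 'k::field mpoly mat \<Rightarrow> 'k mpoly mat \<Rightarrow> 'k mpoly mat" where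
  "glued_matrix m m' A A' = mat (m+m'+1) (m+m') (\<lambda>(i, j).
     if i \<le> m \<and> j < m then A $$ (i, j)
     else if m \<le> i \<and> m \<le> j then A' $$ (i - m, j - m)
     else 0)"

section \<open>Graphs and projective degrees\<close>

text \<open>
  The homomorphism \<open>x\<^sub>i \<mapsto> x\<^sub>i\<close>, \<open>y\<^sub>a\<^sub>+\<^sub>i \<mapsto> f\<^sub>i t\<close> to the Rees algebra, the latter being regarded as
  a subring of \<open>R[t]\<close>; this does not affect the kernel.
\<close>

definition rees_map ::
  "nat \<Rightarrow> (nat \<Rightarrow> 'k::field mpoly) \<Rightarrow> 'k mpoly \<Rightarrow> 'k mpoly poly" where
  "rees_map a f p = (\<Sum>\<mu>\<in>Poly_Mapping.keys p.
     Polynomial.smult (const (Poly_Mapping.lookup p \<mu>))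
     (\<Prod>v\<in>Poly_Mapping.keys \<mu>. (case v of
         Xvar i \<Rightarrow> [:Poly_Mapping.single (Poly_Mapping.single (Xvar i) 1) 1:]
       | Yvar i \<Rightarrow> Polynomial.monom (f (i - a)) 1) ^ Poly_Mapping.lookup \<mu> v))"

definition graph_ideal :: "nat \<Rightarrow> nat \<Rightarrow> (nat \<Rightarrow> 'k::field mpoly) \<Rightarrow> 'k mpoly set" where
  "graph_ideal a n f = {p \<in> carrier (poly_ring (xyvars a n)). rees_map a f p = 0}"

definition bigraded_part :: "var set \<Rightarrow> nat \<Rightarrow> nat \<Rightarrow> 'k::field mpoly set" where
  "bigraded_part V i j = {p \<in> carrier (poly_ring V). bihomogeneous p (int i, int j)}"

text \<open>
  The dimension of \<open>(S/J)\<^sub>i\<^sub>j = S\<^sub>i\<^sub>j / (J \<inter> S\<^sub>i\<^sub>j)\<close> for a bigraded ideal \<open>J\<close> of \<open>S = poly_ring V\<close>,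
  and finite \<open>V\<close>.
\<close>

definition hilbert_fun :: "var set \<Rightarrow> 'k::field mpoly set \<Rightarrow> nat \<Rightarrow> nat \<Rightarrow> nat" where
  "hilbert_fun V J i j = vector_space.dim kscale (bigraded_part V i j :: 'k mpoly set)
     - vector_space.dim kscale (J \<inter> bigraded_part V i j)"

text \<open>
  Power series and polynomials in \<open>T\<^sub>0, T\<^sub>1\<close> are nested, with \<open>T\<^sub>0\<close> as the outer variable.
\<close>

definition hilbert_series :: "var set \<Rightarrow> 'k::field mpoly set \<Rightarrow> int fps fps" where
  "hilbert_series V J = Abs_fps (\<lambda>i. Abs_fps (\<lambda>j. int (hilbert_fun V J i j)))"

definition fps_of_poly2 :: "int poly poly \<Rightarrow> int fps fps" where
  "fps_of_poly2 p = fps_of_poly (map_poly fps_of_poly p)"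

definition hilbert_num :: "nat \<Rightarrow> nat \<Rightarrow> 'k::field mpoly set \<Rightarrow> int poly poly" where
  "hilbert_num a n J = (THE p. fps_of_poly2 p =
     hilbert_series (xyvars a n) J * (1 - fps_X) ^ (n+1) * (fps_const (1 - fps_X)) ^ (n+1))"

text \<open>The substitution \<open>p(1 - T\<^sub>0, 1 - T\<^sub>1)\<close>.\<close>

definition subst_one_minus :: "int poly poly \<Rightarrow> int poly poly" where
  "subst_one_minus p = pcompose (map_poly (\<lambda>q. pcompose q [:1, -1:]) p) [:1, -1:]"

text \<open>\<open>multidegree a n J i j\<close> is the coefficient of \<open>T\<^sub>0\<^sup>i T\<^sub>1\<^sup>j\<close>.\<close>

definition multidegree :: "nat \<Rightarrow> nat \<Rightarrow> 'k::field mpoly set \<Rightarrow> nat \<Rightarrow> nat \<Rightarrow> int" where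
  "multidegree a n J i j = Polynomial.coeff (Polynomial.coeff (subst_one_minus (hilbert_num a n J)) i) j"

definition proj_degree :: "nat \<Rightarrow> nat \<Rightarrow> (nat \<Rightarrow> 'k::field mpoly) \<Rightarrow> nat \<Rightarrow> int" where
  "proj_degree a n f k =
     (if k \<le> n then multidegree a n (graph_ideal a n f) (n - k) k else 0)"

section \<open>Bigraded free resolutions\<close>

text \<open>
  A complex \<open>\<dots> \<rightarrow> F\<^sub>1 \<rightarrow> F\<^sub>0\<close> of bigraded free modules, possibly of infinite rank and infinite
  length, given by homogeneous bases \<open>basis i\<close> of \<open>F\<^sub>i\<close>, the bidegrees of the basis elements,
  and the matrices of the differentials: \<open>diff i b c\<close>, for \<open>b \<in> basis (i+1)\<close> and
  \<open>c \<in> basis i\<close>, is the coefficient at \<open>c\<close> of the image of \<open>b\<close> under \<open>F\<^sub>i\<^sub>+\<^sub>1 \<rightarrow> F\<^sub>i\<close>.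
\<close>

record (overloaded) ('k, 'b) free_complex =
  basis :: "nat \<Rightarrow> 'b set"
  bideg :: "nat \<Rightarrow> 'b \<Rightarrow> int \<times> int"
  diff :: "nat \<Rightarrow> 'b \<Rightarrow> 'b \<Rightarrow> 'k mpoly"

definition free_module :: "var set \<Rightarrow> 'b set \<Rightarrow> ('b \<Rightarrow> 'k::field mpoly) set" where
  "free_module V B = {u. finite {b. u b \<noteq> 0} \<and> {b. u b \<noteq> 0} \<subseteq> B \<and>
     range u \<subseteq> carrier (poly_ring V)}"

definition lin_comb :: "('b \<Rightarrow> 'k::field mpoly) \<Rightarrow> ('b \<Rightarrow> 'k mpoly) \<Rightarrow> 'k mpoly" where
  "lin_comb u e = (\<Sum>b | u b \<noteq> 0. u b * e b)"

definition apply_matrix ::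
  "('b \<Rightarrow> 'c \<Rightarrow> 'k::field mpoly) \<Rightarrow> ('b \<Rightarrow> 'k mpoly) \<Rightarrow> ('c \<Rightarrow> 'k mpoly)" where
  "apply_matrix D u = (\<lambda>c. lin_comb u (\<lambda>b. D b c))"

text \<open>The differentials are homogeneous maps of bidegree \<open>(0,0)\<close>.\<close>

definition bigraded_free_seq :: "var set \<Rightarrow> ('k::field, 'b) free_complex \<Rightarrow> bool" where
  "bigraded_free_seq V F \<longleftrightarrow>
     (\<forall>i. \<forall>b\<in>basis F (Suc i).
        diff F i b \<in> free_module V (basis F i) \<and>
        (\<forall>c\<in>basis F i. bihomogeneous (diff F i b c) (bideg F (Suc i) b - bideg F i c)))"

text \<open>
  Exactness of \<open>\<dots> \<rightarrow> F\<^sub>1 \<rightarrow> F\<^sub>0 \<rightarrow> S/J \<rightarrow> 0\<close>. The homogeneous augmentation \<open>F\<^sub>0 \<rightarrow> S/J\<close> is given by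
  homogeneous representatives \<open>\<epsilon> b \<in> S\<close> of the images of the basis elements.
\<close>

definition free_resolution ::
  "var set \<Rightarrow> 'k::field mpoly set \<Rightarrow> ('k, 'b) free_complex \<Rightarrow> bool" where
  "free_resolution V J F \<longleftrightarrow>
     bigraded_free_seq V F \<and>
     (\<forall>i. {u \<in> free_module V (basis F (Suc i)). apply_matrix (diff F i) u = (\<lambda>_. 0)} =
          apply_matrix (diff F (Suc i)) ` free_module V (basis F (Suc (Suc i)))) \<and>
     (\<exists>\<epsilon>. (\<forall>b\<in>basis F 0. \<epsilon> b \<in> carrier (poly_ring V) \<and> bihomogeneous (\<epsilon> b) (bideg F 0 b)) \<and>
          {u \<in> free_module V (basis F 0). lin_comb u \<epsilon> \<in> J} =
            apply_matrix (diff F 0) ` free_module V (basis F 1) \<and>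
          (\<forall>s\<in>carrier (poly_ring V). \<exists>u\<in>free_module V (basis F 0). s - lin_comb u \<epsilon> \<in> J))"

text \<open>
  The tensor product over \<open>poly_ring V\<close>. The triple \<open>(i, b, b')\<close> in degree \<open>n\<close> stands for
  \<open>b \<otimes> b'\<close> with \<open>b\<close> in the basis of \<open>F\<^sub>i\<close> and \<open>b'\<close> in the basis of \<open>F'\<^sub>n\<^sub>-\<^sub>i\<close>; the differential is
  \<open>d (b \<otimes> b') = d b \<otimes> b' + (-1)\<^sup>i b \<otimes> d b'\<close>.
\<close>

definition tensor_complex ::
  "('k::field, 'b) free_complex \<Rightarrow> ('k, 'c) free_complex \<Rightarrow> ('k, nat \<times> 'b \<times> 'c) free_complex"
where
  "tensor_complex F F' = \<lparr>
     basis = (\<lambda>n. {(i, b, b'). i \<le> n \<and> b \<in> basis F i \<and> b' \<in> basis F' (n - i)}),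
     bideg = (\<lambda>n (i, b, b'). bideg F i b + bideg F' (n - i) b'),
     diff = (\<lambda>n (i, b, b') (j, c, c').
       if i = Suc j \<and> b' = c' then diff F j b c
       else if i = j \<and> i \<le> n \<and> b = c then (-1) ^ i * diff F' (n - i) b' c'
       else 0)\<rparr>"

end

theory Submission
  imports Defs
begin

text \<open>
  Write \<open>P\<close>, \<open>Q\<close> for the coordinate rings of the two factors and \<open>C = k[x\<^sub>m, y\<^sub>m]\<close> for the ring they
  share. In degree zero the hypothesis on resolutions says that the ideal of the graph of \<open>[g|g']\<close>
  is the sum of the ideals \<open>J\<close>, \<open>J'\<close> of the two graphs. No further use of the resolutions is needed:
  the coordinate rings of the graphs are domains in which \<open>x\<^sub>m\<close> and \<open>y\<^sub>m\<close> do not vanish, and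
  over \<open>C\<close> such bigraded modules have no higher Tor. Concretely, \<open>J'\<close> is a free \<open>C\<close>-module on
  bihomogeneous generators, a combination of these with coefficients in \<open>P\<close> lies in the extension
  of \<open>J\<close> only if the coefficients lie in \<open>J\<close>, and counting dimensions gives
  \<open>HS(S/(J + J')) = HS(P/J) HS(Q/J') (1 - T\<^sub>0) (1 - T\<^sub>1)\<close>. Hence the numerators multiply. The
  numerator of a graph of dimension \<open>n\<close>, expanded at \<open>(1, 1)\<close>, has no terms of total degree below \<open>n\<close>,
  by comparing growth as \<open>(T\<^sub>0, T\<^sub>1) \<rightarrow> (1, 1)\<close>; so the coefficients of total degree \<open>m + m'\<close> are the
  stated convolution.
\<close>

section \<open>Relative bases\<close>

text \<open>The quotients P/J and Q/J' are torsion-free over C but need not be free, and a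
  torsion-free module such as the ideal (x_m, y_m) of C is not free either. What rescues J' is that
  it is saturated inside the free module Q: this gives xJ' \<inter> yJ' = xyJ' in each bidegree, so
  the number of new generators in a bidegree is a second difference of dimensions, and summing the
  differences back shows that the generators are independent. The vanishing of Tor then becomes the
  injectivity of (P/J) \<otimes> J' \<rightarrow> (P/J) \<otimes> Q over C. This is linear algebra
  over k, because C has one variable in each of the two degrees and its bihomogeneous elements are
  scalar multiples of single monomials. The factor (1 - T_0) (1 - T_1) is the inverse of the Hilbert
  series of C; it corrects the count of variables, as (m + 1) + (m' + 1) exceeds m + m' + 1 by one.
  Numerators are given by a definite description, so their existence as polynomials has to be
  proved; leading monomials reduce this to monomial ideals. The growth bound is turned into
  vanishing coefficients by restricting to the lines x = \<alpha> t, y = t.\<close>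

locale relative_bases = vector_space scale
  for scale :: "'a::field \<Rightarrow> 'b::ab_group_add \<Rightarrow> 'b"
begin

text \<open>For \<open>U \<subseteq> W\<close>, this is a lift of a basis of the quotient W/U. An
  indexed family instead of a set lets products and shifted generators be used before their
  distinctness is known.\<close>

definition rel_basis :: "'b set \<Rightarrow> 'b set \<Rightarrow> 'i set \<Rightarrow> ('i \<Rightarrow> 'b) \<Rightarrow> bool" where
  "rel_basis U W I f \<longleftrightarrow> finite I \<and> f ` I \<subseteq> W \<and>
     (\<forall>w\<in>W. \<exists>c. w - (\<Sum>i\<in>I. scale (c i) (f i)) \<in> U) \<and>
     (\<forall>c. (\<Sum>i\<in>I. scale (c i) (f i)) \<in> U \<longrightarrow> (\<forall>i\<in>I. c i = 0))"

definition fin_dim :: "'b set \<Rightarrow> bool" where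
  "fin_dim W \<longleftrightarrow> (\<exists>B. finite B \<and> W \<subseteq> span B)"

lemma fin_dim_mono: "fin_dim W \<Longrightarrow> U \<subseteq> W \<Longrightarrow> fin_dim U"
  unfolding fin_dim_def by blast

lemma fin_dim_basis:
  assumes "fin_dim W"
  obtains B where "B \<subseteq> W" "independent B" "W \<subseteq> span B" "finite B" "card B = dim W"
proof -
  obtain B where B: "B \<subseteq> W" "independent B" "W \<subseteq> span B" "card B = dim W"
    by (rule basis_exists)
  obtain C where "finite C" "W \<subseteq> span C" using assms unfolding fin_dim_def by blast
  then have "finite B" using B independent_span_bound by blast
  then show ?thesis using B that by blast
qed

lemma span_finite_ex:
  assumes "finite B" "w \<in> span B"
  shows "\<exists>c. w = (\<Sum>b\<in>B. scale (c b) b)"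
  using assms span_finite by (auto simp: image_iff)

lemma rel_basis_exists:
  assumes U: "subspace U" and UW: "U \<subseteq> W" and W: "subspace W" and fd: "fin_dim W"
  shows "\<exists>I. rel_basis U W I (\<lambda>b. b)"
proof -
  obtain A where A: "A \<subseteq> U" "independent A" "U \<subseteq> span A" "finite A"
    using fin_dim_basis fin_dim_mono[OF fd UW] by metis
  obtain B where B: "A \<subseteq> B" "B \<subseteq> W" "independent B" "W \<subseteq> span B"
    using maximal_independent_subset_extend[of A W] A UW by blast
  obtain C where "finite C" "W \<subseteq> span C" using fd unfolding fin_dim_def by blast
  then have fB: "finite B" using B independent_span_bound by blast
  have UA: "U = span A" using A U by (simp add: span_minimal subset_antisym)
  have "rel_basis U W (B - A) (\<lambda>b. b)" unfolding rel_basis_def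
  proof (intro conjI ballI allI impI)
    show "finite (B - A)" using fB by simp
    show "(\<lambda>b. b) ` (B - A) \<subseteq> W" using B by auto
  next
    fix w assume "w \<in> W"
    then obtain c where c: "w = (\<Sum>b\<in>B. scale (c b) b)" using span_finite_ex[OF fB] B by blast
    have "w = (\<Sum>b\<in>B - A. scale (c b) b) + (\<Sum>b\<in>A. scale (c b) b)"
      using c B fB by (simp add: sum.subset_diff)
    moreover have "(\<Sum>b\<in>A. scale (c b) b) \<in> U" unfolding UA
      by (intro span_sum span_scale span_base)
    ultimately show "\<exists>c. w - (\<Sum>b\<in>B - A. scale (c b) b) \<in> U" by (intro exI[of _ c]) simp
  next
    fix c i assume *: "(\<Sum>b\<in>B - A. scale (c b) b) \<in> U" and i: "i \<in> B - A"
    then obtain d where d: "(\<Sum>b\<in>B - A. scale (c b) b) = (\<Sum>b\<in>A. scale (d b) b)"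
      using span_finite_ex[OF A(4)] UA by blast
    \<comment> \<open>Moving the element of \<open>U\<close> to the other side turns a relation
      modulo \<open>U\<close> into a relation in the basis \<open>B\<close>.\<close>
    define e where "e b = (if b \<in> A then - d b else c b)" for b
    have "(\<Sum>b\<in>B. scale (e b) b) = (\<Sum>b\<in>B - A. scale (e b) b) + (\<Sum>b\<in>A. scale (e b) b)"
      using B fB by (simp add: sum.subset_diff)
    also have "(\<Sum>b\<in>B - A. scale (e b) b) = (\<Sum>b\<in>B - A. scale (c b) b)"
      by (rule sum.cong) (auto simp: e_def)
    also have "(\<Sum>b\<in>A. scale (e b) b) = - (\<Sum>b\<in>A. scale (d b) b)"
      by (simp add: e_def sum_negf)
    finally have "(\<Sum>b\<in>B. scale (e b) b) = 0" using d by simp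
    then have "e i = 0" using independentD[OF B(3) fB] i by blast
    then show "c i = 0" using i by (simp add: e_def)
  qed
  then show ?thesis by blast
qed

lemma rel_basis_dim:
  fixes f :: "'i \<Rightarrow> 'b"
  assumes rb: "rel_basis U W I f" and U: "subspace U" and UW: "U \<subseteq> W" and fd: "fin_dim W"
  shows "dim W = dim U + card I"
proof -
  have fI: "finite I" and fW: "f ` I \<subseteq> W"
    and sp: "\<And>w. w \<in> W \<Longrightarrow> \<exists>c. w - (\<Sum>i\<in>I. scale (c i) (f i)) \<in> U"
    and ind: "\<And>c i. (\<Sum>i\<in>I. scale (c i) (f i)) \<in> U \<Longrightarrow> i \<in> I \<Longrightarrow> c i = 0"
    using rb unfolding rel_basis_def by blast+
  obtain A where A: "A \<subseteq> U" "independent A" "U \<subseteq> span A" "finite A" "card A = dim U"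
    using fin_dim_basis fin_dim_mono[OF fd UW] by metis
  have UA: "U = span A" using A U by (simp add: span_minimal subset_antisym)
  have inj: "inj_on f I"
  proof (rule inj_onI, rule ccontr)
    fix i j assume ij: "i \<in> I" "j \<in> I" "f i = f j" "i \<noteq> j"
    \<comment> \<open>If f i = f j, then f i - f j = 0 is a relation with nonzero
      coefficients.\<close>
    define c :: "'i \<Rightarrow> 'a" where "c k = (if k = i then 1 else if k = j then -1 else 0)" for k
    have "(\<Sum>k\<in>I. scale (c k) (f k)) = (\<Sum>k\<in>{i, j}. scale (c k) (f k))"
      using ij fI by (intro sum.mono_neutral_right) (auto simp: c_def)
    also have "\<dots> = 0" using ij by (simp add: c_def)
    finally have "c i = 0" using ind[of c i] ij subspace_0[OF U] by simp
    then show False by (simp add: c_def)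
  qed
  have disj: "A \<inter> f ` I = {}"
  proof (rule ccontr)
    assume "A \<inter> f ` I \<noteq> {}"
    then obtain i where i: "i \<in> I" "f i \<in> U" using A by auto
    have "(\<Sum>k\<in>I. scale (if k = i then 1 else 0) (f k)) = f i"
      using i fI by (simp add: if_distrib[of "\<lambda>c. scale c _"] sum.delta cong: if_cong)
    then show False using ind[of "\<lambda>k. if k = i then 1 else 0" i] i by auto
  qed
  have "independent (A \<union> f ` I)"
  proof (rule independent_if_scalars_zero)
    show "finite (A \<union> f ` I)" using A fI by simp
    fix c v assume s: "(\<Sum>x\<in>A \<union> f ` I. scale (c x) x) = 0" and v: "v \<in> A \<union> f ` I"
    have e: "(\<Sum>x\<in>A. scale (c x) x) + (\<Sum>i\<in>I. scale (c (f i)) (f i)) = 0"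
      using s disj A fI inj by (simp add: sum.union_disjoint sum.reindex)
    have "(\<Sum>x\<in>A. scale (c x) x) \<in> U" unfolding UA by (intro span_sum span_scale span_base)
    then have "(\<Sum>i\<in>I. scale (c (f i)) (f i)) \<in> U"
      using e U by (metis add_eq_0_iff subspace_neg)
    then have z: "\<And>i. i \<in> I \<Longrightarrow> c (f i) = 0" using ind[of "\<lambda>i. c (f i)"] by blast
    then have "(\<Sum>x\<in>A. scale (c x) x) = 0" using e by simp
    then have "\<And>x. x \<in> A \<Longrightarrow> c x = 0" using independentD[OF A(2) A(4)] by blast
    then show "c v = 0" using z v by auto
  qed
  moreover have "W \<subseteq> span (A \<union> f ` I)"
  proof
    fix w assume "w \<in> W"
    then obtain c where c: "w - (\<Sum>i\<in>I. scale (c i) (f i)) \<in> U" using sp by blast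
    have "w - (\<Sum>i\<in>I. scale (c i) (f i)) \<in> span (A \<union> f ` I)" using c UA span_mono by blast
    moreover have "(\<Sum>i\<in>I. scale (c i) (f i)) \<in> span (A \<union> f ` I)"
      by (intro span_sum span_scale span_base) auto
    ultimately show "w \<in> span (A \<union> f ` I)" using span_add by fastforce
  qed
  moreover have "A \<union> f ` I \<subseteq> W" using A UW fW by blast
  ultimately have "dim W = card (A \<union> f ` I)" using dim_unique by blast
  also have "\<dots> = dim U + card I" using disj A fI inj by (simp add: card_Un_disjoint card_image)
  finally show ?thesis .
qed

text \<open>A basis \<open>B\<close> chosen inside the image already has dim W = card I elements, so
  the image is all of \<open>B\<close> and \<open>f\<close> is injective. This obtains independence
  from a count of dimensions.\<close>

lemma rel_basis_spanning:
  assumes fI: "finite I" and fW: "f ` I \<subseteq> W" and sp: "W \<subseteq> span (f ` I)" and c: "card I = dim W"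
  shows "rel_basis {0} W I f"
proof -
  obtain B where B: "B \<subseteq> f ` I" "independent B" "f ` I \<subseteq> span B"
    using maximal_independent_subset by blast
  have "W \<subseteq> span B" using B sp by (meson order_trans span_minimal subspace_span)
  then have cB: "card B = dim W" using basis_card_eq_dim[of B W] B fW by auto
  have "card B \<le> card (f ` I)" using B fI by (simp add: card_mono)
  then have ci: "card (f ` I) = card I" using c cB card_image_le[OF fI, of f] by simp
  then have inj: "inj_on f I" using fI by (simp add: eq_card_imp_inj_on)
  have "B = f ` I" using B fI cB c ci by (simp add: card_subset_eq)
  then have ind: "independent (f ` I)" using B by simp
  show ?thesis unfolding rel_basis_def
  proof (intro conjI ballI allI impI)
    fix w assume "w \<in> W"
    then obtain c where "w = (\<Sum>b\<in>f ` I. scale (c b) b)"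
      using span_finite_ex[of "f ` I" w] fI sp by blast
    then have "w - (\<Sum>i\<in>I. scale (c (f i)) (f i)) \<in> {0}" using inj by (simp add: sum.reindex)
    then show "\<exists>c. w - (\<Sum>i\<in>I. scale (c i) (f i)) \<in> {0}" by (intro exI)
  next
    fix c i assume s: "(\<Sum>i\<in>I. scale (c i) (f i)) \<in> {0}" and i: "i \<in> I"
    define d where "d b = c (inv_into I f b)" for b
    have "(\<Sum>b\<in>f ` I. scale (d b) b) = 0" using s inj by (simp add: sum.reindex d_def)
    then have "d (f i) = 0" using independentD[OF ind] fI i by blast
    then show "c i = 0" using inj i by (simp add: d_def)
  qed (use fI fW in auto)
qed

lemma fin_dim_add:
  assumes "fin_dim U" "fin_dim V"
  shows "fin_dim {u + v | u v. u \<in> U \<and> v \<in> V}"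
proof -
  obtain A B where "finite A" "U \<subseteq> span A" "finite B" "V \<subseteq> span B"
    using assms unfolding fin_dim_def by blast
  then have "{u + v | u v. u \<in> U \<and> v \<in> V} \<subseteq> span (A \<union> B)" unfolding span_Un by blast
  then show ?thesis using \<open>finite A\<close> \<open>finite B\<close> unfolding fin_dim_def by blast
qed

text \<open>A lift of a basis of V/(U \<inter> V) is also a lift of a basis of (U + V)/U.\<close>

lemma dim_add_Int:
  assumes U: "subspace U" and V: "subspace V" and fU: "fin_dim U" and fV: "fin_dim V"
  shows "dim {u + v | u v. u \<in> U \<and> v \<in> V} + dim (U \<inter> V) = dim U + dim V"
proof -
  let ?W = "{u + v | u v. u \<in> U \<and> v \<in> V}"
  obtain I where I: "rel_basis (U \<inter> V) V I (\<lambda>b. b)"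
    using rel_basis_exists[of "U \<inter> V" V] subspace_inter[OF U V] V fV by blast
  have fI: "finite I" and fW: "I \<subseteq> V"
    and sp: "\<And>w. w \<in> V \<Longrightarrow> \<exists>c. w - (\<Sum>i\<in>I. scale (c i) i) \<in> U \<inter> V"
    and ind: "\<And>c i. (\<Sum>i\<in>I. scale (c i) i) \<in> U \<inter> V \<Longrightarrow> i \<in> I \<Longrightarrow> c i = 0"
    using I unfolding rel_basis_def by auto
  have V0: "V \<subseteq> ?W" "U \<subseteq> ?W" using subspace_0[OF U] subspace_0[OF V] by force+
  have "rel_basis U ?W I (\<lambda>b. b)" unfolding rel_basis_def
  proof (intro conjI ballI allI impI)
    show "finite I" by fact
    show "(\<lambda>b. b) ` I \<subseteq> ?W" using fW V0 by auto
  next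
    fix w assume "w \<in> ?W"
    then obtain u v where uv: "w = u + v" "u \<in> U" "v \<in> V" by blast
    obtain c where "v - (\<Sum>i\<in>I. scale (c i) i) \<in> U" using sp[OF uv(3)] by blast
    then have "u + (v - (\<Sum>i\<in>I. scale (c i) i)) \<in> U" using uv U subspace_add by blast
    then show "\<exists>c. w - (\<Sum>i\<in>I. scale (c i) i) \<in> U" using uv(1) by (metis add_diff_eq)
  next
    fix c i assume s: "(\<Sum>i\<in>I. scale (c i) i) \<in> U" and i: "i \<in> I"
    have "(\<Sum>i\<in>I. scale (c i) i) \<in> V" using V fW by (intro subspace_sum subspace_scale) auto
    then show "c i = 0" using ind s i by blast
  qed
  then have "dim ?W = dim U + card I"
    using rel_basis_dim U V0(2) fin_dim_add[OF fU fV] by blast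
  moreover have "dim V = dim (U \<inter> V) + card I"
    using rel_basis_dim[OF I] subspace_inter[OF U V] fV by auto
  ultimately show ?thesis by simp
qed

text \<open>A basis of \<open>U\<close> stays independent when \<open>p\<close> is adjoined, so the
  values 0 on the basis and 1 at \<open>p\<close> can be prescribed.\<close>

lemma functional_outside_subspace:
  assumes U: "subspace U" and p: "p \<notin> U"
  shows "\<exists>\<phi>. Vector_Spaces.linear scale (*) \<phi> \<and> (\<forall>u\<in>U. \<phi> u = 0) \<and> \<phi> p = 1"
proof -
  interpret f: vector_space "(*) :: 'a \<Rightarrow> 'a \<Rightarrow> 'a"
    by unfold_locales (auto simp: algebra_simps)
  interpret vp: vector_space_pair scale "(*) :: 'a \<Rightarrow> 'a \<Rightarrow> 'a" ..
  obtain A where A: "A \<subseteq> U" "independent A" "U \<subseteq> span A" using maximal_independent_subset by blast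
  have UA: "U = span A" using A U by (simp add: span_minimal subset_antisym)
  have "independent (insert p A)" using A p UA by (simp add: independent_insertI)
  then obtain \<phi> where \<phi>: "Vector_Spaces.linear scale (*) \<phi>"
    "\<And>x. x \<in> insert p A \<Longrightarrow> \<phi> x = (if x = p then 1 else 0)"
    using vp.linear_independent_extend[of "insert p A" "\<lambda>x. if x = p then 1 else 0"] by blast
  interpret l: Vector_Spaces.linear scale "(*)" \<phi> by fact
  have "\<phi> u = 0" if "u \<in> U" for u
    proof (rule l.eq_0_on_span[of A])
    show "u \<in> span A" using that UA by simp
    show "\<phi> x = 0" if "x \<in> A" for x using that \<phi>(2)[of x] p A by auto
  qed
  then show ?thesis using \<phi> by auto
qed

text \<open>A functional that kills \<open>U\<close> and is 1 at an offending \<open>p b\<close>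
  would turn the memberships into a scalar relation excluded by \<open>ind\<close>. In effect,
  linear independence over the field persists after tensoring with the quotient by
  \<open>U\<close>.\<close>

lemma coefficients_in_subspace:
  assumes U: "subspace U" and fB: "finite B"
    and ind: "\<And>l. (\<And>n. (\<Sum>b\<in>B. l b * c b n) = 0) \<Longrightarrow> \<forall>b\<in>B. l b = 0"
    and mem: "\<And>n. (\<Sum>b\<in>B. scale (c b n) (p b)) \<in> U"
    and b: "b \<in> B"
  shows "p b \<in> U"
proof (rule ccontr)
  assume "p b \<notin> U"
  then obtain \<phi> where \<phi>: "Vector_Spaces.linear scale (*) \<phi>" "\<forall>u\<in>U. \<phi> u = 0" "\<phi> (p b) = 1"
    using functional_outside_subspace U by blast
  interpret l: Vector_Spaces.linear scale "(*)" \<phi> by fact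
  have "(\<Sum>b\<in>B. \<phi> (p b) * c b n) = 0" for n
    using \<phi>(2) mem[of n] by (auto simp: l.sum l.scale mult.commute)
  then have "\<forall>b\<in>B. \<phi> (p b) = 0" by (rule ind)
  then have "\<phi> (p b) = 0" using b by blast
  then show False using \<phi>(3) by simp
qed

lemma span_family:
  assumes "finite I" "w \<in> span (f ` I)"
  shows "\<exists>c. w = (\<Sum>i\<in>I. scale (c i) (f i))"
  using assms(2)
proof (induction rule: span_induct_alt)
  case base
  show ?case by (intro exI[of _ "\<lambda>_. 0"]) simp
next
  case (step d x y)
  then obtain i c where i: "i \<in> I" "x = f i" "y = (\<Sum>i\<in>I. scale (c i) (f i))" by blast
  have "(\<Sum>k\<in>I. scale (if k = i then d else 0) (f k)) = (\<Sum>k\<in>I. if k = i then scale d (f k) else 0)"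
    by (rule sum.cong) auto
  also have "\<dots> = scale d x" using i assms(1) by simp
  finally have "scale d x + y = (\<Sum>k\<in>I. scale ((if k = i then d else 0) + c k) (f k))"
    using i by (simp add: scale_left_distrib sum.distrib)
  then show ?case by (intro exI[of _ "\<lambda>k. (if k = i then d else 0) + c k"])
qed

lemma rel_basisI:
  assumes "finite I" "f ` I \<subseteq> W"
    and "\<And>w. w \<in> W \<Longrightarrow> \<exists>s\<in>span (f ` I). w - s \<in> U"
    and "\<And>c i. (\<Sum>i\<in>I. scale (c i) (f i)) \<in> U \<Longrightarrow> i \<in> I \<Longrightarrow> c i = 0"
  shows "rel_basis U W I f"
  unfolding rel_basis_def
proof (intro conjI ballI allI impI)
  fix w assume "w \<in> W"
  then obtain s where s: "s \<in> span (f ` I)" "w - s \<in> U" using assms(3) by blast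
  then show "\<exists>c. w - (\<Sum>i\<in>I. scale (c i) (f i)) \<in> U" using span_family[OF assms(1) s(1)] by blast
qed (use assms in auto)

lemma rel_basisD:
  assumes "rel_basis U W I f"
  shows "finite I" "i \<in> I \<Longrightarrow> f i \<in> W"
    "w \<in> W \<Longrightarrow> \<exists>s\<in>span (f ` I). w - s \<in> U"
    "(\<Sum>i\<in>I. scale (c i) (f i)) \<in> U \<Longrightarrow> i \<in> I \<Longrightarrow> c i = 0"
proof -
  show "finite I" "i \<in> I \<Longrightarrow> f i \<in> W" "(\<Sum>i\<in>I. scale (c i) (f i)) \<in> U \<Longrightarrow> i \<in> I \<Longrightarrow> c i = 0"
    using assms unfolding rel_basis_def by blast+
  assume "w \<in> W"
  then obtain c where c: "w - (\<Sum>i\<in>I. scale (c i) (f i)) \<in> U" using assms unfolding rel_basis_def by blast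
  have "(\<Sum>i\<in>I. scale (c i) (f i)) \<in> span (f ` I)" by (intro span_sum span_scale span_base) simp
  then show "\<exists>s\<in>span (f ` I). w - s \<in> U" using c by blast
qed

lemma dim_zero: "dim {0} = 0"
  by (rule dim_unique[of "{}"]) (simp_all add: independent_empty)

lemma rel_basis_zero_dim:
  assumes "rel_basis {0} W I f"
  shows "dim W = card I"
proof -
  have fd: "fin_dim W" unfolding fin_dim_def
  proof (intro exI conjI subsetI)
    show "finite (f ` I)" using rel_basisD(1)[OF assms] by simp
    fix w assume "w \<in> W"
    then show "w \<in> span (f ` I)" using rel_basisD(3)[OF assms] by fastforce
  qed
  show ?thesis
  proof (cases "W = {}")
    case True
    then have "I = {}" using rel_basisD(2)[OF assms] by blast
    moreover have "dim {} = 0" by (rule dim_unique[of "{}"]) (simp_all add: independent_empty)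
    ultimately show ?thesis using True by simp
  next
    case False
    \<comment> \<open>\<open>rel_basis_dim\<close> asks for \<open>{0} \<subseteq> W\<close>, while
      \<open>W\<close> is an arbitrary set here; adjoining zero does not change its span.\<close>
    have 1: "rel_basis {0} (insert 0 W) I f"
    proof (rule rel_basisI)
      fix w assume "w \<in> insert 0 W"
      then show "\<exists>s\<in>span (f ` I). w - s \<in> {0}"
        using rel_basisD(3)[OF assms, of w] span_zero[of "f ` I"] by (cases "w = 0") force+
    qed (use rel_basisD[OF assms] in auto)
    have "fin_dim (insert 0 W)" using fd span_zero unfolding fin_dim_def by blast
    then have "dim (insert 0 W) = card I"
      using rel_basis_dim[OF 1] dim_zero by simp
    moreover have "dim (insert 0 W) = dim W" by (rule span_eq_dim) simp
    ultimately show ?thesis by simp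
  qed
qed

lemma dim_mono:
  assumes "subspace U" "subspace W" "U \<subseteq> W" "fin_dim W"
  shows "dim U \<le> dim W"
  using rel_basis_exists[OF assms(1,3,2,4)] rel_basis_dim[OF _ assms(1,3,4)] by fastforce

lemma dim_injective_image:
  assumes W: "subspace W" "fin_dim W"
    and t: "\<And>x y. t (x + y) = t x + t y" "\<And>c x. t (scale c x) = scale c (t x)"
      "\<And>x. x \<in> W \<Longrightarrow> t x = 0 \<Longrightarrow> x = 0"
  shows "dim (t ` W) = dim W" and "fin_dim (t ` W)" and "subspace (t ` W)"
proof -
  have t0: "t 0 = 0" using t(1)[of 0 0] by simp
  have ts: "t (\<Sum>i\<in>I. scale (c i) (f i)) = (\<Sum>i\<in>I. scale (c i) (t (f i)))" for I :: "'b set" and c f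
    by (induction I rule: infinite_finite_induct) (auto simp: t0 t)
  have td: "t (x - y) = t x - t y" for x y using t(1)[of "x - y" y] by simp
  obtain I where I: "rel_basis {0} W I (\<lambda>b. b)"
    using rel_basis_exists[of "{0}" W] W subspace_0 by auto
  have tspan: "t x \<in> span (t ` I)" if "x \<in> span I" for x
    using that
  proof (induction rule: span_induct_alt)
    case base
    show ?case by (simp add: t0 span_zero)
  next
    case (step c x y)
    then show ?case by (auto simp: t intro: span_add span_scale span_base)
  qed
  have sp: "w \<in> span I" if "w \<in> W" for w using rel_basisD(3)[OF I that] by auto
  have "rel_basis {0} (t ` W) I t"
  proof (rule rel_basisI)
    fix w assume "w \<in> t ` W"
    then show "\<exists>s\<in>span (t ` I). w - s \<in> {0}" using tspan sp by auto
  next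
    fix c i assume "(\<Sum>i\<in>I. scale (c i) (t i)) \<in> {0}" and i: "i \<in> I"
    then have "t (\<Sum>i\<in>I. scale (c i) i) = 0" using ts[of c "\<lambda>i. i" I] by simp
    moreover have "(\<Sum>i\<in>I. scale (c i) i) \<in> W"
      using rel_basisD(2)[OF I] W by (intro subspace_sum subspace_scale) auto
    ultimately show "c i = 0" using t(3) rel_basisD(4)[OF I, of c i] i by simp
  qed (use rel_basisD[OF I] in auto)
  then show "dim (t ` W) = dim W" using rel_basis_zero_dim[OF I] rel_basis_zero_dim by metis
  show "fin_dim (t ` W)" unfolding fin_dim_def
    using tspan sp rel_basisD(1)[OF I] by (intro exI[of _ "t ` I"]) auto
  show "subspace (t ` W)"
  proof (rule subspaceI)
    show "0 \<in> t ` W" using t0 subspace_0[OF W(1)] by force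
    show "x + y \<in> t ` W" if "x \<in> t ` W" "y \<in> t ` W" for x y
      using that t(1)[symmetric] subspace_add[OF W(1)] by auto
    show "scale c x \<in> t ` W" if "x \<in> t ` W" for x c
      using that t(2)[symmetric] subspace_scale[OF W(1)] by auto
  qed
qed

end

section \<open>Polynomial rings and their ideals\<close>

text \<open>Any linear order on the variables would do: it orders the monomials, which provides leading
  monomials and makes \<open>'k mpoly\<close> an integral domain.\<close>

instantiation var :: linorder
begin

fun var_code :: "var \<Rightarrow> nat" where
  "var_code (Xvar i) = 2 * i"
| "var_code (Yvar i) = 2 * i + 1"

definition less_eq_var :: "var \<Rightarrow> var \<Rightarrow> bool" where
  "less_eq_var v w \<longleftrightarrow> var_code v \<le> var_code w"

definition less_var :: "var \<Rightarrow> var \<Rightarrow> bool" where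
  "less_var v w \<longleftrightarrow> var_code v < var_code w"

instance
proof
  have inj: "v = w" if "var_code v = var_code w" for v w
    using that by (cases v; cases w) (auto, presburger+)
  fix v w :: var
  assume "v \<le> w" "w \<le> v"
  then show "v = w" using inj by (simp add: less_eq_var_def)
qed (auto simp: less_eq_var_def less_var_def)

end

section \<open>Supports and coefficients of polynomials\<close>

abbreviation lookup where "lookup \<equiv> Poly_Mapping.lookup"
abbreviation keys where "keys \<equiv> Poly_Mapping.keys"
abbreviation single where "single \<equiv> Poly_Mapping.single"
abbreviation polys :: "var set \<Rightarrow> 'k::field mpoly set" where
  "polys V \<equiv> carrier (poly_ring V)"

text \<open>Applied at two levels: on polynomials it selects monomials, on monomials it selects
  variables.\<close>

definition restr :: "'a set \<Rightarrow> ('a \<Rightarrow>\<^sub>0 'b::zero) \<Rightarrow> ('a \<Rightarrow>\<^sub>0 'b)" where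
  "restr A p = Abs_poly_mapping (\<lambda>a. if a \<in> A then lookup p a else 0)"

lemma lookup_restr: "lookup (restr A p) a = (if a \<in> A then lookup p a else 0)"
proof -
  have "finite {a. (if a \<in> A then lookup p a else 0) \<noteq> 0}"
    by (rule finite_subset[OF _ finite_keys[of p]]) (auto simp: in_keys_iff split: if_splits)
  then show ?thesis by (simp add: restr_def)
qed

lemma keys_restr: "keys (restr A p) = keys p \<inter> A"
  by (auto simp: in_keys_iff lookup_restr split: if_splits)

lemma restr_add: "restr A (p + q) = restr A p + restr A (q :: _ \<Rightarrow>\<^sub>0 _::comm_monoid_add)"
  by (rule poly_mapping_eqI) (simp add: lookup_restr lookup_add)

lemma restr_zero [simp]: "restr A 0 = 0"
  by (rule poly_mapping_eqI) (simp add: lookup_restr)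

lemma restr_compl: "restr A p + restr (- A) p = (p :: _ \<Rightarrow>\<^sub>0 _::comm_monoid_add)"
  by (rule poly_mapping_eqI) (simp add: lookup_restr lookup_add)

lemma restr_eq_self: "keys p \<subseteq> A \<Longrightarrow> restr A p = p"
  by (rule poly_mapping_eqI) (auto simp: lookup_restr in_keys_iff)

lemma restr_eq_0: "keys p \<inter> A = {} \<Longrightarrow> restr A p = 0"
  by (rule poly_mapping_eqI) (auto simp: lookup_restr in_keys_iff)

lemma keys_mon_add: "keys (\<mu> + \<nu> :: mon) = keys \<mu> \<union> keys \<nu>"
  by (auto simp: in_keys_iff lookup_add)

lemma mpoly_eq_sum_single: "p = (\<Sum>\<mu>\<in>keys p. single \<mu> (lookup p \<mu>))"
  by (rule poly_mapping_eqI)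
    (simp add: lookup_sum lookup_single when_def sum.delta' in_keys_iff cong: if_cong)

lemma mpoly_induct [case_names zero add]:
  assumes "Q 0" and "\<And>p \<mu> c. Q p \<Longrightarrow> Q (single \<mu> c + p)"
  shows "Q (p :: 'k::field mpoly)"
proof -
  have "Q (\<Sum>\<mu>\<in>A. single \<mu> (lookup p \<mu>))" if "finite A" for A
    using that by (induction A) (use assms in auto)
  from this[OF finite_keys[of p]] show ?thesis by (subst mpoly_eq_sum_single)
qed

text \<open>Subtraction of exponents is truncated, hence the divisibility test that guards the
  quotient monomial.\<close>

lemma lookup_single_times:
  "lookup (single \<nu> c * p) \<mu> = (if \<exists>\<kappa>. \<mu> = \<nu> + \<kappa> then c * lookup p (\<mu> - \<nu>) else 0)"
  for p :: "'k::field mpoly"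
proof (induction p rule: mpoly_induct)
  case (add p \<kappa> d)
  have "lookup (single \<nu> c * single \<kappa> d) \<mu> =
      (if \<exists>\<kappa>. \<mu> = \<nu> + \<kappa> then c * lookup (single \<kappa> d) (\<mu> - \<nu>) else 0)"
  proof (cases "\<exists>\<kappa>. \<mu> = \<nu> + \<kappa>")
    case True
    then obtain \<kappa>' where "\<mu> = \<nu> + \<kappa>'" by blast
    then show ?thesis by (auto simp: mult_single lookup_single when_def)
  next
    case False
    then have "\<nu> + \<kappa> \<noteq> \<mu>" by blast
    with False show ?thesis by (simp add: mult_single lookup_single when_def)
  qed
  then show ?case using add by (auto simp: distrib_left lookup_add)
qed simp

lemma lookup_single_times_add [simp]:
  "lookup (single \<nu> c * p) (\<nu> + \<kappa>) = c * lookup p \<kappa>"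
  for p :: "'k::field mpoly"
  by (auto simp: lookup_single_times)

lemma lookup_const_times [simp]: "lookup (const c * p) \<mu> = c * lookup p \<mu>"
  using lookup_single_times_add[of 0 c p \<mu>] by (simp add: const_def)

lemma lookup_kscale [simp]: "lookup (kscale c p) \<mu> = c * lookup p \<mu>"
  by (simp add: kscale_def)

lemma keys_single_times:
  "c \<noteq> 0 \<Longrightarrow> keys (single \<nu> c * p) = (+) \<nu> ` keys p" for p :: "'k::field mpoly"
proof -
  assume c: "c \<noteq> 0"
  have "\<mu> \<in> keys (single \<nu> c * p) \<longleftrightarrow> (\<exists>\<kappa>\<in>keys p. \<mu> = \<nu> + \<kappa>)" for \<mu>
  proof (cases "\<exists>\<kappa>. \<mu> = \<nu> + \<kappa>")
    case True
    then obtain \<kappa> where "\<mu> = \<nu> + \<kappa>" by blast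
    then show ?thesis using c by (auto simp: in_keys_iff)
  next
    case False
    then have "lookup (single \<nu> c * p) \<mu> = 0" by (subst lookup_single_times) simp
    then show ?thesis using False by (auto simp: in_keys_iff)
  qed
  then show ?thesis by blast
qed

lemma keys_kscale: "c \<noteq> 0 \<Longrightarrow> keys (kscale c p) = keys p"
  by (auto simp: in_keys_iff)

lemma const_mult: "const (c * d) = const c * const d"
  by (simp add: const_def mult_single)

lemma const_add: "const (c + d) = const c + const d"
  by (simp add: const_def single_add)

lemma const_simps [simp]: "const 0 = 0" "const 1 = 1"
  by (simp_all add: const_def)

interpretation mp: relative_bases "kscale :: 'k::field \<Rightarrow> 'k mpoly \<Rightarrow> 'k mpoly"
  by unfold_locales (auto simp: kscale_def algebra_simps const_mult const_add)

lemma kscale_mult_left: "kscale c p * q = kscale c (p * q)"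
  and kscale_mult_right: "p * kscale c q = kscale c (p * q)"
  by (simp_all add: kscale_def algebra_simps)

lemma polys_iff: "p \<in> polys V \<longleftrightarrow> (\<forall>\<mu>\<in>keys p. keys \<mu> \<subseteq> V)"
  by (simp add: poly_ring_def)

lemma polys_zero: "0 \<in> polys V" and polys_one: "1 \<in> polys V"
  by (simp_all add: polys_iff)

lemma polys_add: "p \<in> polys V \<Longrightarrow> q \<in> polys V \<Longrightarrow> p + q \<in> polys V"
  unfolding polys_iff using keys_add[of p q] by blast

lemma polys_uminus: "p \<in> polys V \<Longrightarrow> - p \<in> polys V"
  unfolding polys_iff by simp

lemma polys_mult: "p \<in> polys V \<Longrightarrow> q \<in> polys V \<Longrightarrow> p * q \<in> polys V"
  unfolding polys_iff using keys_mult[of p q] by (fastforce simp: keys_mon_add)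

lemma polys_sum: "(\<And>i. i \<in> I \<Longrightarrow> f i \<in> polys V) \<Longrightarrow> (\<Sum>i\<in>I. f i) \<in> polys V"
  by (induction I rule: infinite_finite_induct) (auto intro: polys_zero polys_add)

lemma polys_single: "keys \<mu> \<subseteq> V \<Longrightarrow> single \<mu> c \<in> polys V"
  by (auto simp: polys_iff)

lemma polys_const: "const c \<in> polys V"
  by (simp add: const_def polys_single)

lemma polys_mono: "V \<subseteq> W \<Longrightarrow> polys V \<subseteq> polys W"
  unfolding subset_iff polys_iff by blast

lemma polys_induct [consumes 1, case_names zero add]:
  assumes "p \<in> polys V" and "Q 0"
    and "\<And>p \<mu> c. p \<in> polys V \<Longrightarrow> keys \<mu> \<subseteq> V \<Longrightarrow> Q p \<Longrightarrow> Q (single \<mu> c + p)"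
  shows "Q p"
proof -
  have "Q (\<Sum>\<mu>\<in>A. single \<mu> (lookup p \<mu>))" if "finite A" "A \<subseteq> keys p" for A
    using that
  proof (induction A)
    case (insert \<mu> A)
    have "\<And>\<nu>. \<nu> \<in> insert \<mu> A \<Longrightarrow> keys \<nu> \<subseteq> V" using insert assms(1) by (auto simp: polys_iff)
    then show ?case using insert
      by (auto intro!: assms(3) polys_sum polys_single)
  qed (use assms in auto)
  from this[OF finite_keys[of p]] show ?thesis by (subst mpoly_eq_sum_single) simp
qed

section \<open>Ideals of polynomial rings\<close>

lemma poly_ring_simps [simp]:
  "monoid.mult (poly_ring V) = (*)" "add (poly_ring V) = (+)"
  "one (poly_ring V) = 1" "zero (poly_ring V) = 0"
  by (simp_all add: poly_ring_def)

lemma poly_ring_cring: "cring (poly_ring V :: 'k::field mpoly ring)"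
proof (rule cringI)
  show "abelian_group (poly_ring V :: 'k mpoly ring)"
  proof (rule abelian_groupI)
    fix x :: "'k mpoly" assume "x \<in> polys V"
    then show "\<exists>y\<in>polys V. y \<oplus>\<^bsub>poly_ring V\<^esub> x = \<zero>\<^bsub>poly_ring V\<^esub>"
      by (intro bexI[of _ "- x"]) (auto intro: polys_uminus)
  qed (simp_all add: polys_add polys_zero add.assoc add.commute)
  show "Group.comm_monoid (poly_ring V :: 'k mpoly ring)"
    by (rule comm_monoidI) (simp_all add: polys_mult polys_one mult.assoc mult.commute)
qed (simp add: distrib_right)

text \<open>Ideals of \<open>poly_ring V\<close> written with the type-class operations;
  \<open>is_ideal_ideal\<close> and \<open>ideal_is_ideal\<close> translate to and from ideals of
  the ring structure.\<close>

definition is_ideal :: "var set \<Rightarrow> 'k::field mpoly set \<Rightarrow> bool" where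
  "is_ideal V J \<longleftrightarrow> J \<subseteq> polys V \<and> 0 \<in> J \<and> (\<forall>p\<in>J. \<forall>q\<in>J. p + q \<in> J) \<and>
     (\<forall>p\<in>polys V. \<forall>q\<in>J. p * q \<in> J)"

lemma is_idealD:
  assumes "is_ideal V J"
  shows "J \<subseteq> polys V" "0 \<in> J" "p \<in> J \<Longrightarrow> q \<in> J \<Longrightarrow> p + q \<in> J"
    "r \<in> polys V \<Longrightarrow> q \<in> J \<Longrightarrow> r * q \<in> J" "q \<in> J \<Longrightarrow> kscale c q \<in> J" "q \<in> J \<Longrightarrow> - q \<in> J"
proof -
  show "J \<subseteq> polys V" "0 \<in> J" "p \<in> J \<Longrightarrow> q \<in> J \<Longrightarrow> p + q \<in> J"
    and m: "\<And>r q. r \<in> polys V \<Longrightarrow> q \<in> J \<Longrightarrow> r * q \<in> J"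
    using assms unfolding is_ideal_def by blast+
  show "q \<in> J \<Longrightarrow> kscale c q \<in> J" using m polys_const by (auto simp: kscale_def)
  show "q \<in> J \<Longrightarrow> - q \<in> J" using m[of "-1" q] polys_uminus[OF polys_one] by auto
qed

lemma is_ideal_sum:
  "is_ideal V J \<Longrightarrow> (\<And>i. i \<in> I \<Longrightarrow> f i \<in> J) \<Longrightarrow> (\<Sum>i\<in>I. f i) \<in> J"
  by (induction I rule: infinite_finite_induct) (auto intro: is_idealD)

lemma is_ideal_subspace: "is_ideal V J \<Longrightarrow> mp.subspace J"
  by (rule mp.subspaceI) (auto intro: is_idealD)

lemma is_ideal_ideal:
  fixes J :: "'k::field mpoly set"
  assumes J: "is_ideal V J"
  shows "ideal J (poly_ring V)"
proof -
  interpret cring "poly_ring V :: 'k mpoly ring" by (rule poly_ring_cring)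
  show ?thesis
  proof (rule idealI)
    show "ring (poly_ring V :: 'k mpoly ring)" by (rule ring_axioms)
    show "subgroup J (add_monoid (poly_ring V))"
    proof (rule add.subgroupI)
      fix x assume x: "x \<in> J"
      then have "x \<in> polys V" using is_idealD(1)[OF J] by blast
      then have "\<ominus>\<^bsub>poly_ring V\<^esub> x = - x"
        using minus_equality[of "- x" x] polys_uminus[of x V] by simp
      then show "\<ominus>\<^bsub>poly_ring V\<^esub> x \<in> J" using is_idealD(6)[OF J x] by simp
    qed (use is_idealD[OF J] in auto)
    fix a x :: "'k mpoly" assume a: "a \<in> J" "x \<in> carrier (poly_ring V)"
    show "x \<otimes>\<^bsub>poly_ring V\<^esub> a \<in> J" using is_idealD(4)[OF J a(2,1)] by simp
    then show "a \<otimes>\<^bsub>poly_ring V\<^esub> x \<in> J" by (simp add: mult.commute)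
  qed
qed

lemma ideal_is_ideal:
  assumes "ideal J (poly_ring V)"
  shows "is_ideal V J"
proof -
  interpret ideal J "poly_ring V" by fact
  show ?thesis unfolding is_ideal_def
    using a_subset zero_closed additive_subgroup.zero_closed[OF is_additive_subgroup]
      additive_subgroup.a_closed[OF is_additive_subgroup] I_l_closed by auto
qed

lemma poly_ring_ring: "ring (poly_ring V)"
  using poly_ring_cring by (rule cring.axioms(1))

lemma genideal_is_ideal: "A \<subseteq> polys V \<Longrightarrow> is_ideal V (Idl\<^bsub>poly_ring V\<^esub> A)"
  using ideal_is_ideal ring.genideal_ideal[OF poly_ring_ring] by blast

lemma genideal_superset: "A \<subseteq> polys V \<Longrightarrow> A \<subseteq> Idl\<^bsub>poly_ring V\<^esub> A"
  by (rule ring.genideal_self[OF poly_ring_ring])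

lemma genideal_least: "is_ideal V J \<Longrightarrow> A \<subseteq> J \<Longrightarrow> Idl\<^bsub>poly_ring V\<^esub> A \<subseteq> J"
  by (rule ring.genideal_minimal[OF poly_ring_ring is_ideal_ideal])

lemma is_ideal_plus:
  assumes I: "is_ideal V I" and J: "is_ideal V J"
  shows "is_ideal V {p + q | p q. p \<in> I \<and> q \<in> J}"
  unfolding is_ideal_def
proof (intro conjI ballI)
  show "{p + q | p q. p \<in> I \<and> q \<in> J} \<subseteq> polys V"
    using is_idealD(1)[OF I] is_idealD(1)[OF J] by (auto intro!: polys_add)
  show "0 \<in> {p + q | p q. p \<in> I \<and> q \<in> J}"
    using is_idealD(2)[OF I] is_idealD(2)[OF J] by force
next
  fix p q assume "p \<in> {p + q | p q. p \<in> I \<and> q \<in> J}" "q \<in> {p + q | p q. p \<in> I \<and> q \<in> J}"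
  then obtain p1 p2 q1 q2 where "p = p1 + p2" "q = q1 + q2" and
    m: "p1 \<in> I" "p2 \<in> J" "q1 \<in> I" "q2 \<in> J" by blast
  then have "p + q = (p1 + q1) + (p2 + q2)" by simp
  then show "p + q \<in> {p + q | p q. p \<in> I \<and> q \<in> J}"
    using is_idealD(3)[OF I m(1,3)] is_idealD(3)[OF J m(2,4)] by blast
next
  fix r p :: "'a mpoly"
  assume r: "r \<in> polys V" and "p \<in> {p + q | p q. p \<in> I \<and> q \<in> J}"
  then obtain p1 p2 where p: "p = p1 + p2" "p1 \<in> I" "p2 \<in> J" by blast
  then have "r * p = r * p1 + r * p2" by (simp add: distrib_left)
  then show "r * p \<in> {p + q | p q. p \<in> I \<and> q \<in> J}"
    using is_idealD(4)[OF I r] is_idealD(4)[OF J r] p by blast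
qed

section \<open>Bidegrees and homogeneous components\<close>

lemma xdeg_superset:
  "finite A \<Longrightarrow> keys \<mu> \<subseteq> A \<Longrightarrow>
    xdeg \<mu> = (\<Sum>v\<in>A. case v of Xvar i \<Rightarrow> lookup \<mu> v | Yvar i \<Rightarrow> 0)"
  unfolding xdeg_def by (rule sum.mono_neutral_left) (auto simp: in_keys_iff split: var.splits)

lemma ydeg_superset:
  "finite A \<Longrightarrow> keys \<mu> \<subseteq> A \<Longrightarrow>
    ydeg \<mu> = (\<Sum>v\<in>A. case v of Xvar i \<Rightarrow> 0 | Yvar i \<Rightarrow> lookup \<mu> v)"
  unfolding ydeg_def by (rule sum.mono_neutral_left) (auto simp: in_keys_iff split: var.splits)

lemma xdeg_add [simp]: "xdeg (\<mu> + \<nu>) = xdeg \<mu> + xdeg \<nu>"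
proof -
  let ?A = "keys \<mu> \<union> keys \<nu>"
  have "xdeg (\<mu> + \<nu>) = (\<Sum>v\<in>?A. case v of Xvar i \<Rightarrow> lookup (\<mu> + \<nu>) v | Yvar i \<Rightarrow> 0)"
    by (rule xdeg_superset) (auto simp: keys_mon_add)
  also have "\<dots> = xdeg \<mu> + xdeg \<nu>"
    by (subst (1 2) xdeg_superset[of ?A])
      (auto simp: lookup_add sum.distrib[symmetric] intro!: sum.cong split: var.splits)
  finally show ?thesis .
qed

lemma ydeg_add [simp]: "ydeg (\<mu> + \<nu>) = ydeg \<mu> + ydeg \<nu>"
proof -
  let ?A = "keys \<mu> \<union> keys \<nu>"
  have "ydeg (\<mu> + \<nu>) = (\<Sum>v\<in>?A. case v of Xvar i \<Rightarrow> 0 | Yvar i \<Rightarrow> lookup (\<mu> + \<nu>) v)"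
    by (rule ydeg_superset) (auto simp: keys_mon_add)
  also have "\<dots> = ydeg \<mu> + ydeg \<nu>"
    by (subst (1 2) ydeg_superset[of ?A])
      (auto simp: lookup_add sum.distrib[symmetric] intro!: sum.cong split: var.splits)
  finally show ?thesis .
qed

lemma deg_zero [simp]: "xdeg 0 = 0" "ydeg 0 = 0"
  by (simp_all add: xdeg_def ydeg_def)

lemma deg_single [simp]:
  "xdeg (single (Xvar i) n) = n" "ydeg (single (Xvar i) n) = 0"
  "xdeg (single (Yvar i) n) = 0" "ydeg (single (Yvar i) n) = n"
  by (cases "n = 0"; simp add: xdeg_def ydeg_def)+

definition mons :: "var set \<Rightarrow> nat \<Rightarrow> nat \<Rightarrow> mon set" where
  "mons V i j = {\<mu>. keys \<mu> \<subseteq> V \<and> xdeg \<mu> = i \<and> ydeg \<mu> = j}"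

lemma lookup_le_deg: "lookup \<mu> v \<le> xdeg \<mu> + ydeg \<mu>"
proof (cases "v \<in> keys \<mu>")
  case True
  show ?thesis
  proof (cases v)
    case (Xvar i)
    have "lookup \<mu> v \<le> xdeg \<mu>" unfolding xdeg_def
      by (rule order_trans[OF _ member_le_sum[OF True]]) (auto simp: Xvar split: var.splits)
    then show ?thesis by simp
  next
    case (Yvar i)
    have "lookup \<mu> v \<le> ydeg \<mu>" unfolding ydeg_def
      by (rule order_trans[OF _ member_le_sum[OF True]]) (auto simp: Yvar split: var.splits)
    then show ?thesis by simp
  qed
qed (simp add: in_keys_iff)

text \<open>The exponents of such a monomial are at most i + j by \<open>lookup_le_deg\<close> and
  vanish outside \<open>V\<close>.\<close>

lemma finite_mons:
  assumes "finite V"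
  shows "finite (mons V i j)"
proof (rule finite_imageD)
  show "finite (lookup ` mons V i j)"
  proof (rule finite_subset)
    have "lookup \<mu> v \<le> i + j" "v \<notin> V \<Longrightarrow> lookup \<mu> v = 0" if "\<mu> \<in> mons V i j" for \<mu> v
    proof -
      show "lookup \<mu> v \<le> i + j" using lookup_le_deg[of \<mu> v] that by (simp add: mons_def)
      show "lookup \<mu> v = 0" if "v \<notin> V"
        using that \<open>\<mu> \<in> mons V i j\<close> in_keys_iff[of v \<mu>] unfolding mons_def by blast
    qed
    then show "lookup ` mons V i j \<subseteq> {f. \<forall>v. (v \<in> V \<longrightarrow> f v \<in> {..i+j}) \<and> (v \<notin> V \<longrightarrow> f v = 0)}"
      by auto
    show "finite {f. \<forall>v. (v \<in> V \<longrightarrow> f v \<in> {..i+j}) \<and> (v \<notin> V \<longrightarrow> f v = 0)}"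
      using assms by (rule finite_set_of_finite_funs) simp
  qed
  show "inj_on lookup (mons V i j)" by (rule inj_onI) (rule poly_mapping_eq_iff[THEN iffD2])
qed

lemma bigraded_part_iff: "p \<in> bigraded_part V i j \<longleftrightarrow> keys p \<subseteq> mons V i j"
  by (simp add: bigraded_part_def bihomogeneous_def polys_iff mons_def subset_eq[of "keys p"]
      ball_conj_distrib)

lemma bigraded_part_polys: "bigraded_part V i j \<subseteq> polys V"
  by (auto simp: bigraded_part_def)

lemma bigraded_part_subspace: "mp.subspace (bigraded_part V i j)"
proof (rule mp.subspaceI)
  fix p q :: "'a mpoly" and c :: 'a
  assume p: "p \<in> bigraded_part V i j" and q: "q \<in> bigraded_part V i j"
  show "p + q \<in> bigraded_part V i j"
    using keys_add[of p q] p q by (auto simp: bigraded_part_iff)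
  show "kscale c p \<in> bigraded_part V i j"
    using p keys_kscale[of c p] by (cases "c = 0") (auto simp: bigraded_part_iff kscale_def)
qed (simp add: bigraded_part_iff)

lemma bigraded_part_single:
  "keys \<mu> \<subseteq> V \<Longrightarrow> single \<mu> c \<in> bigraded_part V (xdeg \<mu>) (ydeg \<mu>)"
  by (auto simp: bigraded_part_iff mons_def)

lemma bigraded_part_mult:
  "p \<in> bigraded_part V i j \<Longrightarrow> q \<in> bigraded_part V k l \<Longrightarrow> p * q \<in> bigraded_part V (i + k) (j + l)"
  unfolding bigraded_part_iff using keys_mult[of p q]
  by (fastforce simp: mons_def keys_mon_add)

lemma bigraded_part_mono: "V \<subseteq> W \<Longrightarrow> bigraded_part V i j \<subseteq> bigraded_part W i j"
  unfolding subset_iff[of "bigraded_part V i j"] bigraded_part_iff by (auto simp: mons_def)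

lemma single_eq_kscale: "single \<mu> c = kscale c (single \<mu> 1)"
  by (simp add: kscale_def const_def mult_single)

lemma bigraded_part_span:
  "bigraded_part V i j \<subseteq> mp.span ((\<lambda>\<mu>. single \<mu> (1::'k::field)) ` mons V i j)"
proof
  fix p :: "'k mpoly" assume p: "p \<in> bigraded_part V i j"
  have "(\<Sum>\<mu>\<in>keys p. kscale (lookup p \<mu>) (single \<mu> 1)) \<in> mp.span ((\<lambda>\<mu>. single \<mu> 1) ` mons V i j)"
    using p by (intro mp.span_sum mp.span_scale mp.span_base) (auto simp: bigraded_part_iff)
  then show "p \<in> mp.span ((\<lambda>\<mu>. single \<mu> 1) ` mons V i j)"
    using mpoly_eq_sum_single[of p] by (simp add: single_eq_kscale[symmetric])
qed

lemma bigraded_part_fin_dim: "finite V \<Longrightarrow> mp.fin_dim (bigraded_part V i j)"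
  unfolding mp.fin_dim_def
  by (intro exI conjI) (rule finite_imageI, erule finite_mons, rule bigraded_part_span)

definition bipart :: "nat \<Rightarrow> nat \<Rightarrow> 'k::field mpoly \<Rightarrow> 'k mpoly" where
  "bipart i j p = restr {\<mu>. xdeg \<mu> = i \<and> ydeg \<mu> = j} p"

lemma lookup_bipart: "lookup (bipart i j p) \<mu> = (if xdeg \<mu> = i \<and> ydeg \<mu> = j then lookup p \<mu> else 0)"
  by (simp add: bipart_def lookup_restr)

lemma bipart_mem: "p \<in> polys V \<Longrightarrow> bipart i j p \<in> bigraded_part V i j"
  by (auto simp: bigraded_part_iff bipart_def keys_restr mons_def polys_iff)

lemma bipart_self: "p \<in> bigraded_part V i j \<Longrightarrow> bipart i j p = p"
  unfolding bipart_def by (rule restr_eq_self) (auto simp: bigraded_part_iff mons_def)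

lemma bipart_add: "bipart i j (p + q) = bipart i j p + bipart i j q"
  by (simp add: bipart_def restr_add)

definition is_bigraded :: "'k::field mpoly set \<Rightarrow> bool" where
  "is_bigraded J \<longleftrightarrow> (\<forall>p\<in>J. \<forall>i j. bipart i j p \<in> J)"

text \<open>The polynomial ring over \<open>U\<close> and further variables is free over the one over \<open>U\<close>, with
  basis the monomials \<open>\<nu>\<close> in the further variables; this is the coefficient at \<open>\<nu>\<close>.\<close>

definition mcoeff :: "var set \<Rightarrow> mon \<Rightarrow> 'k::field mpoly \<Rightarrow> 'k mpoly" where
  "mcoeff U \<nu> p = Abs_poly_mapping (\<lambda>\<mu>. if keys \<mu> \<subseteq> U then lookup p (\<mu> + \<nu>) else 0)"

lemma lookup_mcoeff: "lookup (mcoeff U \<nu> p) \<mu> = (if keys \<mu> \<subseteq> U then lookup p (\<mu> + \<nu>) else 0)"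
proof -
  have "finite ((\<lambda>\<mu>. \<mu> + \<nu>) -` keys p)" by (rule finite_vimageI) (auto simp: inj_on_def)
  then have "finite {\<mu>. (if keys \<mu> \<subseteq> U then lookup p (\<mu> + \<nu>) else 0) \<noteq> 0}"
    by (rule rev_finite_subset) (auto simp: in_keys_iff split: if_splits)
  then show ?thesis by (simp add: mcoeff_def)
qed

lemma mcoeff_polys: "mcoeff U \<nu> p \<in> polys U"
proof -
  have "keys \<mu> \<subseteq> U" if "\<mu> \<in> keys (mcoeff U \<nu> p)" for \<mu>
    using that by (cases "keys \<mu> \<subseteq> U") (simp_all add: in_keys_iff[of \<mu>] lookup_mcoeff)
  then show ?thesis by (simp add: polys_iff)
qed

lemma mcoeff_add: "mcoeff U \<nu> (p + q) = mcoeff U \<nu> p + mcoeff U \<nu> q"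
  by (rule poly_mapping_eqI) (simp add: lookup_mcoeff lookup_add)

lemma mcoeff_zero [simp]: "mcoeff U \<nu> 0 = 0"
  by (rule poly_mapping_eqI) (simp add: lookup_mcoeff)

lemma mcoeff_kscale: "mcoeff U \<nu> (kscale c p) = kscale c (mcoeff U \<nu> p)"
  by (rule poly_mapping_eqI) (simp add: lookup_mcoeff)

lemma mcoeff_sum: "mcoeff U \<nu> (\<Sum>i\<in>I. f i) = (\<Sum>i\<in>I. mcoeff U \<nu> (f i))"
  by (induction I rule: infinite_finite_induct) (auto simp: mcoeff_add)

text \<open>The monomials form the product of the monoids of monomials in the variables of
  \<open>U\<close> and in the remaining ones, so divisibility is tested on each factor.\<close>

lemma mon_adds_split:
  fixes \<mu> \<kappa> \<nu> \<rho> :: mon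
  assumes "keys \<kappa> \<subseteq> U" "keys \<nu> \<inter> U = {}"
  shows "(\<exists>\<rho>. \<kappa> + \<nu> = \<mu> + \<rho>) \<longleftrightarrow>
    (\<exists>\<rho>. \<kappa> = restr U \<mu> + \<rho>) \<and> (\<exists>\<rho>. \<nu> = restr (- U) \<mu> + \<rho>)"
proof
  assume "\<exists>\<rho>. \<kappa> + \<nu> = \<mu> + \<rho>"
  then obtain \<rho> where e: "\<kappa> + \<nu> = \<mu> + \<rho>" by blast
  have "\<kappa> = restr U (\<kappa> + \<nu>)" "\<nu> = restr (- U) (\<kappa> + \<nu>)"
    using assms by (auto simp: restr_add restr_eq_self restr_eq_0 disjoint_eq_subset_Compl)
  then have "\<kappa> = restr U \<mu> + restr U \<rho>" "\<nu> = restr (- U) \<mu> + restr (- U) \<rho>"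
    unfolding e by (simp_all add: restr_add)
  then show "(\<exists>\<rho>. \<kappa> = restr U \<mu> + \<rho>) \<and> (\<exists>\<rho>. \<nu> = restr (- U) \<mu> + \<rho>)" by blast
next
  assume "(\<exists>\<rho>. \<kappa> = restr U \<mu> + \<rho>) \<and> (\<exists>\<rho>. \<nu> = restr (- U) \<mu> + \<rho>)"
  then obtain \<rho> \<rho>' where r: "\<kappa> = restr U \<mu> + \<rho>" "\<nu> = restr (- U) \<mu> + \<rho>'" by blast
  have "\<kappa> + \<nu> = \<mu> + (\<rho> + \<rho>')"
    unfolding r by (subst (3) restr_compl[of U \<mu>, symmetric]) (simp add: algebra_simps)
  then show "\<exists>\<rho>. \<kappa> + \<nu> = \<mu> + \<rho>" by blast
qed

text \<open>The two parts of a monomial act differently: the part inside \<open>U\<close> multiplies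
  the coefficient, the part outside \<open>U\<close> shifts the index \<open>\<nu>\<close>.\<close>

lemma mcoeff_single_times:
  assumes \<nu>: "keys \<nu> \<inter> U = {}"
  shows "mcoeff U \<nu> (single \<mu> c * p) =
    (if \<exists>\<rho>. \<nu> = restr (- U) \<mu> + \<rho>
     then single (restr U \<mu>) c * mcoeff U (\<nu> - restr (- U) \<mu>) p else 0)"
proof (rule poly_mapping_eqI)
  fix \<kappa>
  let ?\<mu> = "restr U \<mu>" and ?\<mu>' = "restr (- U) \<mu>"
  have k: "keys ?\<mu> \<subseteq> U" by (simp add: keys_restr)
  show "lookup (mcoeff U \<nu> (single \<mu> c * p)) \<kappa> =
    lookup (if \<exists>\<rho>. \<nu> = ?\<mu>' + \<rho> then single ?\<mu> c * mcoeff U (\<nu> - ?\<mu>') p else 0) \<kappa>"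
  proof (cases "keys \<kappa> \<subseteq> U")
    case False
    have "single ?\<mu> c * mcoeff U (\<nu> - ?\<mu>') p \<in> polys U"
      using k by (intro polys_mult polys_single mcoeff_polys)
    then have "lookup (single ?\<mu> c * mcoeff U (\<nu> - ?\<mu>') p) \<kappa> = 0"
      using False by (auto simp: polys_iff in_keys_iff)
    then show ?thesis using False by (simp add: lookup_mcoeff)
  next
    case True
    note ad = mon_adds_split[OF True \<nu>, of \<mu>]
    show ?thesis
    proof (cases "(\<exists>\<rho>. \<kappa> = ?\<mu> + \<rho>) \<and> (\<exists>\<rho>. \<nu> = ?\<mu>' + \<rho>)")
      case False
      then have "lookup (single \<mu> c * p) (\<kappa> + \<nu>) = 0"
        by (subst lookup_single_times) (simp only: ad if_False)
      moreover have "lookup (single ?\<mu> c * mcoeff U (\<nu> - ?\<mu>') p) \<kappa> = 0"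
        if "\<exists>\<rho>. \<nu> = ?\<mu>' + \<rho>"
        using False that unfolding lookup_single_times by auto
      ultimately show ?thesis using True by (simp add: lookup_mcoeff)
    next
      case T2: True
      then obtain \<rho> \<rho>' where r: "\<kappa> = ?\<mu> + \<rho>" "\<nu> = ?\<mu>' + \<rho>'" by blast
      have e: "\<kappa> + \<nu> = \<mu> + (\<rho> + \<rho>')"
        unfolding r by (subst (3) restr_compl[of U \<mu>, symmetric]) (simp add: algebra_simps)
      have "keys \<rho> \<subseteq> U" using True unfolding r(1) keys_mon_add by simp
      then have "lookup (single ?\<mu> c * mcoeff U (\<nu> - ?\<mu>') p) \<kappa> = c * lookup p (\<rho> + \<rho>')"
        unfolding r by (simp add: lookup_mcoeff)
      moreover have "lookup (mcoeff U \<nu> (single \<mu> c * p)) \<kappa> = c * lookup p (\<rho> + \<rho>')"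
        using True by (simp add: lookup_mcoeff e)
      ultimately show ?thesis using T2 by simp
    qed
  qed
qed

lemma mcoeff_mult_left:
  assumes "q \<in> polys U" "keys \<nu> \<inter> U = {}"
  shows "mcoeff U \<nu> (q * p) = q * mcoeff U \<nu> p"
  using assms(1)
proof (induction rule: polys_induct)
  case (add q \<mu> c)
  have "restr (- U) \<mu> = 0" "restr U \<mu> = \<mu>"
    using add(2) by (auto intro!: restr_eq_0 restr_eq_self)
  then have "mcoeff U \<nu> (single \<mu> c * p) = single \<mu> c * mcoeff U \<nu> p"
    using assms by (subst mcoeff_single_times) auto
  then show ?case using add by (simp add: distrib_right mcoeff_add)
qed simp

lemma mcoeff_of_base:
  assumes "p \<in> polys U" "keys \<nu> \<inter> U = {}"
  shows "mcoeff U \<nu> p = (if \<nu> = 0 then p else 0)"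
proof (rule poly_mapping_eqI)
  fix \<mu>
  have "lookup p (\<mu> + \<nu>) = 0" if "\<nu> \<noteq> 0"
  proof (rule ccontr)
    assume "lookup p (\<mu> + \<nu>) \<noteq> 0"
    then have "keys (\<mu> + \<nu>) \<subseteq> U" using assms by (auto simp: polys_iff in_keys_iff)
    then have "keys \<nu> = {}" using assms(2) unfolding keys_mon_add by blast
    then show False using that by simp
  qed
  moreover have "lookup p \<mu> = 0" if "\<not> keys \<mu> \<subseteq> U"
    using that assms by (auto simp: polys_iff in_keys_iff)
  ultimately show "lookup (mcoeff U \<nu> p) \<mu> = lookup (if \<nu> = 0 then p else 0) \<mu>"
    by (auto simp: lookup_mcoeff)
qed

lemma mcoeff_decomposition:
  "p = (\<Sum>\<nu>\<in>restr (- U) ` keys p. single \<nu> 1 * mcoeff U \<nu> p)"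
proof (rule poly_mapping_eqI)
  fix \<mu> :: mon
  let ?\<nu> = "restr (- U) \<mu>" and ?N = "restr (- U) ` keys p"
  \<comment> \<open>Each monomial \<open>\<mu>\<close> is produced by exactly one summand, the one
    indexed by its part outside \<open>U\<close>.\<close>
  have *: "lookup (single \<nu> 1 * mcoeff U \<nu> p) \<mu> = (if \<nu> = ?\<nu> then lookup p \<mu> else 0)"
    if "\<nu> \<in> ?N" for \<nu>
  proof (cases "\<exists>\<kappa>. \<mu> = \<nu> + \<kappa> \<and> keys \<kappa> \<subseteq> U")
    case True
    then obtain \<kappa> where k: "\<mu> = \<nu> + \<kappa>" "keys \<kappa> \<subseteq> U" by blast
    have "keys \<nu> \<subseteq> - U" using that by (auto simp: keys_restr)
    moreover have "keys \<kappa> \<inter> - U = {}" using k by blast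
    ultimately have "?\<nu> = \<nu>" using k by (simp add: restr_add restr_eq_self restr_eq_0)
    moreover have "lookup (single \<nu> 1 * mcoeff U \<nu> p) \<mu> = lookup p \<mu>"
      unfolding k(1) lookup_single_times_add using k(2) by (simp add: lookup_mcoeff add.commute)
    ultimately show ?thesis by simp
  next
    case False
    have "\<mu> = ?\<nu> + restr U \<mu>" using restr_compl[of U \<mu>] by (simp add: add.commute)
    moreover have "keys (restr U \<mu>) \<subseteq> U" by (simp add: keys_restr)
    ultimately have "\<nu> \<noteq> ?\<nu>" using False by blast
    moreover have "lookup (single \<nu> 1 * mcoeff U \<nu> p) \<mu> = 0"
    proof (cases "\<exists>\<kappa>. \<mu> = \<nu> + \<kappa>")
      case True
      then obtain \<kappa> where "\<mu> = \<nu> + \<kappa>" by blast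
      then show ?thesis using False by (auto simp: lookup_mcoeff)
    next
      case F: False
      then show ?thesis unfolding lookup_single_times by simp
    qed
    ultimately show ?thesis by simp
  qed
  have "lookup (\<Sum>\<nu>\<in>?N. single \<nu> 1 * mcoeff U \<nu> p) \<mu> =
      (\<Sum>\<nu>\<in>?N. if \<nu> = ?\<nu> then lookup p \<mu> else 0)"
    unfolding lookup_sum using * by (intro sum.cong) auto
  also have "\<dots> = lookup p \<mu>" by (auto simp: in_keys_iff image_iff)
  finally show "lookup p \<mu> = lookup (\<Sum>\<nu>\<in>?N. single \<nu> 1 * mcoeff U \<nu> p) \<mu>" by simp
qed

lemma mcoeff_eq_0_imp:
  assumes "\<And>\<nu>. keys \<nu> \<inter> U = {} \<Longrightarrow> mcoeff U \<nu> p = 0"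
  shows "p = 0"
proof -
  have "p = (\<Sum>\<nu>\<in>restr (- U) ` keys p. single \<nu> 1 * mcoeff U \<nu> p)" by (rule mcoeff_decomposition)
  also have "\<dots> = 0" by (rule sum.neutral) (auto simp: keys_restr intro!: assms)
  finally show ?thesis .
qed

text \<open>Passing to the coefficient at \<open>\<nu>\<close> lowers bidegrees by that of
  \<open>\<nu>\<close>; the case distinction guards the truncated subtraction.\<close>

lemma mcoeff_bipart:
  "mcoeff U \<nu> (bipart a b p) =
    (if xdeg \<nu> \<le> a \<and> ydeg \<nu> \<le> b then bipart (a - xdeg \<nu>) (b - ydeg \<nu>) (mcoeff U \<nu> p) else 0)"
  by (rule poly_mapping_eqI) (auto simp: lookup_mcoeff lookup_bipart)

lemma mcoeff_bigraded_part:
  assumes "p \<in> bigraded_part V a b"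
  shows "mcoeff U \<nu> p \<in> bigraded_part U (a - xdeg \<nu>) (b - ydeg \<nu>)"
    and "\<not> (xdeg \<nu> \<le> a \<and> ydeg \<nu> \<le> b) \<Longrightarrow> mcoeff U \<nu> p = 0"
proof -
  have e: "mcoeff U \<nu> p = (if xdeg \<nu> \<le> a \<and> ydeg \<nu> \<le> b
      then bipart (a - xdeg \<nu>) (b - ydeg \<nu>) (mcoeff U \<nu> p) else 0)"
    using mcoeff_bipart[of U \<nu> a b p] bipart_self[OF assms] by simp
  show "mcoeff U \<nu> p \<in> bigraded_part U (a - xdeg \<nu>) (b - ydeg \<nu>)"
    using bipart_mem[OF mcoeff_polys[of U \<nu> p]] by (subst e) (simp add: bigraded_part_iff)
  show "\<not> (xdeg \<nu> \<le> a \<and> ydeg \<nu> \<le> b) \<Longrightarrow> mcoeff U \<nu> p = 0" by (subst e) (rule if_not_P)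
qed

section \<open>Extension of ideals to more variables\<close>

definition ext_ideal :: "var set \<Rightarrow> var set \<Rightarrow> 'k::field mpoly set \<Rightarrow> 'k mpoly set" where
  "ext_ideal V U J = {p \<in> polys V. \<forall>\<nu>. keys \<nu> \<inter> U = {} \<longrightarrow> mcoeff U \<nu> p \<in> J}"

lemma ext_ideal_is_ideal:
  assumes J: "is_ideal U J"
  shows "is_ideal V (ext_ideal V U J)"
proof -
  have "r * p \<in> ext_ideal V U J" if "r \<in> polys V" and p: "p \<in> ext_ideal V U J" for r p
    using that(1)
  proof (induction rule: polys_induct)
    case zero
    show ?case using is_idealD(2)[OF J] by (simp add: ext_ideal_def polys_zero)
  next
    case (add r \<mu> c)
    have "mcoeff U \<nu> (single \<mu> c * p) \<in> J" if "keys \<nu> \<inter> U = {}" for \<nu>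
    proof (cases "\<exists>\<rho>. \<nu> = restr (- U) \<mu> + \<rho>")
      case True
      then obtain \<rho> where r: "\<nu> = restr (- U) \<mu> + \<rho>" by blast
      then have "keys \<rho> \<inter> U = {}" using that by (auto simp: keys_mon_add)
      then have "single (restr U \<mu>) c * mcoeff U \<rho> p \<in> J"
        using p by (intro is_idealD(4)[OF J] polys_single) (auto simp: keys_restr ext_ideal_def)
      then show ?thesis using that r by (subst mcoeff_single_times) auto
    next
      case False
      then show ?thesis using that is_idealD(2)[OF J] by (simp add: mcoeff_single_times)
    qed
    moreover have "single \<mu> c * p \<in> polys V"
      using add p by (auto simp: ext_ideal_def intro: polys_mult polys_single)
    ultimately show ?case using add.IH is_idealD(3)[OF J]
      by (auto simp: ext_ideal_def distrib_right mcoeff_add intro: polys_add)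
  qed
  then show ?thesis
    using is_idealD(2,3)[OF J] unfolding is_ideal_def
    by (auto simp: ext_ideal_def polys_zero mcoeff_add intro: polys_add)
qed

text \<open>The large ring is free over the small one on the monomials in the new variables, so
  membership in the extended ideal can be tested coefficient by coefficient:
  \<open>mcoeff_decomposition\<close> writes a polynomial as a combination of its
  coefficients.\<close>

lemma genideal_eq_ext_ideal:
  assumes J: "is_ideal U J" and UV: "U \<subseteq> V"
  shows "Idl\<^bsub>poly_ring V\<^esub> J = ext_ideal V U J"
proof
  have JU: "J \<subseteq> polys U" by (rule is_idealD(1)[OF J])
  then have JV: "J \<subseteq> polys V" using polys_mono[OF UV] by blast
  show "Idl\<^bsub>poly_ring V\<^esub> J \<subseteq> ext_ideal V U J"
  proof (rule genideal_least[OF ext_ideal_is_ideal[OF J]])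
    show "J \<subseteq> ext_ideal V U J"
      using JU JV is_idealD(2)[OF J] by (auto simp: ext_ideal_def mcoeff_of_base subset_iff)
  qed
  have I: "is_ideal V (Idl\<^bsub>poly_ring V\<^esub> J)" by (rule genideal_is_ideal[OF JV])
  show "ext_ideal V U J \<subseteq> Idl\<^bsub>poly_ring V\<^esub> J"
  proof
    fix p assume p: "p \<in> ext_ideal V U J"
    have "(\<Sum>\<nu>\<in>restr (- U) ` keys p. single \<nu> 1 * mcoeff U \<nu> p) \<in> Idl\<^bsub>poly_ring V\<^esub> J"
    proof (rule is_ideal_sum[OF I], rule is_idealD(4)[OF I])
      fix \<nu> assume "\<nu> \<in> restr (- U) ` keys p"
      then obtain \<mu> where m: "\<mu> \<in> keys p" "\<nu> = restr (- U) \<mu>" by blast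
      have "keys \<mu> \<subseteq> V" using m p by (auto simp: ext_ideal_def polys_iff)
      then show "single \<nu> 1 \<in> polys V" using m by (intro polys_single) (auto simp: keys_restr)
      have "keys \<nu> \<inter> U = {}" using m by (auto simp: keys_restr)
      then show "mcoeff U \<nu> p \<in> Idl\<^bsub>poly_ring V\<^esub> J"
        using p genideal_superset[OF JV] by (auto simp: ext_ideal_def)
    qed
    then show "p \<in> Idl\<^bsub>poly_ring V\<^esub> J" using mcoeff_decomposition[of p U] by simp
  qed
qed

lemma ext_ideal_bigraded:
  assumes J: "is_bigraded J" "0 \<in> J"
  shows "is_bigraded (ext_ideal V U J)"
  unfolding is_bigraded_def
proof (intro ballI allI)
  fix p i j assume "p \<in> ext_ideal V U J"
  then show "bipart i j p \<in> ext_ideal V U J"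
    using J bipart_mem[of p V i j] bigraded_part_polys[of V i j]
    by (auto simp: ext_ideal_def mcoeff_bipart is_bigraded_def)
qed

section \<open>Homogeneous parts of ideals and the shared monomials\<close>

definition ideal_part :: "var set \<Rightarrow> 'k::field mpoly set \<Rightarrow> nat \<Rightarrow> nat \<Rightarrow> 'k mpoly set" where
  "ideal_part V J i j = J \<inter> bigraded_part V i j"

lemma ideal_part_subspace: "is_ideal V J \<Longrightarrow> mp.subspace (ideal_part W J i j)"
  unfolding ideal_part_def by (intro mp.subspace_inter is_ideal_subspace bigraded_part_subspace)

lemma ideal_part_fin_dim: "finite V \<Longrightarrow> mp.fin_dim (ideal_part V J i j)"
  by (rule mp.fin_dim_mono[OF bigraded_part_fin_dim]) (auto simp: ideal_part_def)

lemma hilbert_fun_add_dim: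
  fixes J :: "'k::field mpoly set"
  assumes "is_ideal V J" "finite V"
  shows "hilbert_fun V J i j + mp.dim (ideal_part V J i j) = mp.dim (bigraded_part V i j :: 'k mpoly set)"
proof -
  have "mp.dim (ideal_part V J i j) \<le> mp.dim (bigraded_part V i j :: 'k mpoly set)"
    using assms by (intro mp.dim_mono ideal_part_subspace bigraded_part_subspace bigraded_part_fin_dim)
      (auto simp: ideal_part_def)
  then show ?thesis by (simp add: hilbert_fun_def ideal_part_def)
qed

text \<open>Up to scalars these are all the bihomogeneous elements of k[x_m, y_m].\<close>

definition xypow :: "nat \<Rightarrow> nat \<Rightarrow> nat \<Rightarrow> 'k::field mpoly" where
  "xypow m a b = single (single (Xvar m) a + single (Yvar m) b) 1"

lemma xypow_mult: "xypow m a b * xypow m c d = xypow m (a + c) (b + d)"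
  by (simp add: xypow_def mult_single single_add ac_simps)

lemma xypow_0 [simp]: "xypow m 0 0 = 1"
  by (simp add: xypow_def)

lemma xypow_neq_0 [simp]: "xypow m a b \<noteq> 0"
  by (simp add: xypow_def flip: Poly_Mapping.keys_eq_empty)

lemma xypow_bigraded_part:
  "Xvar m \<in> V \<Longrightarrow> Yvar m \<in> V \<Longrightarrow> xypow m a b \<in> bigraded_part V a b"
  by (auto simp: bigraded_part_iff mons_def xypow_def keys_mon_add)

lemma xypow_polys: "Xvar m \<in> V \<Longrightarrow> Yvar m \<in> V \<Longrightarrow> xypow m a b \<in> polys V"
  using xypow_bigraded_part bigraded_part_polys by blast

text \<open>The monomials in x_m and y_m are nonzerodivisors on the quotient by \<open>J\<close>:
  the bigraded form of being torsion-free over k[x_m, y_m].\<close>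

definition saturated :: "nat \<Rightarrow> var set \<Rightarrow> 'k::field mpoly set \<Rightarrow> bool" where
  "saturated m V J \<longleftrightarrow> (\<forall>p\<in>polys V. \<forall>a b. xypow m a b * p \<in> J \<longrightarrow> p \<in> J)"

text \<open>The value at -1 counts as 0, as in the coefficients of a power series multiplied by 1 -
  T; with this convention the differences sum back to \<open>f\<close>.\<close>

definition back_diff :: "(nat \<Rightarrow> int) \<Rightarrow> nat \<Rightarrow> int" where
  "back_diff f i = f i - (if i = 0 then 0 else f (i - 1))"

lemma sum_back_diff: "(\<Sum>i\<le>a. back_diff f i) = f a"
  by (induction a) (auto simp: back_diff_def)

text \<open>The coefficients of a series in two variables multiplied by (1 - T_0) (1 - T_1), see
  \<open>fps_nth2_mult_one_minus\<close>.\<close>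

definition back_diff2 :: "(nat \<Rightarrow> nat \<Rightarrow> int) \<Rightarrow> nat \<Rightarrow> nat \<Rightarrow> int" where
  "back_diff2 f i j = back_diff (\<lambda>i. back_diff (f i) j) i"

lemma sum_back_diff2: "(\<Sum>i\<le>a. \<Sum>j\<le>b. back_diff2 f i j) = f a b"
proof -
  have "(\<Sum>i\<le>a. \<Sum>j\<le>b. back_diff2 f i j) = (\<Sum>j\<le>b. \<Sum>i\<le>a. back_diff (\<lambda>i. back_diff (f i) j) i)"
    unfolding back_diff2_def by (rule sum.swap)
  also have "\<dots> = f a b" by (simp add: sum_back_diff)
  finally show ?thesis .
qed

lemma keys_xypow_times: "keys (xypow m a b * p) = (+) (single (Xvar m) a + single (Yvar m) b) ` keys p"
  by (simp add: xypow_def keys_single_times)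

lemma xypow_cancel_bigraded_part:
  assumes "Xvar m \<in> V" "Yvar m \<in> V" "xypow m a b * p \<in> bigraded_part V (a + i) (b + j)"
  shows "p \<in> bigraded_part V i j"
  unfolding bigraded_part_iff
proof
  fix \<mu> assume "\<mu> \<in> keys p"
  then have "single (Xvar m) a + single (Yvar m) b + \<mu> \<in> mons V (a + i) (b + j)"
    using assms(3) unfolding bigraded_part_iff keys_xypow_times by blast
  then show "\<mu> \<in> mons V i j" by (simp add: mons_def keys_mon_add)
qed

text \<open>The two variables are distinct, so every monomial of \<open>p\<close> must already
  contain y_m.\<close>

lemma x_times_eq_y_times:
  assumes "xypow m 1 0 * p = xypow m 0 1 * q"
  obtains r where "p = xypow m 0 1 * r" "q = xypow m 1 0 * r"
proof -
  let ?x = "single (Xvar m) 1 :: mon" and ?y = "single (Yvar m) 1 :: mon"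
  \<comment> \<open>\<open>p\<close> with every monomial divided by y_m; the truncated subtraction
    is exact by the divisibility shown next.\<close>
  define r where "r = (\<Sum>\<mu>\<in>keys p. single (\<mu> - ?y) (lookup p \<mu>))"
  have "\<exists>\<kappa>. \<mu> = ?y + \<kappa>" if "\<mu> \<in> keys p" for \<mu>
  proof -
    have "?x + \<mu> \<in> keys (xypow m 1 0 * p)" using that by (simp add: keys_xypow_times)
    then obtain \<nu> where "?x + \<mu> = ?y + \<nu>" unfolding assms keys_xypow_times by auto
    then have "lookup (?x + \<mu>) (Yvar m) = lookup (?y + \<nu>) (Yvar m)" by simp
    then have l: "lookup \<mu> (Yvar m) \<ge> 1" by (simp add: lookup_add lookup_single when_def)
    have "\<mu> = ?y + (\<mu> - ?y)"
      using l by (intro poly_mapping_eqI) (auto simp: lookup_add lookup_minus lookup_single when_def)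
    then show ?thesis by blast
  qed
  then have "xypow m 0 1 * r = (\<Sum>\<mu>\<in>keys p. single \<mu> (lookup p \<mu>))"
    unfolding r_def sum_distrib_left xypow_def
    by (intro sum.cong refl) (use add_diff_cancel_left' in \<open>force simp: mult_single\<close>)
  then have p: "p = xypow m 0 1 * r" using mpoly_eq_sum_single[of p] by simp
  have "xypow m 0 1 * (xypow m 1 0 * r) = xypow m 0 1 * q"
    using assms unfolding p by (simp add: ac_simps)
  then have "q = xypow m 1 0 * r" by simp
  with p show thesis by (rule that)
qed

section \<open>Ideals that are free over the shared variables\<close>

locale saturated_ideal =
  fixes m :: nat and V :: "var set" and J :: "'k::field mpoly set"
  assumes finite_vars: "finite V" and xvar: "Xvar m \<in> V" and yvar: "Yvar m \<in> V"
    and ideal: "is_ideal V J" and sat: "saturated m V J"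
begin

abbreviation part :: "nat \<Rightarrow> nat \<Rightarrow> 'k mpoly set" where
  "part \<equiv> ideal_part V J"

lemmas part_subspace = ideal_part_subspace[OF ideal, of V]
lemmas part_fin_dim = ideal_part_fin_dim[OF finite_vars, of J]

lemma part_polys: "p \<in> part i j \<Longrightarrow> p \<in> polys V"
  using is_idealD(1)[OF ideal] by (auto simp: ideal_part_def)

lemma part_xypow_iff:
  assumes "p \<in> polys V"
  shows "xypow m a b * p \<in> part (a + i) (b + j) \<longleftrightarrow> p \<in> part i j"
proof
  assume "xypow m a b * p \<in> part (a + i) (b + j)"
  then show "p \<in> part i j"
    using sat assms xypow_cancel_bigraded_part[OF xvar yvar] unfolding ideal_part_def saturated_def by blast
next
  assume "p \<in> part i j"
  then show "xypow m a b * p \<in> part (a + i) (b + j)"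
    using is_idealD(4)[OF ideal xypow_polys[OF xvar yvar]]
      bigraded_part_mult[OF xypow_bigraded_part[OF xvar yvar]]
    by (auto simp: ideal_part_def)
qed

lemma part_xypow:
  assumes "p \<in> part i j" "i \<le> a" "j \<le> b"
  shows "xypow m (a - i) (b - j) * p \<in> part a b"
  using part_xypow_iff[OF part_polys[OF assms(1)], of "a - i" "b - j" i j] assms by simp

text \<open>Below degree zero there is nothing to multiply; \<open>{0}\<close> on the border agrees
  with the convention of \<open>back_diff\<close>.\<close>

definition xpart :: "nat \<Rightarrow> nat \<Rightarrow> 'k mpoly set" where
  "xpart i j = (if i = 0 then {0} else (*) (xypow m 1 0) ` part (i - 1) j)"

definition ypart :: "nat \<Rightarrow> nat \<Rightarrow> 'k mpoly set" where
  "ypart i j = (if j = 0 then {0} else (*) (xypow m 0 1) ` part i (j - 1))"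

text \<open>What multiplication by x_m and y_m brings in from lower bidegrees. As in the graded
  Nakayama lemma, complements of these spaces supply generators over k[x_m, y_m].\<close>

definition oldpart :: "nat \<Rightarrow> nat \<Rightarrow> 'k mpoly set" where
  "oldpart i j = {u + v | u v. u \<in> xpart i j \<and> v \<in> ypart i j}"

lemma times_xypow_image:
  "mp.dim ((*) (xypow m a b) ` part i j) = mp.dim (part i j)"
  "mp.fin_dim ((*) (xypow m a b) ` part i j)"
  "mp.subspace ((*) (xypow m a b) ` part i j)"
  by (rule mp.dim_injective_image[OF part_subspace part_fin_dim];
      simp add: distrib_left kscale_mult_right)+

lemma fin_dim_zero: "mp.fin_dim {0 :: 'k mpoly}"
  using mp.fin_dim_mono[OF part_fin_dim[of 0 0], of "{0}"] mp.subspace_0[OF part_subspace[of 0 0]] by simp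

lemma xpart_subspace: "mp.subspace (xpart i j)" "mp.fin_dim (xpart i j)"
  and ypart_subspace: "mp.subspace (ypart i j)" "mp.fin_dim (ypart i j)"
  using times_xypow_image fin_dim_zero by (simp_all add: xpart_def ypart_def)

lemma oldpart_subspace: "mp.subspace (oldpart i j)"
  unfolding oldpart_def by (intro mp.subspace_sums xpart_subspace ypart_subspace)

lemma oldpart_subset: "oldpart i j \<subseteq> part i j"
proof -
  have "xpart i j \<subseteq> part i j"
    using part_xypow[of _ "i - 1" j i j] mp.subspace_0[OF part_subspace]
    by (auto simp: xpart_def)
  moreover have "ypart i j \<subseteq> part i j"
    using part_xypow[of _ i "j - 1" i j] mp.subspace_0[OF part_subspace]
    by (auto simp: ypart_def)
  ultimately show ?thesis unfolding oldpart_def using mp.subspace_add[OF part_subspace] by blast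
qed

text \<open>If u = x p = y q, then p = y r in the polynomial ring, and saturation puts
  \<open>r\<close> into the ideal. This is what distinguishes a saturated ideal from a merely
  torsion-free module: for the ideal (x_m, y_m) the product x_m y_m lies in the intersection without
  being x_m y_m times a member.\<close>

lemma xpart_Int_ypart:
  "xpart i j \<inter> ypart i j =
    (if i = 0 \<or> j = 0 then {0} else (*) (xypow m 1 1) ` part (i - 1) (j - 1))"
proof (cases "i = 0 \<or> j = 0")
  case True
  then show ?thesis
    using mp.subspace_0[OF xpart_subspace(1)[of i j]] mp.subspace_0[OF ypart_subspace(1)[of i j]]
    by (auto simp: xpart_def ypart_def)
next
  case False
  then obtain a b where ab: "i = Suc a" "j = Suc b" by (metis not0_implies_Suc)
  have "xpart i j \<inter> ypart i j = (*) (xypow m 1 1) ` part a b"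
  proof (intro equalityI subsetI)
    fix u assume u: "u \<in> xpart i j \<inter> ypart i j"
    then obtain p where p: "u = xypow m 1 0 * p" "p \<in> part a (Suc b)"
      by (auto simp: xpart_def ab)
    from u obtain q where q: "u = xypow m 0 1 * q" by (auto simp: ypart_def ab)
    obtain r where r: "p = xypow m 0 1 * r"
      using x_times_eq_y_times[of m p q] p(1) q by metis
    have "r \<in> bigraded_part V a b"
      using p(2) xypow_cancel_bigraded_part[OF xvar yvar, where a = 0 and b = 1 and p = r and i = a and j = b]
      by (simp add: r ideal_part_def)
    then have "r \<in> polys V" using bigraded_part_polys by blast
    then have "r \<in> part a b" using part_xypow_iff[of r 0 1 a b] p(2) r by simp
    moreover have "u = xypow m 1 1 * r" unfolding p r by (simp add: xypow_mult flip: mult.assoc)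
    ultimately show "u \<in> (*) (xypow m 1 1) ` part a b" by blast
  next
    fix u assume "u \<in> (*) (xypow m 1 1) ` part a b"
    then obtain r where r: "u = xypow m 1 1 * r" "r \<in> part a b" by blast
    have "u = xypow m 1 0 * (xypow m 0 1 * r)" "u = xypow m 0 1 * (xypow m 1 0 * r)"
      unfolding r by (simp_all add: xypow_mult flip: mult.assoc)
    moreover have "xypow m 0 1 * r \<in> part a (Suc b)" "xypow m 1 0 * r \<in> part (Suc a) b"
      using part_xypow[OF r(2), of a "Suc b"] part_xypow[OF r(2), of "Suc a" b] by simp_all
    ultimately show "u \<in> xpart i j \<inter> ypart i j" by (simp add: xpart_def ypart_def ab)
  qed
  then show ?thesis by (simp add: ab)
qed

text \<open>Inclusion-exclusion: multiplication by a monomial is injective, so the two summands and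
  their intersection have the dimensions of parts in shifted bidegrees.\<close>

lemma dim_oldpart:
  "int (mp.dim (part i j)) - int (mp.dim (oldpart i j)) = back_diff2 (\<lambda>i j. int (mp.dim (part i j))) i j"
proof -
  have "int (mp.dim (oldpart i j)) + int (mp.dim (xpart i j \<inter> ypart i j)) =
      int (mp.dim (xpart i j)) + int (mp.dim (ypart i j))"
    using mp.dim_add_Int[OF xpart_subspace(1) ypart_subspace(1) xpart_subspace(2) ypart_subspace(2), of i j i j]
    unfolding oldpart_def by linarith
  moreover have "mp.dim (xpart i j) = (if i = 0 then 0 else mp.dim (part (i - 1) j))"
    "mp.dim (ypart i j) = (if j = 0 then 0 else mp.dim (part i (j - 1)))"
    "mp.dim (xpart i j \<inter> ypart i j) = (if i = 0 \<or> j = 0 then 0 else mp.dim (part (i - 1) (j - 1)))"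
    unfolding xpart_Int_ypart by (simp_all add: xpart_def ypart_def times_xypow_image mp.dim_zero)
  ultimately show ?thesis
    by (cases "i = 0"; cases "j = 0") (simp_all add: back_diff2_def back_diff_def)
qed

text \<open>The choice is made once per bidegree, so that the same generators serve in all higher
  bidegrees.\<close>

definition new_gens :: "nat \<Rightarrow> nat \<Rightarrow> 'k mpoly set" where
  "new_gens i j = (SOME I. mp.rel_basis (oldpart i j) (part i j) I (\<lambda>b. b))"

lemma new_gens_rel_basis: "mp.rel_basis (oldpart i j) (part i j) (new_gens i j) (\<lambda>b. b)"
  unfolding new_gens_def
  by (rule someI_ex, rule mp.rel_basis_exists)
    (rule oldpart_subspace oldpart_subset part_subspace part_fin_dim)+

lemma card_new_gens:
  "int (card (new_gens i j)) = back_diff2 (\<lambda>i j. int (mp.dim (part i j))) i j"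
  using mp.rel_basis_dim[OF new_gens_rel_basis oldpart_subspace oldpart_subset part_fin_dim, of i j]
    dim_oldpart[of i j] by simp

text \<open>A generator is recorded with its bidegree, because the bidegree determines the monomial
  that multiplies it.\<close>

definition gen_index :: "nat \<Rightarrow> nat \<Rightarrow> (nat \<times> nat \<times> 'k mpoly) set" where
  "gen_index a b = (SIGMA i:{..a}. SIGMA j:{..b}. new_gens i j)"

text \<open>A single monomial of k[x_m, y_m] carries bidegree (i, j) to (a, b), so combinations over
  this ring that are homogeneous of bidegree (a, b) are k-linear combinations of this
  family.\<close>

definition gen_shift :: "nat \<Rightarrow> nat \<Rightarrow> nat \<times> nat \<times> 'k mpoly \<Rightarrow> 'k mpoly" where
  "gen_shift a b = (\<lambda>(i, j, \<beta>). xypow m (a - i) (b - j) * \<beta>)"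

lemma finite_new_gens: "finite (new_gens i j)"
  and new_gens_part: "\<beta> \<in> new_gens i j \<Longrightarrow> \<beta> \<in> part i j"
  using mp.rel_basisD[OF new_gens_rel_basis[of i j]] by auto

lemma finite_gen_index: "finite (gen_index a b)"
  unfolding gen_index_def by (intro finite_SigmaI) (auto simp: finite_new_gens)

lemma gen_shift_span_mono:
  assumes "p \<in> mp.span (gen_shift a b ` gen_index a b)" "a \<le> a'" "b \<le> b'"
  shows "xypow m (a' - a) (b' - b) * p \<in> mp.span (gen_shift a' b' ` gen_index a' b')"
  using assms(1)
proof (induction rule: mp.span_induct_alt)
  case base
  show ?case by (simp add: mp.span_zero)
next
  case (step c x y)
  then obtain i j \<beta> where x: "x = xypow m (a - i) (b - j) * \<beta>" "i \<le> a" "j \<le> b" "\<beta> \<in> new_gens i j"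
    by (auto simp: gen_index_def gen_shift_def)
  have "xypow m (a' - a) (b' - b) * x = gen_shift a' b' (i, j, \<beta>)"
    using x assms by (simp add: gen_shift_def xypow_mult flip: mult.assoc)
  then have "xypow m (a' - a) (b' - b) * x \<in> mp.span (gen_shift a' b' ` gen_index a' b')"
    using x assms by (intro mp.span_base) (auto simp: gen_index_def)
  then show ?case using step
    by (auto simp: distrib_left kscale_mult_right intro: mp.span_add mp.span_scale)
qed

text \<open>Graded Nakayama: modulo the new generators an element comes from lower total degree,
  where the induction hypothesis applies.\<close>

lemma part_subset_span: "part a b \<subseteq> mp.span (gen_shift a b ` gen_index a b)"
proof (induction "a + b" arbitrary: a b rule: less_induct)
  case less
  let ?S = "mp.span (gen_shift a b ` gen_index a b)"
  have "xpart a b \<subseteq> ?S"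
  proof
    fix u assume u: "u \<in> xpart a b"
    show "u \<in> ?S"
    proof (cases "a = 0")
      case True
      then show ?thesis using u by (simp add: xpart_def mp.span_zero)
    next
      case False
      then obtain p where p: "u = xypow m 1 0 * p" "p \<in> part (a - 1) b" using u by (auto simp: xpart_def)
      then have "p \<in> mp.span (gen_shift (a - 1) b ` gen_index (a - 1) b)" using less[of "a - 1" b] False by auto
      from gen_shift_span_mono[OF this, of a b] show ?thesis using p False by simp
    qed
  qed
  moreover have "ypart a b \<subseteq> ?S"
  proof
    fix u assume u: "u \<in> ypart a b"
    show "u \<in> ?S"
    proof (cases "b = 0")
      case True
      then show ?thesis using u by (simp add: ypart_def mp.span_zero)
    next
      case False
      then obtain p where p: "u = xypow m 0 1 * p" "p \<in> part a (b - 1)" using u by (auto simp: ypart_def)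
      then have "p \<in> mp.span (gen_shift a (b - 1) ` gen_index a (b - 1))" using less[of a "b - 1"] False by auto
      from gen_shift_span_mono[OF this, of a b] show ?thesis using p False by simp
    qed
  qed
  ultimately have old: "oldpart a b \<subseteq> ?S" unfolding oldpart_def by (auto intro: mp.span_add)
  have "new_gens a b \<subseteq> gen_shift a b ` gen_index a b"
  proof
    fix \<beta> assume "\<beta> \<in> new_gens a b"
    then have "(a, b, \<beta>) \<in> gen_index a b" by (simp add: gen_index_def)
    moreover have "\<beta> = gen_shift a b (a, b, \<beta>)" by (simp add: gen_shift_def)
    ultimately show "\<beta> \<in> gen_shift a b ` gen_index a b" by blast
  qed
  then have new: "mp.span (new_gens a b) \<subseteq> ?S" by (rule mp.span_mono)
  show "part a b \<subseteq> ?S"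
  proof
    fix w assume "w \<in> part a b"
    then obtain s where "s \<in> mp.span (new_gens a b)" "w - s \<in> oldpart a b"
      using mp.rel_basisD(3)[OF new_gens_rel_basis, of w] by auto
    then have "(w - s) + s \<in> ?S" using old new by (intro mp.span_add) auto
    then show "w \<in> ?S" by simp
  qed
qed

text \<open>So \<open>J\<close> is free over \<open>k[x\<^sub>m, y\<^sub>m]\<close> on the generators \<open>new_gens\<close>; independence comes from
  counting dimensions.\<close>

lemma gen_shift_rel_basis: "mp.rel_basis {0} (part a b) (gen_index a b) (gen_shift a b)"
proof (rule mp.rel_basis_spanning[OF finite_gen_index _ part_subset_span])
  show "gen_shift a b ` gen_index a b \<subseteq> part a b"
    using part_xypow[OF new_gens_part] by (auto simp: gen_index_def gen_shift_def)
  have "int (card (gen_index a b)) =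
      (\<Sum>i\<le>a. \<Sum>j\<le>b. back_diff2 (\<lambda>i j. int (mp.dim (part i j))) i j)"
    by (simp add: gen_index_def card_SigmaI finite_new_gens card_new_gens)
  then show "card (gen_index a b) = mp.dim (part a b)" by (simp add: sum_back_diff2)
qed

end

text \<open>The coefficient involves only variables of \<open>U\<close> and, like \<open>p\<close>,
  only variables of \<open>V\<close>; so it lies in k[x_m, y_m], and being bihomogeneous it is a
  scalar times a monomial. The monomial factor on the left makes the monomial on the right
  independent of \<open>\<nu>\<close>.\<close>

lemma mcoeff_shared:
  assumes p: "p \<in> bigraded_part V i j" and \<nu>: "keys \<nu> \<inter> U = {}" and UV: "U \<inter> V = {Xvar m, Yvar m}"
  shows "\<exists>c. xypow m (xdeg \<nu>) (ydeg \<nu>) * mcoeff U \<nu> p = kscale c (xypow m i j)"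
proof -
  let ?s = "\<lambda>a b. single (Xvar m) a + single (Yvar m) b :: mon"
  \<comment> \<open>If the bidegree of \<open>\<nu>\<close> exceeds (i, j), the coefficient vanishes
    and the subtractions are meaningless, hence the value 0.\<close>
  define c where "c = (if xdeg \<nu> \<le> i \<and> ydeg \<nu> \<le> j
    then lookup p (?s (i - xdeg \<nu>) (j - ydeg \<nu>) + \<nu>) else 0)"
  have sub: "keys (?s a b) \<subseteq> U" for a b using UV by (auto simp: keys_mon_add)
  have "mcoeff U \<nu> p = single (?s (i - xdeg \<nu>) (j - ydeg \<nu>)) c"
  proof (rule poly_mapping_eqI)
    fix \<mu>
    show "lookup (mcoeff U \<nu> p) \<mu> = lookup (single (?s (i - xdeg \<nu>) (j - ydeg \<nu>)) c) \<mu>"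
    proof (cases "\<mu> \<in> keys (mcoeff U \<nu> p)")
      case True
      then have U: "keys \<mu> \<subseteq> U" and "\<mu> + \<nu> \<in> keys p"
        unfolding in_keys_iff[of \<mu>] in_keys_iff[of "\<mu> + \<nu>"] lookup_mcoeff by presburger+
      then have m: "\<mu> + \<nu> \<in> mons V i j" using p by (auto simp: bigraded_part_iff)
      then have "keys \<mu> \<subseteq> {Xvar m, Yvar m}" using UV U by (auto simp: mons_def keys_mon_add)
      then have "\<mu> = ?s (lookup \<mu> (Xvar m)) (lookup \<mu> (Yvar m))"
        by (intro poly_mapping_eqI) (auto simp: lookup_add lookup_single when_def in_keys_iff)
      then obtain a b where ab: "\<mu> = ?s a b" by blast
      then have "a + xdeg \<nu> = i" "b + ydeg \<nu> = j" using m by (auto simp: mons_def)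
      then have "\<mu> = ?s (i - xdeg \<nu>) (j - ydeg \<nu>)" "xdeg \<nu> \<le> i \<and> ydeg \<nu> \<le> j"
        using ab by auto
      then show ?thesis using U by (simp add: lookup_mcoeff c_def)
    next
      case False
      then have z: "lookup (mcoeff U \<nu> p) \<mu> = 0" by (simp add: in_keys_iff)
      have "c = 0" if "\<mu> = ?s (i - xdeg \<nu>) (j - ydeg \<nu>)"
        using z sub that by (auto simp: c_def lookup_mcoeff)
      then show ?thesis using z by (auto simp: lookup_single when_def)
    qed
  qed
  moreover have "single (?s (xdeg \<nu>) (ydeg \<nu>) + ?s (i - xdeg \<nu>) (j - ydeg \<nu>)) c = kscale c (xypow m i j)"
  proof (cases "xdeg \<nu> \<le> i \<and> ydeg \<nu> \<le> j")
    case True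
    have "?s (xdeg \<nu>) (ydeg \<nu>) + ?s (i - xdeg \<nu>) (j - ydeg \<nu>) =
        single (Xvar m) (xdeg \<nu> + (i - xdeg \<nu>)) + single (Yvar m) (ydeg \<nu> + (j - ydeg \<nu>))"
      unfolding single_add by (simp only: ac_simps)
    also have "\<dots> = ?s i j" using True by simp
    finally show ?thesis by (simp add: xypow_def single_eq_kscale[symmetric])
  qed (auto simp: c_def kscale_def)
  ultimately have "xypow m (xdeg \<nu>) (ydeg \<nu>) * mcoeff U \<nu> p = kscale c (xypow m i j)"
    by (simp add: xypow_def mult_single)
  then show ?thesis by blast
qed

lemma rel_basis_expansion:
  fixes F :: "'i \<Rightarrow> 'k::field mpoly"
  assumes "mp.rel_basis {0} W I f" "w \<in> W"
  shows "\<exists>c. w = (\<Sum>i\<in>I. kscale (c i) (f i))"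
  using mp.rel_basisD(3)[OF assms] mp.span_family[OF mp.rel_basisD(1)[OF assms(1)]] by auto

lemma sum_Sigma_Sigma:
  assumes "finite A" "\<And>i. finite (B i)" "\<And>i j. finite (C i j)"
  shows "(\<Sum>t\<in>(SIGMA i:A. SIGMA j:B i. C i j). f (fst t) (fst (snd t))) =
    (\<Sum>i\<in>A. \<Sum>j\<in>B i. \<Sum>c\<in>C i j. f i j)"
proof -
  have "(\<Sum>j\<in>B i. \<Sum>c\<in>C i j. f i j) = (\<Sum>q\<in>(SIGMA j:B i. C i j). f i (fst q))" for i
    using assms by (subst sum.Sigma) (auto simp: case_prod_unfold)
  moreover have "(\<Sum>i\<in>A. \<Sum>q\<in>(SIGMA j:B i. C i j). f i (fst q)) =
      (\<Sum>(i, q)\<in>(SIGMA i:A. SIGMA j:B i. C i j). f i (fst q))"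
    using assms by (intro sum.Sigma) auto
  ultimately show ?thesis by (simp add: case_prod_unfold)
qed

section \<open>Two ideals that share a pair of variables\<close>

locale ideal_pair = A: saturated_ideal m U J + B: saturated_ideal m V J'
  for m :: nat and U V :: "var set" and J J' :: "'k::field mpoly set" +
  assumes shared: "U \<inter> V = {Xvar m, Yvar m}"
    and bigradedA: "is_bigraded J" and bigradedB: "is_bigraded J'"
begin

abbreviation "extA \<equiv> ext_ideal (U \<union> V) U J"
abbreviation "extB \<equiv> ext_ideal (U \<union> V) V J'"

definition sum_ideal :: "'k mpoly set" where
  "sum_ideal = {p + q | p q. p \<in> extA \<and> q \<in> extB}"

lemmas extA_ideal = ext_ideal_is_ideal[OF A.ideal, of "U \<union> V"]
lemmas extB_ideal = ext_ideal_is_ideal[OF B.ideal, of "U \<union> V"]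

lemma sum_ideal_ideal: "is_ideal (U \<union> V) sum_ideal"
  unfolding sum_ideal_def by (rule is_ideal_plus[OF extA_ideal extB_ideal])

text \<open>The one scalar carried by the coefficient of a generator at \<open>\<nu>\<close>, which
  exists by \<open>mcoeff_shared\<close>. The value 0 for \<open>\<nu>\<close> meeting
  \<open>U\<close> lets relations be stated for all \<open>\<nu>\<close>.\<close>

definition shared_coeff :: "nat \<times> nat \<times> 'k mpoly \<Rightarrow> mon \<Rightarrow> 'k" where
  "shared_coeff = (\<lambda>(i, j, \<beta>) \<nu>. if keys \<nu> \<inter> U = {}
     then SOME c. xypow m (xdeg \<nu>) (ydeg \<nu>) * mcoeff U \<nu> \<beta> = kscale c (xypow m i j) else 0)"

lemma shared_coeff:
  assumes "(i, j, \<beta>) \<in> B.gen_index a b" "keys \<nu> \<inter> U = {}"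
  shows "xypow m (xdeg \<nu>) (ydeg \<nu>) * mcoeff U \<nu> \<beta> = kscale (shared_coeff (i, j, \<beta>) \<nu>) (xypow m i j)"
proof -
  have "\<beta> \<in> bigraded_part V i j"
    using assms(1) B.new_gens_part by (auto simp: B.gen_index_def ideal_part_def)
  from someI_ex[OF mcoeff_shared[OF this assms(2) shared]] show ?thesis
    using assms(2) by (simp add: shared_coeff_def)
qed

text \<open>The corresponding combination \<open>w\<close> of shifted generators has all its
  coefficients over \<open>polys U\<close> equal to zero, so w = 0, and
  \<open>gen_shift_rel_basis\<close> makes the scalars vanish.\<close>

lemma shared_coeff_independent:
  assumes "\<And>\<nu>. (\<Sum>t\<in>B.gen_index a b. l t * shared_coeff t \<nu>) = 0"
  shows "\<forall>t\<in>B.gen_index a b. l t = 0"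
proof -
  let ?I = "B.gen_index a b"
  define w where "w = (\<Sum>t\<in>?I. kscale (l t) (B.gen_shift a b t))"
  have "mcoeff U \<nu> w = 0" if \<nu>: "keys \<nu> \<inter> U = {}" for \<nu>
  proof -
    have "xypow m (xdeg \<nu>) (ydeg \<nu>) * mcoeff U \<nu> w =
        (\<Sum>t\<in>?I. kscale (l t) (xypow m (xdeg \<nu>) (ydeg \<nu>) * mcoeff U \<nu> (B.gen_shift a b t)))"
      by (simp add: w_def mcoeff_sum mcoeff_kscale sum_distrib_left kscale_mult_right)
    also have "\<dots> = (\<Sum>t\<in>?I. kscale (l t * shared_coeff t \<nu>) (xypow m a b))"
    proof (rule sum.cong[OF refl])
      fix t assume t: "t \<in> ?I"
      obtain i j \<beta> where tt: "t = (i, j, \<beta>)" by (cases t)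
      have ij: "i \<le> a" "j \<le> b" using t by (auto simp: tt B.gen_index_def)
      have "mcoeff U \<nu> (B.gen_shift a b t) = xypow m (a - i) (b - j) * mcoeff U \<nu> \<beta>"
        unfolding tt B.gen_shift_def prod.case
        by (rule mcoeff_mult_left[OF xypow_polys[OF A.xvar A.yvar] \<nu>])
      then have "xypow m (xdeg \<nu>) (ydeg \<nu>) * mcoeff U \<nu> (B.gen_shift a b t) =
          xypow m (a - i) (b - j) * (xypow m (xdeg \<nu>) (ydeg \<nu>) * mcoeff U \<nu> \<beta>)"
        by (simp add: ac_simps)
      also have "\<dots> = kscale (shared_coeff t \<nu>) (xypow m a b)"
        using shared_coeff[of i j \<beta> a b, OF _ \<nu>] t ij by (simp add: tt kscale_mult_right xypow_mult)
      finally show "kscale (l t) (xypow m (xdeg \<nu>) (ydeg \<nu>) * mcoeff U \<nu> (B.gen_shift a b t)) =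
          kscale (l t * shared_coeff t \<nu>) (xypow m a b)" by simp
    qed
    also have "\<dots> = kscale (\<Sum>t\<in>?I. l t * shared_coeff t \<nu>) (xypow m a b)"
      by (simp add: mp.scale_sum_left)
    also have "\<dots> = 0" using assms by simp
    finally show ?thesis by simp
  qed
  then have "w = 0" by (rule mcoeff_eq_0_imp)
  then show ?thesis
    using mp.rel_basisD(4)[OF B.gen_shift_rel_basis, of l a b] by (auto simp: w_def)
qed

text \<open>This is the injectivity of (P/J) \<otimes> J' \<rightarrow> (P/J) \<otimes> Q over the
  shared ring. Coefficients over \<open>polys U\<close> turn the hypothesis into k-linear
  memberships in \<open>J\<close>; independence of the scalars isolates each \<open>p t\<close>
  times a monomial, and saturation of \<open>J\<close> cancels the monomial.\<close>

lemma coefficients_in_A: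
  assumes p: "\<And>t. t \<in> B.gen_index a b \<Longrightarrow> p t \<in> polys U"
    and s: "(\<Sum>t\<in>B.gen_index a b. p t * snd (snd t)) \<in> extA"
    and t: "t \<in> B.gen_index a b"
  shows "p t \<in> J"
proof -
  let ?I = "B.gen_index a b"
  \<comment> \<open>By \<open>shared_coeff\<close>, each generator leaves behind the monomial of its
    own bidegree. Absorbing it here leaves only scalars that depend on \<open>\<nu>\<close>.\<close>
  define P where "P = (\<lambda>(i, j, \<beta>). xypow m i j * p (i, j, \<beta>))"
  have "(\<Sum>t\<in>?I. kscale (shared_coeff t \<nu>) (P t)) \<in> J" for \<nu>
  proof (cases "keys \<nu> \<inter> U = {}")
    case False
    then have "shared_coeff t \<nu> = 0" for t by (cases t) (simp add: shared_coeff_def)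
    then show ?thesis using is_idealD(2)[OF A.ideal] by simp
  next
    case \<nu>: True
    have "xypow m (xdeg \<nu>) (ydeg \<nu>) * mcoeff U \<nu> (\<Sum>t\<in>?I. p t * snd (snd t)) =
        (\<Sum>t\<in>?I. xypow m (xdeg \<nu>) (ydeg \<nu>) * mcoeff U \<nu> (p t * snd (snd t)))"
      by (simp add: mcoeff_sum sum_distrib_left)
    also have "\<dots> = (\<Sum>t\<in>?I. kscale (shared_coeff t \<nu>) (P t))"
    proof (rule sum.cong[OF refl])
      fix t assume t: "t \<in> ?I"
      obtain i j \<beta> where tt: "t = (i, j, \<beta>)" by (cases t)
      have "mcoeff U \<nu> (p t * snd (snd t)) = p t * mcoeff U \<nu> \<beta>"
        using mcoeff_mult_left[OF p[OF t] \<nu>] by (simp add: tt)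
      then have "xypow m (xdeg \<nu>) (ydeg \<nu>) * mcoeff U \<nu> (p t * snd (snd t)) =
          p t * (xypow m (xdeg \<nu>) (ydeg \<nu>) * mcoeff U \<nu> \<beta>)" by (simp add: ac_simps)
      also have "\<dots> = kscale (shared_coeff t \<nu>) (P t)"
        using shared_coeff[of i j \<beta> a b, OF _ \<nu>] t
        by (simp add: tt P_def kscale_mult_right mult.commute)
      finally show "xypow m (xdeg \<nu>) (ydeg \<nu>) * mcoeff U \<nu> (p t * snd (snd t)) =
          kscale (shared_coeff t \<nu>) (P t)" .
    qed
    finally have "(\<Sum>t\<in>?I. kscale (shared_coeff t \<nu>) (P t)) =
        xypow m (xdeg \<nu>) (ydeg \<nu>) * mcoeff U \<nu> (\<Sum>t\<in>?I. p t * snd (snd t))" by simp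
    moreover have "mcoeff U \<nu> (\<Sum>t\<in>?I. p t * snd (snd t)) \<in> J"
      using s \<nu> by (simp add: ext_ideal_def)
    ultimately show ?thesis
      using is_idealD(4)[OF A.ideal xypow_polys[OF A.xvar A.yvar]] by simp
  qed
  from mp.coefficients_in_subspace[OF is_ideal_subspace[OF A.ideal] B.finite_gen_index
      shared_coeff_independent this t]
  have "P t \<in> J" .
  then show ?thesis using A.sat p[OF t] by (cases t) (auto simp: P_def saturated_def)
qed

definition quot_basis :: "nat \<Rightarrow> nat \<Rightarrow> 'k mpoly set" where
  "quot_basis i j = (SOME I. mp.rel_basis (A.part i j) (bigraded_part U i j) I (\<lambda>b. b))"

lemma quot_basis: "mp.rel_basis (A.part i j) (bigraded_part U i j) (quot_basis i j) (\<lambda>b. b)"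
  unfolding quot_basis_def
  by (rule someI_ex, rule mp.rel_basis_exists)
    (auto simp: ideal_part_def intro: A.part_subspace[unfolded ideal_part_def] bigraded_part_subspace
      bigraded_part_fin_dim A.finite_vars)

lemma card_quot_basis: "card (quot_basis i j) = hilbert_fun U J i j"
proof -
  have "mp.dim (bigraded_part U i j :: 'k mpoly set) = mp.dim (A.part i j) + card (quot_basis i j)"
    by (rule mp.rel_basis_dim[OF quot_basis A.part_subspace _ bigraded_part_fin_dim[OF A.finite_vars]])
      (auto simp: ideal_part_def)
  then show ?thesis
    using hilbert_fun_add_dim[OF A.ideal A.finite_vars, of i j] by simp
qed

lemma in_extA: "p \<in> J \<Longrightarrow> p \<in> extA"
  using genideal_superset[of J "U \<union> V"] genideal_eq_ext_ideal[OF A.ideal, of "U \<union> V"]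
    is_idealD(1)[OF A.ideal] polys_mono[of U "U \<union> V"] by blast

lemma in_extB: "q \<in> J' \<Longrightarrow> q \<in> extB"
  using genideal_superset[of J' "U \<union> V"] genideal_eq_ext_ideal[OF B.ideal, of "U \<union> V"]
    is_idealD(1)[OF B.ideal] polys_mono[of V "U \<union> V"] by blast

text \<open>In bidegree (a, b) the products form a basis of (P/J) \<otimes> J' over the shared ring:
  free generators of \<open>J'\<close>, times a k-basis of the quotient by \<open>J\<close> in the
  complementary bidegree.\<close>

abbreviation "sum_index a b \<equiv> (SIGMA t:B.gen_index a b. quot_basis (a - fst t) (b - fst (snd t)))"
abbreviation "sum_fam \<equiv> \<lambda>(t, c). c * snd (snd t)"

text \<open>Modulo \<open>J\<close> the factor \<open>p\<close> is a combination of
  \<open>quot_basis\<close>, and the error times the generator lies in \<open>extA\<close>.\<close>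

lemma monomial_times_gen:
  assumes t: "t \<in> B.gen_index a b" and p: "p \<in> bigraded_part U (a - fst t) (b - fst (snd t))"
  shows "\<exists>s\<in>mp.span (sum_fam ` sum_index a b). p * snd (snd t) - s \<in> extA"
proof -
  obtain i j \<beta> where tt: "t = (i, j, \<beta>)" by (cases t)
  obtain s where s: "s \<in> mp.span (quot_basis (a - i) (b - j))" "p - s \<in> A.part (a - i) (b - j)"
    using mp.rel_basisD(3)[OF quot_basis p[unfolded tt fst_conv snd_conv]] by auto
  have "\<beta> \<in> polys V"
    using t B.part_polys[OF B.new_gens_part[of \<beta> i j]] by (auto simp: tt B.gen_index_def)
  then have \<beta>: "\<beta> \<in> polys (U \<union> V)" using polys_mono[of V "U \<union> V"] by auto
  have "s * \<beta> \<in> mp.span (sum_fam ` sum_index a b)"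
    using s(1)
  proof (induction rule: mp.span_induct_alt)
    case base
    show ?case by (simp add: mp.span_zero)
  next
    case (step c x y)
    have "x * \<beta> = sum_fam (t, x)" by (simp add: tt)
    moreover have "(t, x) \<in> sum_index a b" using step t by (simp add: tt)
    ultimately have m: "x * \<beta> \<in> sum_fam ` sum_index a b" by blast
    have "kscale c (x * \<beta>) + y * \<beta> \<in> mp.span (sum_fam ` sum_index a b)"
      by (rule mp.span_add[OF mp.span_scale[OF mp.span_base[OF m]] step.IH])
    then show ?case by (simp only: distrib_right kscale_mult_left)
  qed
  moreover have "p * \<beta> - s * \<beta> \<in> extA"
  proof -
    have "\<beta> * (p - s) \<in> extA"
      using s(2) in_extA by (intro is_idealD(4)[OF extA_ideal \<beta>]) (auto simp: ideal_part_def)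
    then show ?thesis by (simp add: algebra_simps)
  qed
  ultimately show ?thesis by (auto simp: tt)
qed

lemma extB_part_spanned:
  assumes v: "v \<in> ideal_part (U \<union> V) extB a b"
  shows "\<exists>s\<in>mp.span (sum_fam ` sum_index a b). v - s \<in> extA"
proof -
  \<comment> \<open>The elements congruent modulo \<open>extA\<close> to the span form a subspace,
    so it suffices to treat the summands of the expansion of \<open>v\<close> over
    \<open>polys V\<close>.\<close>
  let ?T = "{w. \<exists>s\<in>mp.span (sum_fam ` sum_index a b). w - s \<in> extA}"
  have T: "mp.subspace ?T"
  proof (rule mp.subspaceI)
    show "0 \<in> ?T" using is_idealD(2)[OF extA_ideal] mp.span_zero by force
  next
    fix x y assume "x \<in> ?T" "y \<in> ?T"
    then obtain s s' where "s \<in> mp.span (sum_fam ` sum_index a b)" "x - s \<in> extA"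
      "s' \<in> mp.span (sum_fam ` sum_index a b)" "y - s' \<in> extA" by blast
    then have "s + s' \<in> mp.span (sum_fam ` sum_index a b)" "(x - s) + (y - s') \<in> extA"
      using mp.span_add is_idealD(3)[OF extA_ideal] by blast+
    moreover have "(x + y) - (s + s') = (x - s) + (y - s')" by simp
    ultimately show "x + y \<in> ?T" by (metis (mono_tags, lifting) mem_Collect_eq)
  next
    fix c x assume "x \<in> ?T"
    then obtain s where "s \<in> mp.span (sum_fam ` sum_index a b)" "x - s \<in> extA" by blast
    then have "kscale c s \<in> mp.span (sum_fam ` sum_index a b)" "kscale c x - kscale c s \<in> extA"
      using mp.span_scale is_idealD(5)[OF extA_ideal, of "x - s" c]
      by (auto simp: mp.scale_right_diff_distrib)
    then show "kscale c x \<in> ?T" by blast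
  qed
  have "single \<nu> 1 * mcoeff V \<nu> v \<in> ?T" if \<nu>: "\<nu> \<in> restr (- V) ` keys v" for \<nu>
  proof -
    obtain \<mu> where m: "\<mu> \<in> keys v" "\<nu> = restr (- V) \<mu>" using \<nu> by blast
    have vb: "v \<in> bigraded_part (U \<union> V) a b" and vB: "v \<in> extB" using v by (auto simp: ideal_part_def)
    have "\<mu> \<in> mons (U \<union> V) a b" using vb m(1) by (auto simp: bigraded_part_iff)
    then have \<nu>U: "keys \<nu> \<subseteq> U" and \<nu>V: "keys \<nu> \<inter> V = {}"
      unfolding m by (auto simp: mons_def keys_restr)
    show ?thesis
    proof (cases "xdeg \<nu> \<le> a \<and> ydeg \<nu> \<le> b")
      case False
      then show ?thesis using mcoeff_bigraded_part(2)[OF vb, of \<nu> V] mp.subspace_0[OF T] by simp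
    next
      case le: True
      let ?a = "a - xdeg \<nu>" and ?b = "b - ydeg \<nu>"
      have "mcoeff V \<nu> v \<in> B.part ?a ?b"
        using mcoeff_bigraded_part(1)[OF vb, of V \<nu>] vB \<nu>V by (simp add: ideal_part_def ext_ideal_def)
      then obtain c where c: "mcoeff V \<nu> v = (\<Sum>t\<in>B.gen_index ?a ?b. kscale (c t) (B.gen_shift ?a ?b t))"
        using rel_basis_expansion[OF B.gen_shift_rel_basis] by blast
      have "single \<nu> 1 * B.gen_shift ?a ?b t \<in> ?T" if t: "t \<in> B.gen_index ?a ?b" for t
      proof -
        obtain i j \<beta> where tt: "t = (i, j, \<beta>)" by (cases t)
        have ij: "i \<le> ?a" "j \<le> ?b" and t': "t \<in> B.gen_index a b"
          using t by (auto simp: tt B.gen_index_def)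
        \<comment> \<open>The monomial \<open>\<nu>\<close> and the shared monomial both lie in
          \<open>polys U\<close>; together they form a factor of exactly the bidegree missing from
          the generator.\<close>
        have "single \<nu> 1 * xypow m (?a - i) (?b - j)
            \<in> bigraded_part U (xdeg \<nu> + (?a - i)) (ydeg \<nu> + (?b - j))"
          by (intro bigraded_part_mult bigraded_part_single \<nu>U xypow_bigraded_part A.xvar A.yvar)
        moreover have "xdeg \<nu> + (?a - i) = a - i" "ydeg \<nu> + (?b - j) = b - j" using le ij by auto
        ultimately have "single \<nu> 1 * xypow m (?a - i) (?b - j) \<in> bigraded_part U (a - fst t) (b - fst (snd t))"
          by (simp add: tt)
        from monomial_times_gen[OF t' this] show ?thesis
          by (simp add: tt B.gen_shift_def mult.assoc)
      qed
      then have "(\<Sum>t\<in>B.gen_index ?a ?b. kscale (c t) (single \<nu> 1 * B.gen_shift ?a ?b t)) \<in> ?T"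
        by (intro mp.subspace_sum[OF T] mp.subspace_scale[OF T])
      then show ?thesis unfolding c by (simp only: sum_distrib_left kscale_mult_right)
    qed
  qed
  then have "(\<Sum>\<nu>\<in>restr (- V) ` keys v. single \<nu> 1 * mcoeff V \<nu> v) \<in> ?T"
    by (rule mp.subspace_sum[OF T])
  then show ?thesis using mcoeff_decomposition[of v V] by simp
qed

text \<open>The quotient of \<open>sum_ideal\<close> by \<open>extA\<close> is the image of
  \<open>extB\<close>, that is, of (P/J) \<otimes> J'. It is spanned by the family according to
  \<open>extB_part_spanned\<close>, and independence is \<open>coefficients_in_A\<close>.\<close>

lemma sum_rel_basis:
  "mp.rel_basis (ideal_part (U \<union> V) extA a b) (ideal_part (U \<union> V) sum_ideal a b)
    (sum_index a b) sum_fam"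
proof -
  have memb: "sum_fam (t, c) \<in> ideal_part (U \<union> V) sum_ideal a b"
    if t: "t \<in> B.gen_index a b" and c: "c \<in> quot_basis (a - fst t) (b - fst (snd t))" for t c
  proof -
    obtain i j \<beta> where tt: "t = (i, j, \<beta>)" by (cases t)
    have ij: "i \<le> a" "j \<le> b" and \<beta>: "\<beta> \<in> B.part i j"
      using t B.new_gens_part by (auto simp: tt B.gen_index_def)
    have cP: "c \<in> bigraded_part (U \<union> V) (a - i) (b - j)"
      using mp.rel_basisD(2)[OF quot_basis, of c] c
        subsetD[OF bigraded_part_mono[of U "U \<union> V" "a - i" "b - j"], of c] by (simp add: tt)
    have "\<beta> \<in> extB" using \<beta> in_extB by (auto simp: ideal_part_def)
    then have "c * \<beta> \<in> extB"
      using is_idealD(4)[OF extB_ideal] cP bigraded_part_polys by blast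
    then have "c * \<beta> \<in> sum_ideal"
      unfolding sum_ideal_def using is_idealD(2)[OF extA_ideal] by force
    moreover have "\<beta> \<in> bigraded_part (U \<union> V) i j"
      using \<beta> bigraded_part_mono[of V "U \<union> V"] by (auto simp: ideal_part_def)
    from bigraded_part_mult[OF cP this] have "c * \<beta> \<in> bigraded_part (U \<union> V) a b" using ij by simp
    ultimately show ?thesis by (simp add: tt ideal_part_def)
  qed
  have fin: "finite (sum_index a b)"
    using mp.rel_basisD(1)[OF quot_basis] B.finite_gen_index by (intro finite_SigmaI) auto
  have span_part: "mp.span (sum_fam ` sum_index a b) \<subseteq> bigraded_part (U \<union> V) a b"
    using memb by (intro mp.span_minimal bigraded_part_subspace) (auto simp: ideal_part_def)
  show ?thesis
  proof (rule mp.rel_basisI[OF fin])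
    show "sum_fam ` sum_index a b \<subseteq> ideal_part (U \<union> V) sum_ideal a b"
      using memb by auto
  next
    fix w assume w: "w \<in> ideal_part (U \<union> V) sum_ideal a b"
    then obtain p q where pq: "w = p + q" "p \<in> extA" "q \<in> extB"
      by (auto simp: ideal_part_def sum_ideal_def)
    have wb: "w \<in> bigraded_part (U \<union> V) a b" using w by (simp add: ideal_part_def)
    \<comment> \<open>Both extended ideals are bigraded, so the summands may be replaced by their
      components of bidegree (a, b).\<close>
    have e: "w = bipart a b p + bipart a b q"
      using bipart_self[OF wb] by (simp add: pq bipart_add)
    have "bipart a b p \<in> extA" "bipart a b q \<in> extB"
      using ext_ideal_bigraded[OF bigradedA is_idealD(2)[OF A.ideal], of "U \<union> V" U]
        ext_ideal_bigraded[OF bigradedB is_idealD(2)[OF B.ideal], of "U \<union> V" V] pq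
      by (auto simp: is_bigraded_def)
    moreover have "bipart a b q \<in> bigraded_part (U \<union> V) a b"
      using pq is_idealD(1)[OF extB_ideal] by (intro bipart_mem) auto
    ultimately have "bipart a b q \<in> ideal_part (U \<union> V) extB a b" by (simp add: ideal_part_def)
    then obtain s where s: "s \<in> mp.span (sum_fam ` sum_index a b)" "bipart a b q - s \<in> extA"
      using extB_part_spanned by blast
    have "w - s = bipart a b p + (bipart a b q - s)" by (simp add: e)
    then have "w - s \<in> extA" using is_idealD(3)[OF extA_ideal \<open>bipart a b p \<in> extA\<close> s(2)] by metis
    moreover have "w - s \<in> bigraded_part (U \<union> V) a b"
      using wb s span_part by (intro mp.subspace_diff[OF bigraded_part_subspace]) auto
    ultimately show "\<exists>s\<in>mp.span (sum_fam ` sum_index a b). w - s \<in> ideal_part (U \<union> V) extA a b"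
      using s by (auto simp: ideal_part_def)
  next
    fix l i
    assume s: "(\<Sum>i\<in>sum_index a b. kscale (l i) (sum_fam i)) \<in> ideal_part (U \<union> V) extA a b"
      and i: "i \<in> sum_index a b"
    let ?Q = "\<lambda>t. quot_basis (a - fst t) (b - fst (snd t))"
    \<comment> \<open>Collecting the terms that belong to one generator produces coefficients in
      \<open>polys U\<close>, to which \<open>coefficients_in_A\<close> applies.\<close>
    define p where "p t = (\<Sum>c\<in>?Q t. kscale (l (t, c)) c)" for t
    have pP: "p t \<in> bigraded_part U (a - fst t) (b - fst (snd t))" for t
      unfolding p_def using mp.rel_basisD(2)[OF quot_basis]
      by (intro mp.subspace_sum[OF bigraded_part_subspace] mp.subspace_scale[OF bigraded_part_subspace]) auto
    have "(\<Sum>i\<in>sum_index a b. kscale (l i) (sum_fam i)) =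
        (\<Sum>t\<in>B.gen_index a b. \<Sum>c\<in>?Q t. kscale (l (t, c)) (c * snd (snd t)))"
      using mp.rel_basisD(1)[OF quot_basis] B.finite_gen_index
      by (subst sum.Sigma) (auto simp: case_prod_unfold)
    also have "\<dots> = (\<Sum>t\<in>B.gen_index a b. p t * snd (snd t))"
      by (simp add: p_def sum_distrib_right kscale_mult_left)
    finally have "(\<Sum>t\<in>B.gen_index a b. p t * snd (snd t)) \<in> extA" using s by (simp add: ideal_part_def)
    moreover obtain t c where tc: "i = (t, c)" "t \<in> B.gen_index a b" "c \<in> ?Q t" using i by auto
    ultimately have "p t \<in> J"
      using coefficients_in_A[of a b p t] pP bigraded_part_polys by blast
    then have "p t \<in> A.part (a - fst t) (b - fst (snd t))" using pP by (simp add: ideal_part_def)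
    then show "l i = 0"
      using mp.rel_basisD(4)[OF quot_basis, of "\<lambda>c. l (t, c)"] tc by (simp add: p_def)
  qed
qed

text \<open>Each generator of \<open>J'\<close> contributes a copy of the quotient by
  \<open>J\<close>, shifted by its bidegree, and \<open>card_new_gens\<close> counts the
  generators.\<close>

lemma dim_sum_ideal:
  "int (mp.dim (ideal_part (U \<union> V) sum_ideal a b)) =
    int (mp.dim (ideal_part (U \<union> V) extA a b)) +
    (\<Sum>i\<le>a. \<Sum>j\<le>b. back_diff2 (\<lambda>i j. int (mp.dim (B.part i j))) i j * int (hilbert_fun U J (a - i) (b - j)))"
proof -
  have "extA \<subseteq> sum_ideal" unfolding sum_ideal_def using is_idealD(2)[OF extB_ideal] by force
  then have "mp.dim (ideal_part (U \<union> V) sum_ideal a b) =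
      mp.dim (ideal_part (U \<union> V) extA a b) + card (sum_index a b)"
    using A.finite_vars B.finite_vars
    by (intro mp.rel_basis_dim[OF sum_rel_basis] ideal_part_subspace[OF extA_ideal] ideal_part_fin_dim)
      (auto simp: ideal_part_def)
  moreover have "card (sum_index a b) =
      (\<Sum>t\<in>B.gen_index a b. hilbert_fun U J (a - fst t) (b - fst (snd t)))"
    using mp.rel_basisD(1)[OF quot_basis] by (simp add: card_SigmaI B.finite_gen_index card_quot_basis)
  moreover have "\<dots> = (\<Sum>i\<le>a. \<Sum>j\<le>b. \<Sum>\<beta>\<in>B.new_gens i j. hilbert_fun U J (a - i) (b - j))"
    unfolding B.gen_index_def by (rule sum_Sigma_Sigma) (simp_all add: B.finite_new_gens)
  ultimately show ?thesis by (simp add: B.card_new_gens)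
qed

end

section \<open>The Hilbert series of a sum of ideals\<close>

lemma fps_nth_mult_one_minus_X:
  "fps_nth (f * (1 - fps_X)) i = fps_nth f i - (if i = 0 then 0 else fps_nth f (i - 1))"
  for f :: "'a::comm_ring_1 fps"
  by (simp add: right_diff_distrib)

lemma fps_nth2_mult_one_minus:
  fixes f :: "int fps fps"
  shows "fps_nth (fps_nth (f * (1 - fps_X) * fps_const (1 - fps_X)) i) j =
    back_diff2 (\<lambda>i j. fps_nth (fps_nth f i) j) i j"
  unfolding fps_mult_right_const_nth fps_nth_mult_one_minus_X
  by (auto simp: back_diff2_def back_diff_def algebra_simps)

lemma back_diff2_diff:
  "back_diff2 (\<lambda>i j. f i j - g i j) i j = back_diff2 f i j - back_diff2 g i j"
  by (simp add: back_diff2_def back_diff_def)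

lemma fps_nth2_hilbert_series [simp]:
  "fps_nth (fps_nth (hilbert_series V J) i) j = int (hilbert_fun V J i j)"
  by (simp add: hilbert_series_def)

context ideal_pair
begin

text \<open>\<open>dim_sum_ideal\<close> is used twice, for \<open>J'\<close> and for the whole ring
  \<open>polys V\<close> in its place. The second use computes the dimension of the ambient ring,
  and the contribution of \<open>extA\<close> cancels in the difference.\<close>

lemma hilbert_series_sum_ideal:
  "hilbert_series (U \<union> V) sum_ideal =
    hilbert_series U J * (hilbert_series V J' * (1 - fps_X) * fps_const (1 - fps_X))"
proof (intro fps_ext)
  fix a b
  interpret Q: ideal_pair m U V J "polys V"
  proof unfold_locales
    show "is_ideal V (polys V :: 'k mpoly set)"
      by (auto simp: is_ideal_def polys_zero intro: polys_add polys_mult)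
    show "saturated m V (polys V :: 'k mpoly set)" by (simp add: saturated_def)
    show "is_bigraded (polys V :: 'k mpoly set)"
      using bipart_mem bigraded_part_polys by (fastforce simp: is_bigraded_def)
  qed (use A.finite_vars B.finite_vars B.xvar B.yvar A.xvar A.yvar A.ideal A.sat shared bigradedA in auto)
  have "polys (U \<union> V) \<subseteq> Q.sum_ideal"
    unfolding Q.sum_ideal_def using is_idealD(2)[OF extA_ideal]
    by (force simp: ext_ideal_def mcoeff_polys)
  then have Qs: "Q.sum_ideal = polys (U \<union> V)" using is_idealD(1)[OF Q.sum_ideal_ideal] by blast
  let ?P = "\<lambda>V i j. bigraded_part V i j :: 'k mpoly set"
  have whole: "ideal_part W (polys W) i j = ?P W i j" for W i j
    using bigraded_part_polys by (auto simp: ideal_part_def)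
  let ?H = "\<lambda>i j. int (hilbert_fun U J i j)"
  have HB: "int (hilbert_fun V J' i j) = int (mp.dim (?P V i j)) - int (mp.dim (B.part i j))" for i j
    using hilbert_fun_add_dim[OF B.ideal B.finite_vars, of i j] by simp
  have e: "(\<lambda>i. fps_nth (fps_nth (hilbert_series V J') i)) = (\<lambda>i j. int (hilbert_fun V J' i j))"
    by (simp add: fun_eq_iff)
  have "int (hilbert_fun (U \<union> V) sum_ideal a b) =
      int (mp.dim (?P (U \<union> V) a b)) - int (mp.dim (ideal_part (U \<union> V) sum_ideal a b))"
    using hilbert_fun_add_dim[OF sum_ideal_ideal, of a b] A.finite_vars B.finite_vars by simp
  also have "int (mp.dim (?P (U \<union> V) a b)) = int (mp.dim (ideal_part (U \<union> V) extA a b)) +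
      (\<Sum>i\<le>a. \<Sum>j\<le>b. back_diff2 (\<lambda>i j. int (mp.dim (?P V i j))) i j * ?H (a - i) (b - j))"
    using Q.dim_sum_ideal[of a b] by (simp add: Qs whole)
  also have "\<dots> - int (mp.dim (ideal_part (U \<union> V) sum_ideal a b)) =
      (\<Sum>i\<le>a. \<Sum>j\<le>b. back_diff2 (\<lambda>i j. int (hilbert_fun V J' i j)) i j * ?H (a - i) (b - j))"
    unfolding dim_sum_ideal HB
    by (simp add: back_diff2_diff left_diff_distrib sum_subtractf)
  also have "\<dots> = fps_nth (fps_nth ((hilbert_series V J' * (1 - fps_X) * fps_const (1 - fps_X)) *
      hilbert_series U J) a) b"
    unfolding fps_mult_nth[of _ "hilbert_series U J"] fps_sum_nth fps_mult_nth[of _ "fps_nth _ _"]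
      fps_nth2_mult_one_minus e
    by (simp add: atLeast0AtMost)
  finally show "fps_nth (fps_nth (hilbert_series (U \<union> V) sum_ideal) a) b =
      fps_nth (fps_nth (hilbert_series U J *
        (hilbert_series V J' * (1 - fps_X) * fps_const (1 - fps_X))) a) b"
    by (simp add: mult.commute)
qed

end

text \<open>The cokernel of \<open>F \<otimes> F'\<close> in degree zero is \<open>S/J \<otimes> S/J' = S/(J + J')\<close>, so \<open>K\<close> and \<open>J + J'\<close>
  annihilate the same cyclic module.\<close>

lemma free_module_iff:
  "u \<in> free_module V B \<longleftrightarrow> finite {b. u b \<noteq> 0} \<and> (\<forall>b. u b \<noteq> 0 \<longrightarrow> b \<in> B) \<and> (\<forall>b. u b \<in> polys V)"
  by (auto simp: free_module_def)

lemma lin_comb_superset: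
  "finite A \<Longrightarrow> {b. u b \<noteq> 0} \<subseteq> A \<Longrightarrow> lin_comb u e = (\<Sum>b\<in>A. u b * e b)"
  unfolding lin_comb_def by (rule sum.mono_neutral_left) auto

lemma lin_comb_single [simp]: "lin_comb (\<lambda>b. if b = a then r else 0) e = r * e a"
  by (subst lin_comb_superset[of "{a}"]) auto

lemma free_module_single:
  "a \<in> B \<Longrightarrow> r \<in> polys V \<Longrightarrow> (\<lambda>b. if b = a then r else 0) \<in> free_module V B"
  by (auto simp: free_module_iff polys_zero intro: finite_subset[of _ "{a}"])

text \<open>What a resolution says about the presentation \<open>F\<^sub>1 \<rightarrow> F\<^sub>0
  \<rightarrow> S/J \<rightarrow> 0\<close>, without the bidegrees.\<close>

definition coker_ideal :: "var set \<Rightarrow> ('k::field, 'b) free_complex \<Rightarrow> 'k mpoly set \<Rightarrow> ('b \<Rightarrow> 'k mpoly) \<Rightarrow> bool"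
where
  "coker_ideal V F J \<epsilon> \<longleftrightarrow>
     (\<forall>b\<in>basis F 0. \<epsilon> b \<in> polys V) \<and>
     (\<forall>b\<in>basis F (Suc 0). diff F 0 b \<in> free_module V (basis F 0)) \<and>
     {u \<in> free_module V (basis F 0). lin_comb u \<epsilon> \<in> J} = apply_matrix (diff F 0) ` free_module V (basis F 1) \<and>
     (\<forall>s\<in>polys V. \<exists>u\<in>free_module V (basis F 0). s - lin_comb u \<epsilon> \<in> J)"

lemma coker_idealD:
  assumes "coker_ideal V F J \<epsilon>"
  shows "b \<in> basis F 0 \<Longrightarrow> \<epsilon> b \<in> polys V"
    and "{u \<in> free_module V (basis F 0). lin_comb u \<epsilon> \<in> J} = apply_matrix (diff F 0) ` free_module V (basis F 1)"
proof -
  note a = assms[unfolded coker_ideal_def]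
  show "b \<in> basis F 0 \<Longrightarrow> \<epsilon> b \<in> polys V" by (rule bspec[OF conjunct1[OF a]])
  show "{u \<in> free_module V (basis F 0). lin_comb u \<epsilon> \<in> J} = apply_matrix (diff F 0) ` free_module V (basis F 1)"
    by (rule conjunct1[OF conjunct2[OF conjunct2[OF a]]])
qed

lemma free_resolution_coker:
  assumes "free_resolution V J F"
  shows "\<exists>\<epsilon>. coker_ideal V F J \<epsilon>"
proof -
  note r = assms[unfolded free_resolution_def]
  have d: "\<forall>b\<in>basis F (Suc 0). diff F 0 b \<in> free_module V (basis F 0)"
    using conjunct1[OF r, unfolded bigraded_free_seq_def, rule_format, of _ 0] by blast
  from conjunct2[OF conjunct2[OF r]] obtain \<epsilon> where
    e: "\<forall>b\<in>basis F 0. \<epsilon> b \<in> polys V \<and> bihomogeneous (\<epsilon> b) (bideg F 0 b)"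
      "{u \<in> free_module V (basis F 0). lin_comb u \<epsilon> \<in> J} =
        apply_matrix (diff F 0) ` free_module V (basis F 1)"
      "\<forall>s\<in>polys V. \<exists>u\<in>free_module V (basis F 0). s - lin_comb u \<epsilon> \<in> J"
    by (elim exE conjE)
  show ?thesis unfolding coker_ideal_def
    by (intro exI[of _ \<epsilon>] conjI d e(2,3)) (use e(1) in blast)
qed

text \<open>\<open>J\<close> annihilates S/J, so a member of \<open>J\<close> times a basis element
  is a boundary.\<close>

lemma coker_mult_basis:
  assumes c: "coker_ideal V F J \<epsilon>" and J: "is_ideal V J" and j: "j \<in> J" and b: "b \<in> basis F 0"
  shows "\<exists>w\<in>free_module V (basis F 1). apply_matrix (diff F 0) w = (\<lambda>c. if c = b then j else 0)"
proof -
  have "\<epsilon> b \<in> polys V" "j \<in> polys V" using c b j is_idealD(1)[OF J] by (auto simp: coker_ideal_def)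
  then have "lin_comb (\<lambda>c. if c = b then j else 0) \<epsilon> \<in> J"
    using is_idealD(4)[OF J, of "\<epsilon> b" j] j by (simp add: mult.commute)
  then have "(\<lambda>c. if c = b then j else 0) \<in> {u \<in> free_module V (basis F 0). lin_comb u \<epsilon> \<in> J}"
    using free_module_single[OF b \<open>j \<in> polys V\<close>] by simp
  then show ?thesis using c unfolding coker_ideal_def by (auto simp: image_iff)
qed

section \<open>The tensor product complex in low degrees\<close>

lemma tensor_basis_0: "basis (tensor_complex F F') 0 = {(0, b, b') | b b'. b \<in> basis F 0 \<and> b' \<in> basis F' 0}"
  by (auto simp: tensor_complex_def)

lemma tensor_basis_1: "basis (tensor_complex F F') 1 =
  {(Suc 0, b, b') | b b'. b \<in> basis F 1 \<and> b' \<in> basis F' 0} \<union>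
  {(0, b, b') | b b'. b \<in> basis F 0 \<and> b' \<in> basis F' 1}"
  by (auto simp: tensor_complex_def le_Suc_eq)

lemma apply_matrix_superset:
  "finite A \<Longrightarrow> {b. u b \<noteq> 0} \<subseteq> A \<Longrightarrow> apply_matrix D u c = (\<Sum>b\<in>A. u b * D b c)"
  unfolding apply_matrix_def by (rule lin_comb_superset)

lemma apply_matrix_single: "apply_matrix D (\<lambda>b. if b = a then r else 0) = (\<lambda>c. r * D a c)"
  by (simp add: apply_matrix_def)

lemma lin_comb_apply_matrix:
  assumes fw: "finite {y. w y \<noteq> 0}" and fD: "\<And>y. w y \<noteq> 0 \<Longrightarrow> finite {x. D y x \<noteq> 0}"
  shows "lin_comb (apply_matrix D w) e = (\<Sum>y | w y \<noteq> 0. w y * lin_comb (D y) e)"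
proof -
  \<comment> \<open>One finite range \<open>?B\<close> for all the inner sums allows the order of
    summation to be exchanged.\<close>
  let ?A = "{y. w y \<noteq> 0}" and ?B = "\<Union>y\<in>{y. w y \<noteq> 0}. {x. D y x \<noteq> 0}"
  have fB: "finite ?B" using fw fD by blast
  have a: "apply_matrix D w x = (\<Sum>y\<in>?A. w y * D y x)" for x by (rule apply_matrix_superset[OF fw]) simp
  have "{x. apply_matrix D w x \<noteq> 0} \<subseteq> ?B"
  proof
    fix x assume "x \<in> {x. apply_matrix D w x \<noteq> 0}"
    then have "(\<Sum>y\<in>?A. w y * D y x) \<noteq> 0" by (simp add: a)
    then obtain y where "y \<in> ?A" "w y * D y x \<noteq> 0" by (rule sum.not_neutral_contains_not_neutral)
    then show "x \<in> ?B" by auto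
  qed
  then have "lin_comb (apply_matrix D w) e = (\<Sum>x\<in>?B. (\<Sum>y\<in>?A. w y * D y x) * e x)"
    by (subst lin_comb_superset[OF fB]) (simp_all only: a)
  also have "\<dots> = (\<Sum>y\<in>?A. \<Sum>x\<in>?B. w y * (D y x * e x))"
    by (subst sum.swap) (simp add: sum_distrib_right mult.assoc)
  also have "\<dots> = (\<Sum>y\<in>?A. w y * lin_comb (D y) e)"
  proof (rule sum.cong[OF refl])
    fix y assume "y \<in> ?A"
    then have "lin_comb (D y) e = (\<Sum>x\<in>?B. D y x * e x)" by (intro lin_comb_superset[OF fB]) blast
    then show "(\<Sum>x\<in>?B. w y * (D y x * e x)) = w y * lin_comb (D y) e"
      by (simp add: sum_distrib_left)
  qed
  finally show ?thesis .
qed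

lemma lin_comb_in_ideal:
  assumes I: "is_ideal V I" and u: "u \<in> free_module V B" and e: "\<And>b. b \<in> B \<Longrightarrow> e b \<in> I"
  shows "lin_comb u e \<in> I"
  unfolding lin_comb_def
  by (rule is_ideal_sum[OF I], rule is_idealD(4)[OF I]) (use u e in \<open>auto simp: free_module_iff\<close>)

lemma coker_image_in_ideal:
  assumes c: "coker_ideal V F J \<epsilon>" and b: "b \<in> basis F 1"
  shows "lin_comb (diff F 0 b) \<epsilon> \<in> J"
proof -
  have "diff F 0 b = apply_matrix (diff F 0) (\<lambda>c. if c = b then 1 else 0)"
    by (simp add: apply_matrix_single)
  then have "diff F 0 b \<in> apply_matrix (diff F 0) ` free_module V (basis F 1)"
    using free_module_single[OF b polys_one] by blast
  then show ?thesis using c unfolding coker_ideal_def by blast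
qed

text \<open>If \<open>j\<close> annihilates the image of every basis element in S/K, it annihilates
  1, which is the image of some \<open>u\<close>; and the annihilator of S/K is
  \<open>K\<close>.\<close>

lemma coker_ideal_subset:
  assumes c: "coker_ideal V F K \<epsilon>" and K: "is_ideal V K" and j: "j \<in> polys V"
    and w: "\<And>b. b \<in> basis F 0 \<Longrightarrow>
      \<exists>w\<in>free_module V (basis F 1). apply_matrix (diff F 0) w = (\<lambda>c. if c = b then j else 0)"
  shows "j \<in> K"
proof -
  have m: "j * \<epsilon> b \<in> K" if "b \<in> basis F 0" for b
  proof -
    have "(\<lambda>c. if c = b then j else 0) \<in> {u \<in> free_module V (basis F 0). lin_comb u \<epsilon> \<in> K}"
      unfolding coker_idealD(2)[OF c] using w[OF that] by (metis image_eqI)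
    then show ?thesis by simp
  qed
  obtain u where u: "u \<in> free_module V (basis F 0)" "1 - lin_comb u \<epsilon> \<in> K"
    using c polys_one unfolding coker_ideal_def by blast
  have "j * lin_comb u \<epsilon> = lin_comb u (\<lambda>b. j * \<epsilon> b)"
    by (simp add: lin_comb_def sum_distrib_left ac_simps)
  then have "j * lin_comb u \<epsilon> \<in> K" using lin_comb_in_ideal[OF K u(1)] m by simp
  moreover have "j * (1 - lin_comb u \<epsilon>) \<in> K" using is_idealD(4)[OF K j u(2)] .
  ultimately have "j * (1 - lin_comb u \<epsilon>) + j * lin_comb u \<epsilon> \<in> K" using is_idealD(3)[OF K] by blast
  then show ?thesis by (simp add: algebra_simps)
qed

lemma lin_comb_embed:
  assumes w: "finite {c. w c \<noteq> 0}" and f: "inj f"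
    and W: "\<And>c. W (f c) = w c" "\<And>y. y \<notin> range f \<Longrightarrow> W y = 0"
  shows "lin_comb W e = lin_comb w (\<lambda>c. e (f c))"
proof -
  have "lin_comb W e = (\<Sum>y\<in>f ` {c. w c \<noteq> 0}. W y * e y)"
  proof (rule lin_comb_superset)
    show "{y. W y \<noteq> 0} \<subseteq> f ` {c. w c \<noteq> 0}"
    proof
      fix y assume y: "y \<in> {y. W y \<noteq> 0}"
      then obtain c where "y = f c" using W(2)[of y] by blast
      then show "y \<in> f ` {c. w c \<noteq> 0}" using y W(1)[of c] by simp
    qed
  qed (use w in simp)
  also have "\<dots> = lin_comb w (\<lambda>c. e (f c))"
    unfolding lin_comb_def by (subst sum.reindex) (use f W in \<open>auto intro: inj_on_subset\<close>)
  finally show ?thesis .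
qed

text \<open>Meant for the embeddings that fix the basis element of the other factor:
  \<open>f\<close> on degree one and \<open>e\<close> on degree zero carry a boundary of a factor to
  a boundary of the tensor complex.\<close>

lemma lift_boundary:
  assumes w: "w \<in> free_module V (basis F 1)" "apply_matrix (diff F 0) w = (\<lambda>c. if c = b then j else 0)"
    and f: "inj f" "f ` basis F 1 \<subseteq> basis T 1" and e: "inj e"
    and D: "\<And>c d. diff T 0 (f c) (e d) = diff F 0 c d" "\<And>c x. x \<notin> range e \<Longrightarrow> diff T 0 (f c) x = 0"
  shows "\<exists>W\<in>free_module V (basis T 1). apply_matrix (diff T 0) W = (\<lambda>x. if x = e b then j else 0)"
proof
  define W where "W y = (if y \<in> range f then w (inv_into UNIV f y) else 0)" for y
  have Wf: "W (f c) = w c" for c using f(1) by (simp add: W_def)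
  have W0: "W y = 0" if "y \<notin> range f" for y using that by (simp add: W_def)
  have fw: "finite {c. w c \<noteq> 0}" using w(1) by (simp add: free_module_iff)
  have sub: "{y. W y \<noteq> 0} \<subseteq> f ` {c. w c \<noteq> 0}"
  proof
    fix y assume y: "y \<in> {y. W y \<noteq> 0}"
    then obtain c where "y = f c" using W0[of y] by blast
    then show "y \<in> f ` {c. w c \<noteq> 0}" using y Wf[of c] by simp
  qed
  show "W \<in> free_module V (basis T 1)"
    unfolding free_module_iff
  proof (intro conjI allI impI)
    show "finite {y. W y \<noteq> 0}" by (rule finite_subset[OF sub finite_imageI[OF fw]])
    show "y \<in> basis T 1" if "W y \<noteq> 0" for y
      using that sub f(2) w(1) unfolding free_module_iff by blast
    show "W y \<in> polys V" for y using w(1) by (simp add: W_def free_module_iff polys_zero)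
  qed
  have "apply_matrix (diff T 0) W x = (if x = e b then j else 0)" for x
  proof -
    have x: "apply_matrix (diff T 0) W x = lin_comb w (\<lambda>c. diff T 0 (f c) x)"
      unfolding apply_matrix_def by (rule lin_comb_embed[OF fw f(1) Wf W0])
    show ?thesis
    proof (cases "x \<in> range e")
      case True
      then obtain d where "x = e d" by blast
      then show ?thesis
        using x D(1) e fun_cong[OF w(2), of d] by (simp add: apply_matrix_def inj_eq)
    next
      case False
      then show ?thesis using x D(2) by (auto simp: lin_comb_def)
    qed
  qed
  then show "apply_matrix (diff T 0) W = (\<lambda>x. if x = e b then j else 0)" by blast
qed

lemma tensor_coker:
  fixes F :: "('k::field, 'b) free_complex" and F' :: "('k, 'c) free_complex"
  assumes cF: "coker_ideal V F J \<epsilon>" and cF': "coker_ideal V F' J' \<epsilon>'"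
    and cT: "coker_ideal V (tensor_complex F F') K \<epsilon>''"
    and J: "is_ideal V J" and J': "is_ideal V J'" and K: "is_ideal V K"
  shows "K = {p + q | p q. p \<in> J \<and> q \<in> J'}"
proof (intro equalityI)
  let ?T = "tensor_complex F F'" and ?L = "{p + q | p q. p \<in> J \<and> q \<in> J'}"
  let ?D = "diff ?T 0"
  have D1: "?D (Suc 0, c, b') (i, d, d') = (if i = 0 \<and> d' = b' then diff F 0 c d else 0)" for c b' i d d'
    by (auto simp: tensor_complex_def)
  \<comment> \<open>Here the first factor has degree 0, so the sign in the differential is
    1.\<close>
  have D0: "?D (0, b, c') (i, d, d') = (if i = 0 \<and> d = b then diff F' 0 c' d' else 0)" for b c' i d d'
    by (auto simp: tensor_complex_def)
  \<comment> \<open>\<open>j\<close> times a basis element is a boundary already in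
    \<open>F\<close>; with the second basis element fixed it becomes a boundary of the tensor
    complex.\<close>
  have "j \<in> K" if j: "j \<in> J" for j
  proof (rule coker_ideal_subset[OF cT K])
    show "j \<in> polys V" using j is_idealD(1)[OF J] by blast
    fix t assume "t \<in> basis ?T 0"
    then obtain b b' where t: "t = (0, b, b')" and b: "b \<in> basis F 0" "b' \<in> basis F' 0"
      by (auto simp: tensor_basis_0)
    obtain w where w: "w \<in> free_module V (basis F 1)"
      "apply_matrix (diff F 0) w = (\<lambda>c. if c = b then j else 0)"
      using coker_mult_basis[OF cF J j b(1)] by blast
    show "\<exists>w\<in>free_module V (basis ?T 1). apply_matrix ?D w = (\<lambda>c. if c = t then j else 0)"
      unfolding t
      by (rule lift_boundary[OF w, where f = "\<lambda>c. (Suc 0, c, b')" and e = "\<lambda>d. (0, d, b')"])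
        (use b in \<open>auto simp: tensor_basis_1[unfolded One_nat_def] inj_def D1 image_iff\<close>)
  qed
  moreover have "j \<in> K" if j: "j \<in> J'" for j
  proof (rule coker_ideal_subset[OF cT K])
    show "j \<in> polys V" using j is_idealD(1)[OF J'] by blast
    fix t assume "t \<in> basis ?T 0"
    then obtain b b' where t: "t = (0, b, b')" and b: "b \<in> basis F 0" "b' \<in> basis F' 0"
      by (auto simp: tensor_basis_0)
    obtain w where w: "w \<in> free_module V (basis F' 1)"
      "apply_matrix (diff F' 0) w = (\<lambda>c. if c = b' then j else 0)"
      using coker_mult_basis[OF cF' J' j b(2)] by blast
    show "\<exists>w\<in>free_module V (basis ?T 1). apply_matrix ?D w = (\<lambda>c. if c = t then j else 0)"
      unfolding t
      by (rule lift_boundary[OF w, where f = "\<lambda>c. (0, b, c)" and e = "\<lambda>d. (0, b, d)"])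
        (use b in \<open>auto simp: tensor_basis_1[unfolded One_nat_def] inj_def D0 image_iff\<close>)
  qed
  ultimately show "?L \<subseteq> K" using is_idealD(3)[OF K] by blast
  have L: "is_ideal V ?L" by (rule is_ideal_plus[OF J J'])
  have JL: "J \<subseteq> ?L" "J' \<subseteq> ?L" using is_idealD(2)[OF J] is_idealD(2)[OF J'] by force+
  have eps: "\<And>b. b \<in> basis F 0 \<Longrightarrow> \<epsilon> b \<in> polys V" "\<And>b. b \<in> basis F' 0 \<Longrightarrow> \<epsilon>' b \<in> polys V"
    by (rule coker_idealD(1)[OF cF] coker_idealD(1)[OF cF'], assumption)+
  \<comment> \<open>The product of the two augmentations. It sends boundaries of the tensor complex
    into \<open>?L\<close>.\<close>
  define e where "e = (\<lambda>(i::nat, d, d'). \<epsilon> d * \<epsilon>' d')"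
  have De: "lin_comb (?D y) e \<in> ?L" if y: "y \<in> basis ?T 1" for y
    using y unfolding tensor_basis_1
  proof (elim UnE CollectE exE conjE)
    fix c b' assume y: "y = (Suc 0, c, b')" and c: "c \<in> basis F 1" "b' \<in> basis F' 0"
    have f: "finite {d. diff F 0 c d \<noteq> 0}"
      using cF c unfolding coker_ideal_def free_module_iff by auto
    have "lin_comb (?D y) e = lin_comb (diff F 0 c) (\<lambda>d. e (0, d, b'))"
      by (rule lin_comb_embed[OF f]) (auto simp: y D1 inj_def image_iff)
    also have "\<dots> = \<epsilon>' b' * lin_comb (diff F 0 c) \<epsilon>"
      by (simp add: lin_comb_def sum_distrib_left e_def ac_simps)
    finally show ?thesis
      using subsetD[OF JL(1) is_idealD(4)[OF J eps(2)[OF c(2)] coker_image_in_ideal[OF cF c(1)]]]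
      by (simp only:)
  next
    fix b c assume y: "y = (0, b, c)" and c: "b \<in> basis F 0" "c \<in> basis F' 1"
    have f: "finite {d. diff F' 0 c d \<noteq> 0}"
      using cF' c unfolding coker_ideal_def free_module_iff by auto
    have "lin_comb (?D y) e = lin_comb (diff F' 0 c) (\<lambda>d. e (0, b, d))"
      by (rule lin_comb_embed[OF f]) (auto simp: y D0 inj_def image_iff)
    also have "\<dots> = \<epsilon> b * lin_comb (diff F' 0 c) \<epsilon>'"
      by (simp add: lin_comb_def sum_distrib_left e_def ac_simps)
    finally show ?thesis
      using subsetD[OF JL(2) is_idealD(4)[OF J' eps(1)[OF c(1)] coker_image_in_ideal[OF cF' c(2)]]]
      by (simp only:)
  qed
  show "K \<subseteq> ?L"
  proof
    fix k assume k: "k \<in> K"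
    then have kP: "k \<in> polys V" using is_idealD(1)[OF K] by blast
    \<comment> \<open>\<open>k\<close> times a basis element is a boundary because \<open>k\<close>
      lies in \<open>K\<close>; applying \<open>e\<close> to it gives a member of
      \<open>?L\<close>.\<close>
    have kb: "k * (\<epsilon> b * \<epsilon>' b') \<in> ?L" if b: "b \<in> basis F 0" "b' \<in> basis F' 0" for b b'
    proof -
      have t: "(0, b, b') \<in> basis ?T 0" using b by (simp add: tensor_basis_0)
      from coker_mult_basis[OF cT K k t] obtain w where
        w: "w \<in> free_module V (basis ?T 1)" "apply_matrix ?D w = (\<lambda>c. if c = (0, b, b') then k else 0)"
        by blast
      have "k * (\<epsilon> b * \<epsilon>' b') = lin_comb (apply_matrix ?D w) e" unfolding w(2) by (simp add: e_def)
      also have "\<dots> = (\<Sum>y | w y \<noteq> 0. w y * lin_comb (?D y) e)"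
        by (rule lin_comb_apply_matrix)
          (use w(1) cT in \<open>auto simp: free_module_iff coker_ideal_def\<close>)
      also have "\<dots> \<in> ?L"
        by (rule is_ideal_sum[OF L], rule is_idealD(4)[OF L])
          (use w(1) De in \<open>auto simp: free_module_iff\<close>)
      finally show ?thesis .
    qed
    \<comment> \<open>Each augmentation takes a value congruent to 1, modulo \<open>J\<close> and
      \<open>J'\<close> respectively. Substituting both values in k * 1 * 1 leaves a combination of
      the elements treated in \<open>kb\<close>.\<close>
    obtain u where u: "u \<in> free_module V (basis F 0)" "1 - lin_comb u \<epsilon> \<in> J"
      using cF polys_one unfolding coker_ideal_def by blast
    obtain u' where u': "u' \<in> free_module V (basis F' 0)" "1 - lin_comb u' \<epsilon>' \<in> J'"
      using cF' polys_one unfolding coker_ideal_def by blast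
    have up: "lin_comb u \<epsilon> \<in> polys V"
      unfolding lin_comb_def using u(1) eps(1)
      by (intro polys_sum polys_mult) (auto simp: free_module_iff)
    have "lin_comb u (\<lambda>b. lin_comb u' (\<lambda>b'. k * (\<epsilon> b * \<epsilon>' b'))) \<in> ?L"
      using kb by (intro lin_comb_in_ideal[OF L u(1)] lin_comb_in_ideal[OF L u'(1)])
    moreover have "lin_comb u (\<lambda>b. lin_comb u' (\<lambda>b'. k * (\<epsilon> b * \<epsilon>' b'))) =
        k * lin_comb u \<epsilon> * lin_comb u' \<epsilon>'"
      by (simp add: lin_comb_def sum_distrib_left sum_distrib_right ac_simps sum.swap[of _ "{b. u b \<noteq> 0}"])
    ultimately have 3: "k * lin_comb u \<epsilon> * lin_comb u' \<epsilon>' \<in> ?L" by simp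
    have 1: "k * (1 - lin_comb u \<epsilon>) \<in> ?L" using is_idealD(4)[OF J kP u(2)] JL by blast
    have 2: "(k * lin_comb u \<epsilon>) * (1 - lin_comb u' \<epsilon>') \<in> ?L"
      using is_idealD(4)[OF J' polys_mult[OF kP up] u'(2)] JL by blast
    have "k = k * (1 - lin_comb u \<epsilon>) + (k * lin_comb u \<epsilon>) * (1 - lin_comb u' \<epsilon>') +
        k * lin_comb u \<epsilon> * lin_comb u' \<epsilon>'" by (simp add: algebra_simps)
    then show "k \<in> ?L" using is_idealD(3)[OF L is_idealD(3)[OF L 1 2] 3] by metis
  qed
qed

section \<open>Graphs\<close>

definition rees_var :: "nat \<Rightarrow> (nat \<Rightarrow> 'k::field mpoly) \<Rightarrow> var \<Rightarrow> 'k mpoly poly" where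
  "rees_var a f v = (case v of Xvar i \<Rightarrow> [:single (single (Xvar i) 1) 1:]
     | Yvar i \<Rightarrow> Polynomial.monom (f (i - a)) 1)"

definition rees_mon :: "nat \<Rightarrow> (nat \<Rightarrow> 'k::field mpoly) \<Rightarrow> mon \<Rightarrow> 'k mpoly poly" where
  "rees_mon a f \<mu> = (\<Prod>v\<in>keys \<mu>. rees_var a f v ^ lookup \<mu> v)"

lemma rees_mon_superset:
  "finite A \<Longrightarrow> keys \<mu> \<subseteq> A \<Longrightarrow> rees_mon a f \<mu> = (\<Prod>v\<in>A. rees_var a f v ^ lookup \<mu> v)"
  unfolding rees_mon_def by (rule prod.mono_neutral_left) (auto simp: in_keys_iff)

lemma rees_mon_add: "rees_mon a f (\<mu> + \<nu>) = rees_mon a f \<mu> * rees_mon a f \<nu>"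
proof -
  let ?A = "keys \<mu> \<union> keys \<nu>"
  have "rees_mon a f (\<mu> + \<nu>) = (\<Prod>v\<in>?A. rees_var a f v ^ lookup (\<mu> + \<nu>) v)"
    by (rule rees_mon_superset) (auto simp: keys_mon_add)
  also have "\<dots> = (\<Prod>v\<in>?A. rees_var a f v ^ lookup \<mu> v) * (\<Prod>v\<in>?A. rees_var a f v ^ lookup \<nu> v)"
    by (simp add: lookup_add power_add prod.distrib)
  finally show ?thesis using rees_mon_superset[of ?A \<mu> a f] rees_mon_superset[of ?A \<nu> a f] by simp
qed

lemma rees_map_superset:
  assumes "finite A" "keys p \<subseteq> A"
  shows "rees_map a f p = (\<Sum>\<mu>\<in>A. Polynomial.smult (const (lookup p \<mu>)) (rees_mon a f \<mu>))"
  unfolding rees_map_def rees_mon_def rees_var_def using assms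
  by (intro sum.mono_neutral_left) (auto simp: in_keys_iff)

lemma rees_map_add: "rees_map a f (p + q) = rees_map a f p + rees_map a f q"
proof -
  let ?A = "keys p \<union> keys q"
  have "rees_map a f (p + q) = (\<Sum>\<mu>\<in>?A. Polynomial.smult (const (lookup (p + q) \<mu>)) (rees_mon a f \<mu>))"
    using keys_add[of p q] by (intro rees_map_superset) auto
  also have "\<dots> = (\<Sum>\<mu>\<in>?A. Polynomial.smult (const (lookup p \<mu>)) (rees_mon a f \<mu>)) +
      (\<Sum>\<mu>\<in>?A. Polynomial.smult (const (lookup q \<mu>)) (rees_mon a f \<mu>))"
    by (simp add: lookup_add const_add smult_add_left sum.distrib)
  finally show ?thesis using rees_map_superset[of ?A p a f] rees_map_superset[of ?A q a f] by simp
qed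

lemma rees_map_single: "rees_map a f (single \<mu> c) = Polynomial.smult (const c) (rees_mon a f \<mu>)"
  by (subst rees_map_superset[of "{\<mu>}"]) auto

lemma rees_map_zero [simp]: "rees_map a f 0 = 0"
  by (simp add: rees_map_def)

lemma rees_map_mult: "rees_map a f (p * q) = rees_map a f p * rees_map a f q"
proof (induction p rule: mpoly_induct)
  case (add p \<mu> c)
  have "rees_map a f (single \<mu> c * q) = rees_map a f (single \<mu> c) * rees_map a f q"
  proof (induction q rule: mpoly_induct)
    case (add q \<nu> d)
    have "rees_map a f (single \<mu> c * single \<nu> d) = rees_map a f (single \<mu> c) * rees_map a f (single \<nu> d)"
      by (simp add: mult_single rees_map_single rees_mon_add const_mult ac_simps)
    then show ?case using add by (simp add: distrib_left rees_map_add)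
  qed simp
  then show ?case using add by (simp add: distrib_right rees_map_add)
qed simp

lemma rees_map_kscale: "rees_map a f (kscale c p) = Polynomial.smult (const c) (rees_map a f p)"
proof -
  have "rees_map a f (const c) = [:const c:]"
    unfolding const_def[of c] rees_map_single by (simp add: rees_mon_def const_def)
  then show ?thesis by (simp add: kscale_def rees_map_mult)
qed

lemma rees_map_sum: "rees_map a f (\<Sum>i\<in>I. p i) = (\<Sum>i\<in>I. rees_map a f (p i))"
  by (induction I rule: infinite_finite_induct) (auto simp: rees_map_add)

lemma graph_ideal_is_ideal: "is_ideal (xyvars a n) (graph_ideal a n f)"
  unfolding is_ideal_def graph_ideal_def
  by (auto simp: rees_map_add rees_map_mult polys_zero intro: polys_add polys_mult)

lemma rees_map_xypow_neq_0:
  assumes "f (m - a) \<noteq> 0"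
  shows "rees_map a f (xypow m i j) \<noteq> 0"
proof -
  have "rees_mon a f (single (Xvar m) i) = [:single (single (Xvar m) 1) 1:] ^ i"
    by (subst rees_mon_superset[of "{Xvar m}"]) (auto simp: rees_var_def)
  moreover have "rees_mon a f (single (Yvar m) j) = Polynomial.monom (f (m - a)) 1 ^ j"
    by (subst rees_mon_superset[of "{Yvar m}"]) (auto simp: rees_var_def)
  moreover have "single (single (Xvar m) (Suc 0)) (1::'a) \<noteq> 0"
    by (simp flip: Poly_Mapping.keys_eq_empty)
  ultimately show ?thesis using assms
    by (simp add: xypow_def rees_map_single rees_mon_add)
qed

text \<open>The target of the Rees map lies in the domain R[t], where x_m and y_m have the nonzero
  images x_m and f_(m-a) t.\<close>

lemma graph_ideal_saturated:
  assumes "f (m - a) \<noteq> 0"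
  shows "saturated m (xyvars a n) (graph_ideal a n f)"
  using rees_map_xypow_neq_0[of f m a, OF assms] by (auto simp: saturated_def graph_ideal_def rees_map_mult)

locale homogeneous_forms =
  fixes a n d :: nat and f :: "nat \<Rightarrow> 'k::field mpoly"
  assumes forms: "\<And>i. i \<le> n \<Longrightarrow> f i \<in> bigraded_part (xvars a n) d 0"
begin

text \<open>Every y-variable goes to a form of degree \<open>d\<close> times t, so a monomial of
  bidegree (i, j) goes to a form of degree i + d j times t^j.\<close>

lemma rees_mon_bidegree:
  assumes "keys \<mu> \<subseteq> xyvars a n"
  shows "\<exists>q\<in>bigraded_part (xvars a n) (xdeg \<mu> + d * ydeg \<mu>) 0. rees_mon a f \<mu> = Polynomial.monom q (ydeg \<mu>)"
proof -
  let ?x = "\<lambda>v. case v of Xvar i \<Rightarrow> lookup \<mu> v | Yvar i \<Rightarrow> 0"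
  let ?y = "\<lambda>v. case v of Xvar i \<Rightarrow> 0 | Yvar i \<Rightarrow> lookup \<mu> v"
  have pow: "q ^ k \<in> bigraded_part (xvars a n) (e * k) 0" if "q \<in> bigraded_part (xvars a n) e 0" for q :: "'k mpoly" and e k
  proof (induction k)
    case 0
    show ?case using bigraded_part_single[of 0 "xvars a n" 1] by simp
  next
    case (Suc k)
    then show ?case using bigraded_part_mult[OF that Suc] by simp
  qed
  have "\<exists>q\<in>bigraded_part (xvars a n) (sum ?x A + d * sum ?y A) 0.
      (\<Prod>v\<in>A. rees_var a f v ^ lookup \<mu> v) = Polynomial.monom q (sum ?y A)"
    if "finite A" "A \<subseteq> xyvars a n" for A
    using that
  proof (induction A)
    case empty
    show ?case using bigraded_part_single[of 0 "xvars a n" 1]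
      by (intro bexI[of _ 1]) (auto simp: monom_0 one_pCons)
  next
    case (insert v A)
    then obtain q where q: "q \<in> bigraded_part (xvars a n) (sum ?x A + d * sum ?y A) 0"
      "(\<Prod>v\<in>A. rees_var a f v ^ lookup \<mu> v) = Polynomial.monom q (sum ?y A)" by auto
    show ?case
    proof (cases v)
      case (Xvar i)
      let ?q = "single (single (Xvar i) 1) (1::'k)"
      have "single (Xvar i) 1 \<in> mons (xvars a n) 1 0"
        using insert Xvar by (auto simp: mons_def xyvars_def xvars_def)
      then have "?q \<in> bigraded_part (xvars a n) 1 0" by (simp add: bigraded_part_iff)
      from bigraded_part_mult[OF pow[OF this, of "lookup \<mu> v"] q(1)] insert q(2) Xvar show ?thesis
        by (intro bexI[of _ "?q ^ lookup \<mu> v * q"])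
          (auto simp: rees_var_def poly_const_pow smult_monom ac_simps)
    next
      case (Yvar i)
      have "f (i - a) \<in> bigraded_part (xvars a n) d 0"
        using insert Yvar by (intro forms) (auto simp: xyvars_def)
      from bigraded_part_mult[OF pow[OF this, of "lookup \<mu> v"] q(1)] insert q(2) Yvar show ?thesis
        by (intro bexI[of _ "f (i - a) ^ lookup \<mu> v * q"])
          (auto simp: rees_var_def monom_power mult_monom algebra_simps)
    qed
  qed
  from this[OF finite_keys assms] show ?thesis unfolding rees_mon_def xdeg_def ydeg_def .
qed

lemma rees_map_bidegree:
  assumes "p \<in> bigraded_part (xyvars a n) i j"
  shows "Polynomial.coeff (rees_map a f p) k \<in> bigraded_part (xvars a n) (i + d * j) 0"
    and "k \<noteq> j \<Longrightarrow> Polynomial.coeff (rees_map a f p) k = 0"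
proof -
  have m: "Polynomial.coeff (Polynomial.smult (const c) (rees_mon a f \<mu>)) k \<in> bigraded_part (xvars a n) (i + d * j) 0 \<and>
      (k \<noteq> j \<longrightarrow> Polynomial.coeff (Polynomial.smult (const c) (rees_mon a f \<mu>)) k = 0)" if "\<mu> \<in> keys p" for \<mu> c
  proof -
    have \<mu>: "keys \<mu> \<subseteq> xyvars a n" "xdeg \<mu> = i" "ydeg \<mu> = j"
      using that assms by (auto simp: bigraded_part_iff mons_def)
    obtain q where "q \<in> bigraded_part (xvars a n) (i + d * j) 0" "rees_mon a f \<mu> = Polynomial.monom q j"
      using rees_mon_bidegree[OF \<mu>(1)] \<mu> by auto
    then show ?thesis
      using mp.subspace_scale[OF bigraded_part_subspace] mp.subspace_0[OF bigraded_part_subspace]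
      by (auto simp flip: kscale_def)
  qed
  have e: "rees_map a f p = (\<Sum>\<mu>\<in>keys p. Polynomial.smult (const (lookup p \<mu>)) (rees_mon a f \<mu>))"
    by (rule rees_map_superset) auto
  show "Polynomial.coeff (rees_map a f p) k \<in> bigraded_part (xvars a n) (i + d * j) 0"
    unfolding e coeff_sum using m by (intro mp.subspace_sum[OF bigraded_part_subspace]) blast
  show "Polynomial.coeff (rees_map a f p) k = 0" if "k \<noteq> j"
    unfolding e coeff_sum using m that by (intro sum.neutral) blast
qed

text \<open>The pair (i, j) can be recovered from the degree i + d j and the exponent
  \<open>j\<close> of t, so the Rees map separates the homogeneous components. Hence its kernel is
  bigraded.\<close>

lemma bipart_coeff_rees_map:
  assumes "p \<in> polys (xyvars a n)"
  shows "bipart (i + d * j) 0 (Polynomial.coeff (rees_map a f p) j) =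
    Polynomial.coeff (rees_map a f (bipart i j p)) j"
  using assms
proof (induction rule: polys_induct)
  case zero
  show ?case by (simp add: bipart_def)
next
  case (add p \<mu> c)
  let ?c = "Polynomial.coeff (rees_map a f (single \<mu> c)) j"
  have s: "single \<mu> c \<in> bigraded_part (xyvars a n) (xdeg \<mu>) (ydeg \<mu>)"
    using add(2) by (rule bigraded_part_single)
  note b = rees_map_bidegree[OF s, of j]
  have "bipart (i + d * j) 0 ?c = Polynomial.coeff (rees_map a f (bipart i j (single \<mu> c))) j"
  proof (cases "xdeg \<mu> = i \<and> ydeg \<mu> = j")
    case True
    then show ?thesis using bipart_self[OF b(1)] bipart_self[OF s] by simp
  next
    case False
    have "bipart i j (single \<mu> c) = 0"
      using False by (intro poly_mapping_eqI) (auto simp: lookup_bipart lookup_single when_def)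
    moreover have "bipart (i + d * j) 0 ?c = 0"
    proof (cases "ydeg \<mu> = j")
      case True
      \<comment> \<open>With \<open>j\<close> fixed, different x-degrees lead to different degrees
        in R.\<close>
      then have "xdeg \<mu> + d * ydeg \<mu> \<noteq> i + d * j" using False by simp
      then show ?thesis using b(1) unfolding bigraded_part_iff bipart_def
        by (intro restr_eq_0) (auto simp: mons_def)
    qed (use b(2) in \<open>simp add: bipart_def\<close>)
    ultimately show ?thesis by simp
  qed
  then show ?case using add by (simp add: rees_map_add bipart_add)
qed

lemma graph_ideal_bigraded: "is_bigraded (graph_ideal a n f)"
  unfolding is_bigraded_def
proof (intro ballI allI)
  fix p i j assume p: "p \<in> graph_ideal a n f"
  then have pP: "p \<in> polys (xyvars a n)" by (simp add: graph_ideal_def)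
  have m: "bipart i j p \<in> bigraded_part (xyvars a n) i j" by (rule bipart_mem[OF pP])
  have "rees_map a f (bipart i j p) = 0"
  proof (rule poly_eqI)
    fix k
    have "Polynomial.coeff (rees_map a f (bipart i j p)) j = 0"
      using bipart_coeff_rees_map[OF pP, of i j] p by (simp add: graph_ideal_def bipart_def)
    then show "Polynomial.coeff (rees_map a f (bipart i j p)) k = Polynomial.coeff 0 k"
      using rees_map_bidegree(2)[OF m, of k] by (cases "k = j") auto
  qed
  then show "bipart i j p \<in> graph_ideal a n f"
    using m bigraded_part_polys by (auto simp: graph_ideal_def)
qed

text \<open>The total degree determines the exponent of the last variable from the other
  \<open>n\<close> exponents, each at most \<open>N\<close>. What matters below is that the order of
  growth is \<open>n\<close> and not n + 1.\<close>

lemma card_mons_xvars: "card (mons (xvars a n) N 0) \<le> (N + 1) ^ n"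
proof -
  let ?r = "\<lambda>\<mu>. \<lambda>i\<in>{a..<a+n}. lookup \<mu> (Xvar i)"
  have xd: "xdeg \<mu> = (\<Sum>i\<in>{a..a+n}. lookup \<mu> (Xvar i))" if "keys \<mu> \<subseteq> xvars a n" for \<mu>
    using xdeg_superset[of "xvars a n" \<mu>] that
    by (simp add: xvars_def sum.reindex inj_on_def)
  have "inj_on ?r (mons (xvars a n) N 0)"
  proof (rule inj_onI, rule poly_mapping_eqI)
    fix \<mu> \<nu> v assume \<mu>: "\<mu> \<in> mons (xvars a n) N 0" and \<nu>: "\<nu> \<in> mons (xvars a n) N 0" and e: "?r \<mu> = ?r \<nu>"
    have l: "lookup \<mu> (Xvar i) = lookup \<nu> (Xvar i)" if "i \<in> {a..<a+n}" for i
      using fun_cong[OF e, of i] that by simp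
    have "(\<Sum>i\<in>{a..a+n}. lookup \<mu> (Xvar i)) = (\<Sum>i\<in>{a..a+n}. lookup \<nu> (Xvar i))"
      using \<mu> \<nu> xd by (auto simp: mons_def)
    moreover have "{a..a+n} = insert (a + n) {a..<a+n}" by auto
    ultimately have "lookup \<mu> (Xvar (a + n)) = lookup \<nu> (Xvar (a + n))" using l by simp
    then have l: "lookup \<mu> (Xvar i) = lookup \<nu> (Xvar i)" if "i \<in> {a..a+n}" for i
      using l that by (cases "i = a + n") auto
    show "lookup \<mu> v = lookup \<nu> v"
    proof (cases "v \<in> xvars a n")
      case True
      then show ?thesis using l by (auto simp: xvars_def)
    next
      case False
      then have "v \<notin> keys \<mu>" "v \<notin> keys \<nu>" using \<mu> \<nu> by (auto simp: mons_def)
      then show ?thesis by (simp add: in_keys_iff)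
    qed
  qed
  moreover have "?r ` mons (xvars a n) N 0 \<subseteq> (\<Pi>\<^sub>E i\<in>{a..<a+n}. {..N})"
  proof (intro image_subsetI restrict_PiE_iff[THEN iffD2] ballI)
    fix \<mu> i assume "\<mu> \<in> mons (xvars a n) N 0"
    then show "lookup \<mu> (Xvar i) \<in> {..N}" using lookup_le_deg[of \<mu> "Xvar i"] by (simp add: mons_def)
  qed
  ultimately have "card (mons (xvars a n) N 0) \<le> card (\<Pi>\<^sub>E i\<in>{a..<a+n}. {..N})"
    by (intro card_inj_on_le) (auto intro: finite_PiE)
  then show ?thesis by (simp add: card_PiE)
qed

text \<open>The graph is \<open>n\<close>-dimensional because its coordinate ring embeds into \<open>R[t]\<close>, where \<open>R\<close> has
  \<open>n + 1\<close> variables.\<close>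

lemma hilbert_fun_graph_bound: "hilbert_fun (xyvars a n) (graph_ideal a n f) i j \<le> (i + d * j + 1) ^ n"
proof -
  let ?V = "xyvars a n" and ?J = "graph_ideal a n f" and ?W = "bigraded_part (xvars a n) (i + d * j) 0 :: 'k mpoly set"
  have fV: "finite ?V" "finite (xvars a n)" by (auto simp: xyvars_def xvars_def)
  have sub: "ideal_part ?V ?J i j \<subseteq> bigraded_part ?V i j" by (auto simp: ideal_part_def)
  note sp = ideal_part_subspace[OF graph_ideal_is_ideal[of a n f], of ?V i j]
  obtain I where I: "mp.rel_basis (ideal_part ?V ?J i j) (bigraded_part ?V i j) I (\<lambda>b. b)"
    using mp.rel_basis_exists[OF sp sub bigraded_part_subspace bigraded_part_fin_dim[OF fV(1)]] by blast
  \<comment> \<open>On bidegree (i, j) only the coefficient of t^j can be nonzero, so the kernel of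
    this linear map is exactly the homogeneous part of the graph ideal.\<close>
  define t where "t b = Polynomial.coeff (rees_map a f b) j" for b
  have tW: "t ` I \<subseteq> ?W" using rees_map_bidegree(1) mp.rel_basisD(2)[OF I] by (auto simp: t_def)
  have "mp.rel_basis {0} (mp.span (t ` I)) I t"
  proof (rule mp.rel_basisI)
    show "t ` I \<subseteq> mp.span (t ` I)" by (rule mp.span_superset)
    show "\<exists>s\<in>mp.span (t ` I). w - s \<in> {0}" if "w \<in> mp.span (t ` I)" for w using that by auto
    fix c b assume s: "(\<Sum>b\<in>I. kscale (c b) (t b)) \<in> {0}" and b: "b \<in> I"
    let ?p = "\<Sum>b\<in>I. kscale (c b) b"
    have pB: "?p \<in> bigraded_part ?V i j" using mp.rel_basisD(2)[OF I]
      by (intro mp.subspace_sum[OF bigraded_part_subspace] mp.subspace_scale[OF bigraded_part_subspace]) auto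
    have "rees_map a f ?p = 0"
    proof (rule poly_eqI)
      fix k
      have "Polynomial.coeff (rees_map a f ?p) j = (\<Sum>b\<in>I. kscale (c b) (t b))"
        by (simp add: rees_map_sum rees_map_kscale coeff_sum t_def kscale_def[of _ "Polynomial.coeff _ _"])
      then show "Polynomial.coeff (rees_map a f ?p) k = Polynomial.coeff 0 k"
        using s rees_map_bidegree(2)[OF pB, of k] by (cases "k = j") auto
    qed
    then have "?p \<in> ideal_part ?V ?J i j"
      using pB bigraded_part_polys by (auto simp: ideal_part_def graph_ideal_def)
    then show "c b = 0" using mp.rel_basisD(4)[OF I] b by blast
  qed (use mp.rel_basisD(1)[OF I] in auto)
  then have "card I = mp.dim (mp.span (t ` I))" by (simp only: mp.rel_basis_zero_dim)
  also have "\<dots> \<le> mp.dim ?W"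
    using tW by (intro mp.dim_mono mp.subspace_span bigraded_part_subspace bigraded_part_fin_dim fV mp.span_minimal)
  also have "\<dots> \<le> card ((\<lambda>\<mu>. single \<mu> (1::'k)) ` mons (xvars a n) (i + d * j) 0)"
  proof (rule mp.dim_le_card)
    show "?W \<subseteq> mp.span ((\<lambda>\<mu>. single \<mu> (1::'k)) ` mons (xvars a n) (i + d * j) 0)"
      by (rule bigraded_part_span)
  qed (use finite_mons fV in auto)
  also have "\<dots> \<le> card (mons (xvars a n) (i + d * j) 0)" by (rule card_image_le) (rule finite_mons[OF fV(2)])
  also have "\<dots> \<le> (i + d * j + 1) ^ n" by (rule card_mons_xvars)
  finally have "card I \<le> (i + d * j + 1) ^ n" .
  moreover have "hilbert_fun ?V ?J i j = card I"
    using hilbert_fun_add_dim[OF graph_ideal_is_ideal[of a n f] fV(1), of i j]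
      mp.rel_basis_dim[OF I sp sub bigraded_part_fin_dim[OF fV(1)]] by simp
  ultimately show ?thesis by simp
qed

end

section \<open>Numerators of Hilbert series\<close>

text \<open>Let \<open>G\<close> serve for the old variables. If the exponent of the new variable
  exceeds all those in \<open>G\<close>, an element of \<open>G\<close> still works; only finitely
  many values of that exponent remain, and each slice is covered by the induction
  hypothesis.\<close>

lemma dickson:
  fixes A :: "('i \<Rightarrow> nat) set"
  assumes "finite V"
  shows "\<exists>G\<subseteq>A. finite G \<and> (\<forall>u\<in>A. \<exists>g\<in>G. \<forall>v\<in>V. g v \<le> u v)"
  using assms
proof (induction V arbitrary: A)
  case empty
  show ?case
  proof (cases "A = {}")
    case False
    then obtain u where "u \<in> A" by blast
    then show ?thesis by (intro exI[of _ "{u}"]) auto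
  qed auto
next
  case (insert v V)
  obtain G where G: "G \<subseteq> A" "finite G" "\<forall>u\<in>A. \<exists>g\<in>G. \<forall>v\<in>V. g v \<le> u v"
    using insert.IH[of A] by (elim exE conjE)
  \<comment> \<open>A bound for the exponents of \<open>v\<close> in \<open>G\<close>; a sum also
    makes sense for empty \<open>G\<close>.\<close>
  define N where "N = (\<Sum>g\<in>G. g v)"
  have N: "g v \<le> N" if "g \<in> G" for g unfolding N_def using member_le_sum[of g G "\<lambda>g. g v"] that G(2) by simp
  have "\<forall>k. \<exists>H\<subseteq>{u\<in>A. u v = k}. finite H \<and> (\<forall>u\<in>{u\<in>A. u v = k}. \<exists>g\<in>H. \<forall>v\<in>V. g v \<le> u v)"
    by (intro allI insert.IH)
  from choice[OF this] obtain H where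
    H': "\<forall>k. H k \<subseteq> {u\<in>A. u v = k} \<and> finite (H k) \<and>
      (\<forall>u\<in>{u\<in>A. u v = k}. \<exists>g\<in>H k. \<forall>v\<in>V. g v \<le> u v)" ..
  then have H: "H k \<subseteq> {u\<in>A. u v = k}" "finite (H k)"
    "u \<in> A \<Longrightarrow> u v = k \<Longrightarrow> \<exists>g\<in>H k. \<forall>v\<in>V. g v \<le> u v" for k u
    by simp_all
  show ?case
  proof (intro exI[of _ "G \<union> (\<Union>k\<le>N. H k)"] conjI ballI)
    show "G \<union> (\<Union>k\<le>N. H k) \<subseteq> A" using G(1) H(1) by blast
    show "finite (G \<union> (\<Union>k\<le>N. H k))" using G(2) H(2) by blast
    fix u assume u: "u \<in> A"
    show "\<exists>g\<in>G \<union> (\<Union>k\<le>N. H k). \<forall>w\<in>insert v V. g w \<le> u w"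
    proof (cases "u v \<le> N")
      case True
      obtain g where g: "g \<in> H (u v)" "\<forall>w\<in>V. g w \<le> u w" using H(3)[OF u refl] by blast
      then have "g v = u v" using H(1)[of "u v"] by blast
      then show ?thesis using g True by (intro bexI[of _ g]) auto
    next
      case False
      obtain g where "g \<in> G" "\<forall>w\<in>V. g w \<le> u w" using G(3) u by blast
      then show ?thesis using False N[of g] by (intro bexI[of _ g]) auto
    qed
  qed
qed

text \<open>The monomials in the monomial ideal generated by \<open>G\<close>.\<close>

definition mon_upset :: "var set \<Rightarrow> mon set \<Rightarrow> mon set" where
  "mon_upset V G = {\<gamma> + \<kappa> | \<gamma> \<kappa>. \<gamma> \<in> G \<and> keys \<kappa> \<subseteq> V}"

abbreviation all_mons :: "var set \<Rightarrow> mon set" where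
  "all_mons V \<equiv> {\<mu>. keys \<mu> \<subseteq> V}"

lemma mon_le_iff: "(\<exists>\<kappa>. \<mu> = \<gamma> + \<kappa>) \<longleftrightarrow> (\<forall>v. lookup \<gamma> v \<le> lookup \<mu> v)" for \<mu> \<gamma> :: mon
proof
  assume "\<forall>v. lookup \<gamma> v \<le> lookup \<mu> v"
  then have "\<mu> = \<gamma> + (\<mu> - \<gamma>)" by (intro poly_mapping_eqI) (simp add: lookup_add lookup_minus)
  then show "\<exists>\<kappa>. \<mu> = \<gamma> + \<kappa>" by blast
qed (auto simp: lookup_add)

lemma mon_upset_iff:
  assumes "\<mu> \<in> all_mons V"
  shows "\<mu> \<in> mon_upset V G \<longleftrightarrow> (\<exists>\<gamma>\<in>G. \<forall>v. lookup \<gamma> v \<le> lookup \<mu> v)"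
proof
  assume "\<exists>\<gamma>\<in>G. \<forall>v. lookup \<gamma> v \<le> lookup \<mu> v"
  then obtain \<gamma> \<kappa> where k: "\<gamma> \<in> G" "\<mu> = \<gamma> + \<kappa>" using mon_le_iff by blast
  then have "keys \<kappa> \<subseteq> V" using assms by (simp add: keys_mon_add)
  then show "\<mu> \<in> mon_upset V G" using k unfolding mon_upset_def by blast
next
  assume "\<mu> \<in> mon_upset V G"
  then obtain \<gamma> \<kappa> where "\<gamma> \<in> G" "\<mu> = \<gamma> + \<kappa>" unfolding mon_upset_def by blast
  then show "\<exists>\<gamma>\<in>G. \<forall>v. lookup \<gamma> v \<le> lookup \<mu> v" using mon_le_iff by blast
qed

lemma mon_upsetI: "\<gamma> \<in> G \<Longrightarrow> keys \<kappa> \<subseteq> V \<Longrightarrow> \<gamma> + \<kappa> \<in> mon_upset V G"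
  unfolding mon_upset_def by blast

lemma mon_upset_subset: "G \<subseteq> all_mons V \<Longrightarrow> mon_upset V G \<subseteq> all_mons V"
  by (fastforce simp: mon_upset_def keys_mon_add)

lemma mon_upset_finitely_generated:
  assumes V: "finite V" and M: "M \<subseteq> all_mons V"
    and up: "\<And>\<mu> \<kappa>. \<mu> \<in> M \<Longrightarrow> keys \<kappa> \<subseteq> V \<Longrightarrow> \<mu> + \<kappa> \<in> M"
  shows "\<exists>G\<subseteq>M. finite G \<and> M = mon_upset V G"
proof -
  obtain H where H: "H \<subseteq> lookup ` M" "finite H" "\<forall>u\<in>lookup ` M. \<exists>g\<in>H. \<forall>v\<in>V. g v \<le> u v"
    using dickson[OF V, of "lookup ` M"] by (elim exE conjE)
  then obtain G where G: "G \<subseteq> M" "finite G" "H = lookup ` G" using finite_subset_image[OF H(2,1)] by blast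
  have "\<mu> \<in> mon_upset V G" if \<mu>: "\<mu> \<in> M" for \<mu>
  proof -
    obtain \<gamma> where \<gamma>: "\<gamma> \<in> G" "\<forall>v\<in>V. lookup \<gamma> v \<le> lookup \<mu> v" using H(3) G(3) \<mu> by blast
    have "lookup \<gamma> v \<le> lookup \<mu> v" for v
    proof (cases "v \<in> V")
      case False
      then have "v \<notin> keys \<gamma>" using \<gamma>(1) G(1) M by blast
      then show ?thesis by (simp add: in_keys_iff)
    qed (use \<gamma> in auto)
    moreover have "\<mu> \<in> all_mons V" using M \<mu> by blast
    ultimately show ?thesis using \<gamma>(1) mon_upset_iff by blast
  qed
  moreover have "mon_upset V G \<subseteq> M" using up G(1) by (auto simp: mon_upset_def)
  ultimately show ?thesis using G by blast
qed

section \<open>Hilbert series of sets of monomials\<close>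

definition mon_series :: "mon set \<Rightarrow> int fps fps" where
  "mon_series M = Abs_fps (\<lambda>i. Abs_fps (\<lambda>j. int (card {\<mu>\<in>M. xdeg \<mu> = i \<and> ydeg \<mu> = j})))"

definition mon_term :: "mon \<Rightarrow> int fps fps" where
  "mon_term \<mu> = fps_X ^ xdeg \<mu> * fps_const (fps_X ^ ydeg \<mu>)"

lemma mon_series_nth: "fps_nth (fps_nth (mon_series M) i) j = int (card {\<mu>\<in>M. xdeg \<mu> = i \<and> ydeg \<mu> = j})"
  by (simp add: mon_series_def)

lemma finite_mons_subset:
  assumes "finite V" "M \<subseteq> all_mons V"
  shows "finite {\<mu>\<in>M. xdeg \<mu> = i \<and> ydeg \<mu> = j}"
  by (rule finite_subset[OF _ finite_mons[OF assms(1), of i j]]) (use assms in \<open>auto simp: mons_def\<close>)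

lemma mon_series_Un:
  assumes "finite V" "M \<subseteq> all_mons V" "N \<subseteq> all_mons V" "M \<inter> N = {}"
  shows "mon_series (M \<union> N) = mon_series M + mon_series N"
proof (intro fps_ext)
  fix i j
  have "{\<mu>\<in>M \<union> N. xdeg \<mu> = i \<and> ydeg \<mu> = j} =
      {\<mu>\<in>M. xdeg \<mu> = i \<and> ydeg \<mu> = j} \<union> {\<mu>\<in>N. xdeg \<mu> = i \<and> ydeg \<mu> = j}" by blast
  moreover have "card \<dots> = card {\<mu>\<in>M. xdeg \<mu> = i \<and> ydeg \<mu> = j} + card {\<mu>\<in>N. xdeg \<mu> = i \<and> ydeg \<mu> = j}"
    using assms by (intro card_Un_disjoint finite_mons_subset[of V]) auto
  ultimately show "fps_nth (fps_nth (mon_series (M \<union> N)) i) j =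
      fps_nth (fps_nth (mon_series M + mon_series N) i) j" by (simp add: mon_series_nth)
qed

lemma mon_series_shift: "mon_series ((+) \<tau> ` M) = mon_term \<tau> * mon_series M"
proof (intro fps_ext)
  fix i j
  have "{\<mu>\<in>(+) \<tau> ` M. xdeg \<mu> = i \<and> ydeg \<mu> = j} = (if xdeg \<tau> \<le> i \<and> ydeg \<tau> \<le> j
      then (+) \<tau> ` {\<mu>\<in>M. xdeg \<mu> = i - xdeg \<tau> \<and> ydeg \<mu> = j - ydeg \<tau>} else {})"
    by (auto simp: image_iff)
  then have "fps_nth (fps_nth (mon_series ((+) \<tau> ` M)) i) j =
      (if xdeg \<tau> \<le> i \<and> ydeg \<tau> \<le> j then
        int (card {\<mu>\<in>M. xdeg \<mu> = i - xdeg \<tau> \<and> ydeg \<mu> = j - ydeg \<tau>}) else 0)"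
    by (simp add: mon_series_nth card_image)
  also have "\<dots> = fps_nth (fps_nth (mon_term \<tau> * mon_series M) i) j"
    by (simp add: mon_term_def mult.assoc fps_X_power_mult_nth mon_series_nth not_le)
  finally show "fps_nth (fps_nth (mon_series ((+) \<tau> ` M)) i) j =
      fps_nth (fps_nth (mon_term \<tau> * mon_series M) i) j" .
qed

text \<open>A monomial either avoids \<open>v\<close> or is \<open>v\<close> times another monomial,
  which gives a linear equation for the series with \<open>v\<close> included.\<close>

lemma mon_series_all_mons:
  assumes "finite V"
  shows "mon_series (all_mons V) * (\<Prod>v\<in>V. 1 - mon_term (single v 1)) = 1"
  using assms
proof (induction V)
  case empty
  have "{\<mu>. keys \<mu> \<subseteq> {} \<and> xdeg \<mu> = i \<and> ydeg \<mu> = j} = (if i = 0 \<and> j = 0 then {0} else {})" for i j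
    by auto
  then have "mon_series (all_mons {}) = 1"
    by (intro fps_ext) (simp add: mon_series_nth)
  then show ?case by simp
next
  case (insert v V)
  let ?W = "insert v V" and ?t = "single v 1 :: mon"
  have "all_mons ?W = all_mons V \<union> (+) ?t ` all_mons ?W"
  proof (intro equalityI subsetI)
    fix \<mu> assume \<mu>: "\<mu> \<in> all_mons ?W"
    show "\<mu> \<in> all_mons V \<union> (+) ?t ` all_mons ?W"
    proof (cases "v \<in> keys \<mu>")
      case True
      then have "\<forall>w. lookup ?t w \<le> lookup \<mu> w" by (auto simp: lookup_single when_def in_keys_iff)
      then obtain \<kappa> where k: "\<mu> = ?t + \<kappa>" using mon_le_iff by blast
      then have "\<kappa> \<in> all_mons ?W" using \<mu> by (simp add: keys_mon_add)
      then show ?thesis using k by blast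
    qed (use \<mu> in auto)
  qed (auto simp: keys_mon_add)
  moreover have "all_mons V \<inter> (+) ?t ` all_mons ?W = {}" using insert by (auto simp: keys_mon_add)
  moreover have "(+) ?t ` all_mons ?W \<subseteq> all_mons ?W" by (auto simp: keys_mon_add)
  ultimately have "mon_series (all_mons ?W) = mon_series (all_mons V) + mon_term ?t * mon_series (all_mons ?W)"
    using mon_series_Un[of ?W "all_mons V" "(+) ?t ` all_mons ?W"] insert by (auto simp: mon_series_shift)
  then have "mon_series (all_mons ?W) * (1 - mon_term ?t) = mon_series (all_mons V)"
    by (simp add: algebra_simps)
  then show ?case using insert by (simp add: mult.assoc[symmetric])
qed

lemma mon_series_xyvars:
  "mon_series (all_mons (xyvars a n)) * ((1 - fps_X) ^ (n + 1) * fps_const (1 - fps_X) ^ (n + 1)) = 1"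
proof -
  have "(\<Prod>v\<in>xyvars a n. 1 - mon_term (single v 1)) =
      (\<Prod>v\<in>Xvar ` {a..a+n}. 1 - mon_term (single v 1)) * (\<Prod>v\<in>Yvar ` {a..a+n}. 1 - mon_term (single v 1))"
    unfolding xyvars_def by (rule prod.union_disjoint) auto
  also have "(\<Prod>v\<in>Xvar ` {a..a+n}. 1 - mon_term (single v 1)) = (1 - fps_X) ^ (n + 1)"
    by (subst prod.reindex) (auto simp: inj_on_def mon_term_def)
  also have "(\<Prod>v\<in>Yvar ` {a..a+n}. 1 - mon_term (single v 1)) = fps_const (1 - fps_X) ^ (n + 1)"
    by (subst prod.reindex) (auto simp: inj_on_def mon_term_def simp flip: fps_const_sub)
  finally show ?thesis using mon_series_all_mons[of "xyvars a n"] by (simp add: xyvars_def)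
qed

lemma fps_of_poly2_nth: "fps_nth (fps_of_poly2 p) i = fps_of_poly (Polynomial.coeff p i)"
  by (simp add: fps_of_poly2_def coeff_map_poly)

lemma fps_of_poly2_add: "fps_of_poly2 (p + q) = fps_of_poly2 p + fps_of_poly2 q"
  by (rule fps_ext) (simp add: fps_of_poly2_nth fps_of_poly_add)

lemma fps_of_poly2_diff: "fps_of_poly2 (p - q) = fps_of_poly2 p - fps_of_poly2 q"
  by (rule fps_ext) (simp add: fps_of_poly2_nth fps_of_poly_diff)

lemma fps_of_poly2_mult: "fps_of_poly2 (p * q) = fps_of_poly2 p * fps_of_poly2 q"
  by (rule fps_ext)
    (simp add: fps_of_poly2_nth fps_mult_nth coeff_mult fps_of_poly_sum fps_of_poly_mult atLeast0AtMost)

lemma fps_of_poly2_one: "fps_of_poly2 1 = 1"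
  by (rule fps_ext) (simp add: fps_of_poly2_nth)

lemma fps_of_poly2_inject: "fps_of_poly2 p = fps_of_poly2 q \<Longrightarrow> p = q"
  by (rule poly_eqI) (metis fps_of_poly2_nth fps_of_poly_eq_iff)

lemma mon_term_poly:
  "mon_term \<mu> = fps_of_poly2 (Polynomial.monom (Polynomial.monom 1 (ydeg \<mu>)) (xdeg \<mu>))"
  by (rule fps_ext) (simp add: mon_term_def fps_of_poly2_nth fps_of_poly_monom)

text \<open>Adjoining a generator \<open>\<tau>\<close> adds those multiples of
  \<open>\<tau>\<close> that are not yet in the ideal, namely \<open>\<tau>\<close> times the
  complement of the colon ideal by \<open>\<tau>\<close>. The colon ideal has fewer generators as
  well, so the recursion is on their number.\<close>

lemma mon_series_upset:
  assumes V: "finite V" and "finite G" "G \<subseteq> all_mons V"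
  shows "\<exists>p. mon_series (mon_upset V G) = fps_of_poly2 p * mon_series (all_mons V)"
  using assms(2,3)
proof (induction "card G" arbitrary: G rule: less_induct)
  case less
  show ?case
  proof (cases "G = {}")
    case True
    then have "mon_series (mon_upset V G) = 0"
      by (intro fps_ext) (simp add: mon_upset_def mon_series_nth)
    then show ?thesis by (intro exI[of _ 0]) (simp add: fps_of_poly2_def)
  next
    case False
    then obtain \<tau> G' where G: "G = insert \<tau> G'" "\<tau> \<notin> G'" by (meson Set.set_insert ex_in_conv)
    then have fG': "finite G'" "G' \<subseteq> all_mons V" "\<tau> \<in> all_mons V" "card G' < card G"
      using less.prems by auto
    \<comment> \<open>Generators of the colon ideal: truncated subtraction divides
      \<open>\<gamma>\<close> by its greatest common divisor with \<open>\<tau>\<close>.\<close>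
    let ?H = "(\<lambda>\<gamma>. \<gamma> - \<tau>) ` G'" and ?A = "all_mons V"
    have H: "finite ?H" "?H \<subseteq> ?A" "card ?H < card G"
    proof -
      have "keys (\<gamma> - \<tau>) \<subseteq> keys \<gamma>" for \<gamma> by (auto simp: in_keys_iff lookup_minus)
      then show "?H \<subseteq> ?A" using fG'(2) by blast
      show "card ?H < card G" using card_image_le[OF fG'(1), of "\<lambda>\<gamma>. \<gamma> - \<tau>"] fG'(4) by linarith
    qed (use fG' in auto)
    obtain p q where p: "mon_series (mon_upset V G') = fps_of_poly2 p * mon_series ?A"
      and q: "mon_series (mon_upset V ?H) = fps_of_poly2 q * mon_series ?A"
      using less.hyps[OF fG'(4,1,2)] less.hyps[OF H(3,1,2)] by blast
    have subs: "mon_upset V G' \<subseteq> ?A" "mon_upset V ?H \<subseteq> ?A"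
      using fG'(2) H(2) by (auto intro!: mon_upset_subset)
    have colon: "\<tau> + \<mu> \<in> mon_upset V G' \<longleftrightarrow> \<mu> \<in> mon_upset V ?H" if "\<mu> \<in> ?A" for \<mu>
    proof -
      have "\<tau> + \<mu> \<in> ?A" using that fG'(3) by (simp add: keys_mon_add)
      then show ?thesis
        using mon_upset_iff[OF that, of ?H] mon_upset_iff[of "\<tau> + \<mu>" V G']
        by (simp add: lookup_add lookup_minus le_diff_conv add.commute)
    qed
    \<comment> \<open>Shifted by \<open>\<tau>\<close>, these are the multiples of
      \<open>\<tau>\<close> outside the ideal of \<open>G'\<close>.\<close>
    let ?D = "?A - mon_upset V ?H"
    have "?D \<union> mon_upset V ?H = ?A" "?D \<inter> mon_upset V ?H = {}" "?D \<subseteq> ?A" using subs(2) by blast+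
    then have "mon_series ?A = mon_series ?D + mon_series (mon_upset V ?H)"
      using mon_series_Un[OF V, of ?D "mon_upset V ?H"] subs(2) by simp
    then have D: "mon_series ?D = (1 - fps_of_poly2 q) * mon_series ?A" using q by (simp add: algebra_simps)
    have "mon_upset V G = mon_upset V G' \<union> (+) \<tau> ` ?D"
    proof (intro equalityI subsetI)
      fix \<mu> assume "\<mu> \<in> mon_upset V G"
      then obtain \<gamma> \<kappa> where "\<mu> = \<gamma> + \<kappa>" "keys \<kappa> \<subseteq> V" "\<gamma> = \<tau> \<or> \<gamma> \<in> G'"
        by (auto simp: mon_upset_def G)
      then show "\<mu> \<in> mon_upset V G' \<union> (+) \<tau> ` ?D"
        using colon[of \<kappa>] mon_upsetI[of \<gamma> G' \<kappa> V] by auto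
    next
      fix \<mu> assume "\<mu> \<in> mon_upset V G' \<union> (+) \<tau> ` ?D"
      then consider \<gamma> \<kappa> where "\<mu> = \<gamma> + \<kappa>" "\<gamma> \<in> G'" "keys \<kappa> \<subseteq> V"
        | \<kappa> where "\<mu> = \<tau> + \<kappa>" "keys \<kappa> \<subseteq> V" unfolding mon_upset_def[of V G'] by blast
      then show "\<mu> \<in> mon_upset V G" by cases (auto simp: G intro: mon_upsetI)
    qed
    moreover have "mon_upset V G' \<inter> (+) \<tau> ` ?D = {}" using colon by auto
    moreover have "(+) \<tau> ` ?D \<subseteq> ?A" using fG'(3) by (auto simp: keys_mon_add)
    ultimately have s: "mon_series (mon_upset V G) = mon_series (mon_upset V G') + mon_term \<tau> * mon_series ?D"
      using mon_series_Un[OF V subs(1)] by (simp add: mon_series_shift)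
    obtain t where "mon_term \<tau> = fps_of_poly2 t" using mon_term_poly by metis
    then have "mon_series (mon_upset V G) = fps_of_poly2 (p + t * (1 - q)) * mon_series ?A"
      unfolding s p D by (simp add: fps_of_poly2_add fps_of_poly2_mult fps_of_poly2_diff fps_of_poly2_one algebra_simps)
    then show ?thesis by blast
  qed
qed

section \<open>Leading monomials and rationality of Hilbert series\<close>

definition lead_mon :: "'k::field mpoly \<Rightarrow> mon" where
  "lead_mon p = Max (keys p)"

lemma lead_mon_in_keys: "p \<noteq> 0 \<Longrightarrow> lead_mon p \<in> keys p"
  unfolding lead_mon_def by (rule Max_in) auto

lemma lead_mon_ge: "\<mu> \<in> keys p \<Longrightarrow> \<mu> \<le> lead_mon p"
  unfolding lead_mon_def by simp

text \<open>The order on monomials is compatible with addition, so translation by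
  \<open>\<kappa>\<close> commutes with taking the maximum.\<close>

lemma lead_mon_single_times:
  assumes "p \<noteq> 0"
  shows "lead_mon (single \<kappa> 1 * p) = \<kappa> + lead_mon p"
  unfolding lead_mon_def keys_single_times[OF one_neq_zero]
  by (rule mono_Max_commute[symmetric]) (use assms in \<open>auto simp: mono_def add_left_mono\<close>)

definition lead_mons :: "'k::field mpoly set \<Rightarrow> mon set" where
  "lead_mons W = lead_mon ` (W - {0})"

text \<open>Gaussian elimination: one element of \<open>W\<close> per leading monomial gives a
  basis. Subtracting a multiple of the right one lowers the leading monomial, and in a relation the
  largest index with nonzero coefficient cannot cancel.\<close>

lemma dim_eq_card_lead_mons:
  fixes W :: "'k::field mpoly set"
  assumes W: "mp.subspace W" and fin: "finite M" and keys: "\<And>p. p \<in> W \<Longrightarrow> keys p \<subseteq> M"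
  shows "mp.dim W = card (lead_mons W)"
proof -
  have "\<forall>\<mu>\<in>lead_mons W. \<exists>p. p \<in> W \<and> p \<noteq> 0 \<and> lead_mon p = \<mu>" by (auto simp: lead_mons_def)
  then obtain P where P: "\<And>\<mu>. \<mu> \<in> lead_mons W \<Longrightarrow> P \<mu> \<in> W \<and> P \<mu> \<noteq> 0 \<and> lead_mon (P \<mu>) = \<mu>"
    unfolding bchoice_iff by blast
  have "lead_mons W \<subseteq> M" using lead_mon_in_keys keys by (fastforce simp: lead_mons_def)
  then have fL: "finite (lead_mons W)" using fin finite_subset by blast
  have "mp.rel_basis {0} W (lead_mons W) P"
  proof (rule mp.rel_basisI[OF fL])
    show "P ` lead_mons W \<subseteq> W" using P by blast
  next
    fix w assume "w \<in> W"
    then have "w \<in> mp.span (P ` lead_mons W)"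
    \<comment> \<open>Counting the monomials of \<open>M\<close> up to the leading one gives a
      natural-number measure; the conjunct \<open>w \<noteq> 0\<close> makes it vanish at zero,
      where \<open>lead_mon\<close> is unspecified.\<close>
    proof (induction "card {\<mu>\<in>M. w \<noteq> 0 \<and> \<mu> \<le> lead_mon w}" arbitrary: w rule: less_induct)
      case less
      show ?case
      proof (cases "w = 0")
        case True
        then show ?thesis by (simp add: mp.span_zero)
      next
        case False
        let ?\<mu> = "lead_mon w"
        have \<mu>: "?\<mu> \<in> lead_mons W" using less.prems False by (auto simp: lead_mons_def)
        note P\<mu> = P[OF \<mu>]
        define c where "c = lookup w ?\<mu> / lookup (P ?\<mu>) ?\<mu>"
        define w' where "w' = w - kscale c (P ?\<mu>)"
        have "lookup (P ?\<mu>) ?\<mu> \<noteq> 0" using lead_mon_in_keys[of "P ?\<mu>"] P\<mu> by (simp add: in_keys_iff)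
        then have z: "lookup w' ?\<mu> = 0" by (simp add: w'_def c_def lookup_minus)
        have w': "w' \<in> W" unfolding w'_def
          using less.prems P\<mu> by (intro mp.subspace_diff[OF W] mp.subspace_scale[OF W]) auto
        have lt: "lead_mon w' < ?\<mu>" if "w' \<noteq> 0"
        proof -
          have k: "lead_mon w' \<in> keys w'" by (rule lead_mon_in_keys[OF that])
          have "keys w' \<subseteq> keys w \<union> keys (P ?\<mu>)"
            by (auto simp: w'_def in_keys_iff lookup_minus)
          then have "lead_mon w' \<le> ?\<mu>" using k lead_mon_ge P\<mu> by fastforce
          moreover have "lead_mon w' \<noteq> ?\<mu>" using k z by (auto simp: in_keys_iff)
          ultimately show ?thesis by simp
        qed
        have "{\<mu>\<in>M. w' \<noteq> 0 \<and> \<mu> \<le> lead_mon w'} \<subset> {\<mu>\<in>M. w \<noteq> 0 \<and> \<mu> \<le> lead_mon w}"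
        proof -
          have "?\<mu> \<in> M" using lead_mon_in_keys[OF False] keys less.prems by blast
          then have "?\<mu> \<in> {\<mu>\<in>M. w \<noteq> 0 \<and> \<mu> \<le> lead_mon w}" using False by simp
          moreover have "?\<mu> \<notin> {\<mu>\<in>M. w' \<noteq> 0 \<and> \<mu> \<le> lead_mon w'}" using lt by (auto simp: not_le)
          moreover have "{\<mu>\<in>M. w' \<noteq> 0 \<and> \<mu> \<le> lead_mon w'} \<subseteq> {\<mu>\<in>M. w \<noteq> 0 \<and> \<mu> \<le> lead_mon w}"
            using lt False by auto
          ultimately show ?thesis by blast
        qed
        then have "card {\<mu>\<in>M. w' \<noteq> 0 \<and> \<mu> \<le> lead_mon w'} < card {\<mu>\<in>M. w \<noteq> 0 \<and> \<mu> \<le> lead_mon w}"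
          using fin by (intro psubset_card_mono) auto
        then have "w' \<in> mp.span (P ` lead_mons W)" using less.hyps w' by blast
        moreover have "kscale c (P ?\<mu>) \<in> mp.span (P ` lead_mons W)"
          using \<mu> by (intro mp.span_scale mp.span_base) auto
        ultimately have "w' + kscale c (P ?\<mu>) \<in> mp.span (P ` lead_mons W)" by (rule mp.span_add)
        then show ?thesis by (simp add: w'_def)
      qed
    qed
    then show "\<exists>s\<in>mp.span (P ` lead_mons W). w - s \<in> {0}" by auto
  next
    fix c \<mu> assume s: "(\<Sum>\<mu>\<in>lead_mons W. kscale (c \<mu>) (P \<mu>)) \<in> {0}" and \<mu>: "\<mu> \<in> lead_mons W"
    show "c \<mu> = 0"
    proof (rule ccontr)
      assume "c \<mu> \<noteq> 0"
      let ?N = "{\<nu>\<in>lead_mons W. c \<nu> \<noteq> 0}"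
      \<comment> \<open>Among the elements that occur, only the one with the largest leading
        monomial contains that monomial.\<close>
      define \<nu> where "\<nu> = Max ?N"
      have ne: "?N \<noteq> {}" "finite ?N" using \<mu> \<open>c \<mu> \<noteq> 0\<close> fL by auto
      then have \<nu>: "\<nu> \<in> lead_mons W" "c \<nu> \<noteq> 0" using Max_in[OF ne(2,1)] by (auto simp: \<nu>_def)
      have "c \<kappa> * lookup (P \<kappa>) \<nu> = 0" if "\<kappa> \<in> lead_mons W - {\<nu>}" for \<kappa>
      proof (cases "c \<kappa> = 0")
        case False
        then have "\<kappa> \<le> \<nu>" unfolding \<nu>_def using that ne by (intro Max_ge) auto
        then have "\<kappa> < \<nu>" using that by auto
        then have "\<nu> \<notin> keys (P \<kappa>)" using lead_mon_ge[of \<nu> "P \<kappa>"] P[of \<kappa>] that by auto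
        then show ?thesis by (simp add: in_keys_iff)
      qed simp
      then have "(\<Sum>\<kappa>\<in>lead_mons W. c \<kappa> * lookup (P \<kappa>) \<nu>) = c \<nu> * lookup (P \<nu>) \<nu>"
        by (subst sum.remove[OF fL \<nu>(1)]) (simp add: sum.neutral)
      moreover have "(\<Sum>\<kappa>\<in>lead_mons W. c \<kappa> * lookup (P \<kappa>) \<nu>) = 0"
        using arg_cong[OF singletonD[OF s], of "\<lambda>p. lookup p \<nu>"] by (simp add: lookup_sum)
      moreover have "lookup (P \<nu>) \<nu> \<noteq> 0" using lead_mon_in_keys[of "P \<nu>"] P[OF \<nu>(1)] by (simp add: in_keys_iff)
      ultimately show False using \<nu>(2) by simp
    qed
  qed
  then show ?thesis by (rule mp.rel_basis_zero_dim)
qed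

text \<open>Macaulay's argument: \<open>J\<close> and its initial ideal have the same Hilbert
  function. The monomials \<open>L\<close> of the initial ideal are closed under multiplication,
  hence finitely generated by \<open>dickson\<close>, and \<open>mon_series_upset\<close>
  applies.\<close>

theorem hilbert_series_rational:
  assumes V: "finite V" and J: "is_ideal V J"
  shows "\<exists>p. hilbert_series V J = fps_of_poly2 p * mon_series (all_mons V)"
proof -
  define L where "L = (\<Union>i j. lead_mons (ideal_part V J i j))"
  have part: "keys p \<subseteq> mons V i j" if "p \<in> ideal_part V J i j" for p i j
    using that by (simp add: ideal_part_def bigraded_part_iff)
  have lm: "lead_mons (ideal_part V J i j) \<subseteq> mons V i j" for i j
    using lead_mon_in_keys part by (fastforce simp: lead_mons_def)
  then have LV: "L \<subseteq> all_mons V" by (auto simp: L_def mons_def)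
  have up: "\<mu> + \<kappa> \<in> L" if \<mu>: "\<mu> \<in> L" and \<kappa>: "keys \<kappa> \<subseteq> V" for \<mu> \<kappa>
  proof -
    obtain i j p where p: "p \<in> ideal_part V J i j" "p \<noteq> 0" "\<mu> = lead_mon p"
      using \<mu> by (auto simp: L_def lead_mons_def)
    have "single \<kappa> 1 * p \<in> J" using p \<kappa> by (intro is_idealD(4)[OF J] polys_single) (auto simp: ideal_part_def)
    moreover have "single \<kappa> 1 * p \<in> bigraded_part V (xdeg \<kappa> + i) (ydeg \<kappa> + j)"
      using p \<kappa> by (intro bigraded_part_mult bigraded_part_single) (auto simp: ideal_part_def)
    moreover have "single \<kappa> 1 * p \<noteq> 0"
      using p(2) by (simp add: keys_single_times flip: Poly_Mapping.keys_eq_empty)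
    moreover have "\<mu> + \<kappa> = lead_mon (single \<kappa> 1 * p)"
      using lead_mon_single_times[OF p(2)] p(3) by (simp add: add.commute)
    ultimately have "\<mu> + \<kappa> \<in> lead_mons (ideal_part V J (xdeg \<kappa> + i) (ydeg \<kappa> + j))"
      by (simp add: lead_mons_def ideal_part_def)
    then show ?thesis unfolding L_def by blast
  qed
  obtain G where G: "finite G" "G \<subseteq> L" "L = mon_upset V G"
    using mon_upset_finitely_generated[OF V LV up] by blast
  then obtain p where p: "mon_series L = fps_of_poly2 p * mon_series (all_mons V)"
    using mon_series_upset[OF V, of G] LV by blast
  have "hilbert_series V J = mon_series (all_mons V) - mon_series L"
  proof (intro fps_ext)
    fix i j
    \<comment> \<open>A leading monomial has the bidegree of the part it comes from, so no other
      part contributes to this slice of \<open>L\<close>.\<close>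
    have "{\<mu>\<in>L. xdeg \<mu> = i \<and> ydeg \<mu> = j} = lead_mons (ideal_part V J i j)"
      using lm by (fastforce simp: L_def mons_def)
    then have "mp.dim (ideal_part V J i j) = card {\<mu>\<in>L. xdeg \<mu> = i \<and> ydeg \<mu> = j}"
      using dim_eq_card_lead_mons[OF ideal_part_subspace[OF J] finite_mons[OF V] part] by simp
    moreover have "mp.dim (bigraded_part V i j :: 'a mpoly set) = card (mons V i j)"
    proof -
      have "mons V i j \<subseteq> lead_mons (bigraded_part V i j :: 'a mpoly set)"
      proof
        fix \<mu> assume "\<mu> \<in> mons V i j"
        then show "\<mu> \<in> lead_mons (bigraded_part V i j :: 'a mpoly set)"
          unfolding lead_mons_def
          by (intro image_eqI[of _ _ "single \<mu> 1"])
            (auto simp: lead_mon_def bigraded_part_iff simp flip: Poly_Mapping.keys_eq_empty)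
      qed
      moreover have "lead_mons (bigraded_part V i j :: 'a mpoly set) \<subseteq> mons V i j"
        using lead_mon_in_keys by (fastforce simp: lead_mons_def bigraded_part_iff)
      ultimately show ?thesis
        using dim_eq_card_lead_mons[of "bigraded_part V i j" "mons V i j"] finite_mons[OF V, of i j]
          bigraded_part_subspace[of V i j] by (simp add: bigraded_part_iff)
    qed
    moreover have "{\<mu>. keys \<mu> \<subseteq> V \<and> xdeg \<mu> = i \<and> ydeg \<mu> = j} = mons V i j" by (simp add: mons_def)
    ultimately show "fps_nth (fps_nth (hilbert_series V J) i) j =
        fps_nth (fps_nth (mon_series (all_mons V) - mon_series L) i) j"
      using hilbert_fun_add_dim[OF J V, of i j] by (simp add: mon_series_nth)
  qed
  then have "hilbert_series V J = fps_of_poly2 (1 - p) * mon_series (all_mons V)"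
    using p by (simp add: fps_of_poly2_diff fps_of_poly2_one algebra_simps)
  then show ?thesis by blast
qed

lemma hilbert_num_eqI:
  assumes "fps_of_poly2 p = hilbert_series (xyvars a n) J * (1 - fps_X) ^ (n+1) * (fps_const (1 - fps_X)) ^ (n+1)"
  shows "hilbert_num a n J = p"
  unfolding hilbert_num_def
proof (rule the_equality)
  show "q = p" if "fps_of_poly2 q = hilbert_series (xyvars a n) J * (1 - fps_X) ^ (n+1) * (fps_const (1 - fps_X)) ^ (n+1)" for q
    using that assms by (intro fps_of_poly2_inject) simp
qed (rule assms)

text \<open>Justifies the definite description: existence is \<open>hilbert_series_rational\<close>,
  with the denominator supplied by \<open>mon_series_xyvars\<close>, and uniqueness is the
  injectivity of \<open>fps_of_poly2\<close>.\<close>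

lemma hilbert_num:
  assumes "is_ideal (xyvars a n) J"
  shows "fps_of_poly2 (hilbert_num a n J) =
    hilbert_series (xyvars a n) J * (1 - fps_X) ^ (n+1) * (fps_const (1 - fps_X)) ^ (n+1)"
proof -
  have "finite (xyvars a n)" by (simp add: xyvars_def)
  then obtain p where p: "hilbert_series (xyvars a n) J = fps_of_poly2 p * mon_series (all_mons (xyvars a n))"
    using hilbert_series_rational assms by blast
  have e: "fps_of_poly2 p = hilbert_series (xyvars a n) J * (1 - fps_X) ^ (n+1) * (fps_const (1 - fps_X)) ^ (n+1)"
    unfolding p mult.assoc mon_series_xyvars by simp
  then show ?thesis using hilbert_num_eqI by metis
qed

section \<open>Growth and vanishing of coefficients\<close>

definition eval1 :: "int poly \<Rightarrow> real \<Rightarrow> real" where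
  "eval1 q y = poly (map_poly of_int q) y"

definition eval2 :: "int poly poly \<Rightarrow> real \<Rightarrow> real \<Rightarrow> real" where
  "eval2 p x y = poly (map_poly (\<lambda>q. eval1 q y) p) x"

lemma eval1_zero [simp]: "eval1 0 y = 0"
  by (simp add: eval1_def)

lemma eval1_pCons: "eval1 (pCons a q) y = of_int a + y * eval1 q y"
  by (simp add: eval1_def map_poly_pCons)

lemma eval1_add: "eval1 (p + q) y = eval1 p y + eval1 q y"
proof -
  have "map_poly real_of_int (p + q) = map_poly of_int p + map_poly of_int q"
    by (rule poly_eqI) (simp add: coeff_map_poly)
  then show ?thesis by (simp add: eval1_def)
qed

lemma eval1_diff: "eval1 (p - q) y = eval1 p y - eval1 q y"
  using eval1_add[of "p - q" q y] by simp

lemma eval1_pcompose: "eval1 (pcompose q [:1, -1:]) y = eval1 q (1 - y)"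
proof (induction q)
  case (pCons a q)
  let ?p = "pcompose q [:1, -1:]"
  have "pcompose (pCons a q) [:1, -1:] = [:a:] + (?p - pCons 0 ?p)"
    by (simp add: pcompose_pCons)
  then have "eval1 (pcompose (pCons a q) [:1, -1:]) y = of_int a + (eval1 ?p y - y * eval1 ?p y)"
    by (simp add: eval1_add eval1_diff eval1_pCons)
  then show ?case using pCons by (simp add: eval1_pCons algebra_simps)
qed simp

lemma eval2_zero [simp]: "eval2 0 x y = 0"
  by (simp add: eval2_def)

lemma eval2_pCons: "eval2 (pCons a q) x y = eval1 a y + x * eval2 q x y"
  by (simp add: eval2_def map_poly_pCons)

lemma eval2_add: "eval2 (p + q) x y = eval2 p x y + eval2 q x y"
proof -
  have "map_poly (\<lambda>q. eval1 q y) (p + q) = map_poly (\<lambda>q. eval1 q y) p + map_poly (\<lambda>q. eval1 q y) q"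
    by (rule poly_eqI) (simp add: coeff_map_poly eval1_add)
  then show ?thesis by (simp add: eval2_def)
qed

lemma eval2_diff: "eval2 (p - q) x y = eval2 p x y - eval2 q x y"
  using eval2_add[of "p - q" q x y] by simp

lemma eval2_subst_one_minus: "eval2 (subst_one_minus p) x y = eval2 p (1 - x) (1 - y)"
proof (induction p)
  case (pCons a q)
  let ?p = "subst_one_minus q"
  have "subst_one_minus (pCons a q) = [:pcompose a [:1, -1:]:] + (?p - pCons 0 ?p)"
    by (simp add: subst_one_minus_def pcompose_pCons map_poly_pCons)
  then have "eval2 (subst_one_minus (pCons a q)) x y =
      eval1 a (1 - y) + (eval2 ?p x y - x * eval2 ?p x y)"
    by (simp add: eval2_add eval2_diff eval2_pCons eval1_pcompose)
  then show ?case using pCons by (simp add: eval2_pCons algebra_simps)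
qed (simp add: subst_one_minus_def)

definition coeff2 :: "int poly poly \<Rightarrow> nat \<Rightarrow> nat \<Rightarrow> int" where
  "coeff2 p i j = Polynomial.coeff (Polynomial.coeff p i) j"

lemma coeff2_bound: "\<exists>D. \<forall>i j. i > D \<or> j > D \<longrightarrow> coeff2 p i j = 0"
proof -
  \<comment> \<open>The sum of the inner degrees bounds each of them; one \<open>D\<close> then
    serves both variables.\<close>
  define D where "D = Polynomial.degree p + (\<Sum>i\<le>Polynomial.degree p. Polynomial.degree (Polynomial.coeff p i))"
  have "coeff2 p i j = 0" if "i > D \<or> j > D" for i j
  proof (cases "i > Polynomial.degree p")
    case True
    then show ?thesis by (simp add: coeff2_def coeff_eq_0)
  next
    case False
    then have "Polynomial.degree (Polynomial.coeff p i) \<le> (\<Sum>i\<le>Polynomial.degree p. Polynomial.degree (Polynomial.coeff p i))"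
      by (intro member_le_sum) auto
    then have "j > Polynomial.degree (Polynomial.coeff p i)" using that False by (auto simp: D_def)
    then show ?thesis by (simp add: coeff2_def coeff_eq_0)
  qed
  then show ?thesis by blast
qed

lemma poly_eq_sum_bound:
  fixes q :: "'a::comm_semiring_1 poly"
  assumes "\<And>i. i > D \<Longrightarrow> Polynomial.coeff q i = 0"
  shows "poly q x = (\<Sum>i\<le>D. Polynomial.coeff q i * x ^ i)"
proof -
  have "Polynomial.degree q \<le> D" using assms by (rule degree_le[OF allI, OF impI])
  then have "(\<Sum>i\<le>Polynomial.degree q. Polynomial.coeff q i * x ^ i) = (\<Sum>i\<le>D. Polynomial.coeff q i * x ^ i)"
    by (intro sum.mono_neutral_left) (auto simp: coeff_eq_0)
  then show ?thesis by (simp add: poly_altdef)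
qed

lemma eval1_eq_sum:
  assumes "\<And>j. j > D \<Longrightarrow> Polynomial.coeff q j = 0"
  shows "eval1 q y = (\<Sum>j\<le>D. of_int (Polynomial.coeff q j) * y ^ j)"
  unfolding eval1_def using assms by (subst poly_eq_sum_bound[of D]) (auto simp: coeff_map_poly)

lemma eval2_eq_sum:
  assumes "\<forall>i j. i > D \<or> j > D \<longrightarrow> coeff2 p i j = 0"
  shows "eval2 p x y = (\<Sum>i\<le>D. (\<Sum>j\<le>D. of_int (coeff2 p i j) * y ^ j) * x ^ i)"
proof -
  have e: "eval1 (Polynomial.coeff p i) y = (\<Sum>j\<le>D. of_int (coeff2 p i j) * y ^ j)" for i
    unfolding coeff2_def by (rule eval1_eq_sum) (use assms in \<open>simp add: coeff2_def\<close>)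
  show ?thesis unfolding eval2_def
    by (subst poly_eq_sum_bound[of D]) (use assms in \<open>auto simp: coeff_map_poly e\<close>)
qed

text \<open>Iterated sums in the order in which the series are nested, with inner sums
  \<open>r u\<close>. Multiplication by 1 - T_0 or 1 - T_1 then acts on one of the sums at a time,
  without rearranging a double series.\<close>

definition dsums :: "(nat \<Rightarrow> nat \<Rightarrow> real) \<Rightarrow> real \<Rightarrow> real \<Rightarrow> real \<Rightarrow> bool" where
  "dsums f z w s \<longleftrightarrow> (\<exists>r. (\<forall>u. (\<lambda>v. f u v * w ^ v) sums r u) \<and> (\<lambda>u. r u * z ^ u) sums s)"

lemma dsumsI:
  "(\<And>u. (\<lambda>v. f u v * w ^ v) sums r u) \<Longrightarrow> (\<lambda>u. r u * z ^ u) sums s \<Longrightarrow> dsums f z w s"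
  unfolding dsums_def by (intro exI[of _ r]) auto

lemma dsums_unique:
  assumes "dsums f z w s" "dsums f z w t"
  shows "s = t"
proof -
  obtain r r' where "\<And>u. (\<lambda>v. f u v * w ^ v) sums r u" "(\<lambda>u. r u * z ^ u) sums s"
    "\<And>u. (\<lambda>v. f u v * w ^ v) sums r' u" "(\<lambda>u. r' u * z ^ u) sums t"
    using assms unfolding dsums_def by blast
  moreover from this have "r = r'" using sums_unique2 by blast
  ultimately show ?thesis using sums_unique2 by blast
qed

lemma sums_shift_mult:
  fixes a :: "nat \<Rightarrow> real"
  assumes "(\<lambda>u. a u * z ^ u) sums s"
  shows "(\<lambda>u. (a u - (if u = 0 then 0 else a (u - 1))) * z ^ u) sums ((1 - z) * s)"
proof -
  have "(\<lambda>u. a u * z ^ Suc u) sums (z * s)" using sums_mult[OF assms, of z] by (simp add: ac_simps)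
  then have "(\<lambda>u. (if u = 0 then 0 else a (u - 1)) * z ^ u) sums (z * s)"
    using sums_Suc[of "\<lambda>u. (if u = 0 then 0 else a (u - 1)) * z ^ u" "z * s"] by simp
  from sums_diff[OF assms this] show ?thesis by (simp add: algebra_simps)
qed

lemma dsums_one_minus_X:
  assumes "dsums (\<lambda>u v. of_int (fps_nth (fps_nth F u) v)) z w s"
  shows "dsums (\<lambda>u v. of_int (fps_nth (fps_nth (F * (1 - fps_X)) u) v)) z w ((1 - z) * s)"
proof -
  obtain r where r: "\<And>u. (\<lambda>v. of_int (fps_nth (fps_nth F u) v) * w ^ v) sums r u"
    "(\<lambda>u. r u * z ^ u) sums s" using assms unfolding dsums_def by blast
  have "(\<lambda>v. of_int (fps_nth (fps_nth (F * (1 - fps_X)) u) v) * w ^ v) sums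
      (r u - (if u = 0 then 0 else r (u - 1)))" for u
    using r(1)[of u] sums_diff[OF r(1)[of u] r(1)[of "u - 1"]]
    by (cases "u = 0") (simp_all add: fps_nth_mult_one_minus_X left_diff_distrib)
  then show ?thesis using sums_shift_mult[OF r(2)] by (rule dsumsI)
qed

lemma dsums_const_one_minus_X:
  assumes "dsums (\<lambda>u v. of_int (fps_nth (fps_nth F u) v)) z w s"
  shows "dsums (\<lambda>u v. of_int (fps_nth (fps_nth (F * fps_const (1 - fps_X)) u) v)) z w ((1 - w) * s)"
proof -
  obtain r where r: "\<And>u. (\<lambda>v. of_int (fps_nth (fps_nth F u) v) * w ^ v) sums r u"
    "(\<lambda>u. r u * z ^ u) sums s" using assms unfolding dsums_def by blast
  have "(\<lambda>v. of_int (fps_nth (fps_nth (F * fps_const (1 - fps_X)) u) v) * w ^ v) sums ((1 - w) * r u)" for u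
    using sums_shift_mult[OF r(1)[of u]]
    by (simp add: fps_nth_mult_one_minus_X if_distrib[of real_of_int] cong: if_cong)
  moreover have "(\<lambda>u. (1 - w) * r u * z ^ u) sums ((1 - w) * s)"
    using sums_mult[OF r(2), of "1 - w"] by (simp add: ac_simps)
  ultimately show ?thesis by (rule dsumsI)
qed

lemma dsums_numerator:
  assumes "dsums (\<lambda>u v. of_int (fps_nth (fps_nth F u) v)) z w s"
  shows "dsums (\<lambda>u v. of_int (fps_nth (fps_nth (F * (1 - fps_X) ^ k * fps_const (1 - fps_X) ^ l) u) v))
    z w ((1 - w) ^ l * ((1 - z) ^ k * s))"
proof -
  have 1: "dsums (\<lambda>u v. of_int (fps_nth (fps_nth (F * (1 - fps_X) ^ k) u) v)) z w ((1 - z) ^ k * s)"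
  proof (induction k)
    case (Suc k)
    from dsums_one_minus_X[OF Suc] show ?case by (simp add: ac_simps)
  qed (use assms in simp)
  show ?thesis
  proof (induction l)
    case (Suc l)
    have "F * (1 - fps_X) ^ k * fps_const (1 - fps_X) ^ Suc l =
        F * (1 - fps_X) ^ k * fps_const (1 - fps_X) ^ l * fps_const (1 - fps_X)"
      by (simp only: power_Suc2 mult.assoc)
    with dsums_const_one_minus_X[OF Suc] show ?case by (simp only: power_Suc mult.assoc)
  qed (use 1 in simp)
qed

lemma dsums_poly: "dsums (\<lambda>u v. of_int (fps_nth (fps_nth (fps_of_poly2 p) u) v)) z w (eval2 p z w)"
proof -
  obtain D where D: "\<forall>i j. i > D \<or> j > D \<longrightarrow> coeff2 p i j = 0" using coeff2_bound by blast
  have e: "fps_nth (fps_nth (fps_of_poly2 p) u) v = coeff2 p u v" for u v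
    by (simp add: fps_of_poly2_nth coeff2_def)
  have "(\<lambda>v. of_int (coeff2 p u v) * w ^ v) sums (\<Sum>j\<le>D. of_int (coeff2 p u j) * w ^ j)" for u
    by (rule sums_finite) (use D in auto)
  moreover have "(\<lambda>u. (\<Sum>j\<le>D. of_int (coeff2 p u j) * w ^ j) * z ^ u) sums eval2 p z w"
    unfolding eval2_eq_sum[OF D] by (rule sums_finite) (use D in auto)
  ultimately show ?thesis unfolding e by (rule dsumsI)
qed

text \<open>Cauchy product with the geometric series; the coefficients add up by the hockey-stick
  identity.\<close>

lemma sums_binomial_series:
  fixes z :: real
  assumes "0 \<le> z" "z < 1"
  shows "(\<lambda>u. real (u + n choose n) * z ^ u) sums (1 / (1 - z) ^ (n + 1))"
proof (induction n)
  case 0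
  show ?case using geometric_sums[of z] assms by simp
next
  case (Suc n)
  let ?a = "\<lambda>u. real (u + n choose n) * z ^ u"
  have "(\<lambda>u. \<Sum>i\<le>u. ?a i * z ^ (u - i)) sums (suminf ?a * suminf ((^) z))"
    using Suc assms by (intro Cauchy_product_sums) (auto simp: abs_mult intro: sums_summable summable_geometric)
  moreover have "(\<Sum>i\<le>u. ?a i * z ^ (u - i)) = real (u + Suc n choose Suc n) * z ^ u" for u
  proof -
    have "(\<Sum>i\<le>u. ?a i * z ^ (u - i)) = (\<Sum>i\<le>u. real (i + n choose n) * z ^ u)"
      by (rule sum.cong) (auto simp: mult.assoc simp flip: power_add)
    also have "\<dots> = real (\<Sum>i\<le>u. (n + i choose n)) * z ^ u" by (simp add: sum_distrib_right add.commute)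
    also have "(\<Sum>i\<le>u. (n + i choose n)) = (u + Suc n choose Suc n)"
      by (induction u) (simp_all add: add.commute)
    finally show ?thesis .
  qed
  moreover have "suminf ?a * suminf ((^) z) = 1 / (1 - z) ^ (Suc n + 1)"
    unfolding sums_unique[OF Suc, symmetric] using suminf_geometric[of z] assms by simp
  ultimately show ?case by simp
qed

text \<open>The right side is the product of the \<open>n\<close> factors u + 1, ..., u + n.\<close>

lemma power_le_fact_binomial: "(u + 1) ^ n \<le> fact n * (u + n choose n)"
proof (induction n)
  case (Suc n)
  have "(u + 1) ^ Suc n \<le> Suc (u + n) * (fact n * (u + n choose n))"
    using mult_mono[OF _ Suc, of "u + 1" "Suc (u + n)"] by simp
  also have "\<dots> = fact n * (Suc (u + n) * (u + n choose n))" by (simp only: ac_simps)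
  also have "\<dots> = fact n * (Suc n * (Suc (u + n) choose Suc n))" by (simp only: Suc_times_binomial)
  also have "\<dots> = fact (Suc n) * (u + Suc n choose Suc n)"
    by (simp only: fact_Suc of_nat_id ac_simps add_Suc_right)
  finally show ?case .
qed simp

lemma power_series_bound:
  fixes z :: real
  assumes "0 \<le> z" "z < 1"
  shows "summable (\<lambda>u. real (u + 1) ^ n * z ^ u)"
    and "suminf (\<lambda>u. real (u + 1) ^ n * z ^ u) \<le> fact n / (1 - z) ^ (n + 1)"
proof -
  have s: "(\<lambda>u. fact n * (real (u + n choose n) * z ^ u)) sums (fact n * (1 / (1 - z) ^ (n + 1)))"
    by (rule sums_mult[OF sums_binomial_series[OF assms]])
  have le: "real (u + 1) ^ n * z ^ u \<le> fact n * (real (u + n choose n) * z ^ u)" for u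
  proof -
    have "real ((u + 1) ^ n) \<le> real (fact n * (u + n choose n))"
      using power_le_fact_binomial by (rule of_nat_mono)
    then have "real (u + 1) ^ n \<le> fact n * real (u + n choose n)" by simp
    then have "real (u + 1) ^ n * z ^ u \<le> (fact n * real (u + n choose n)) * z ^ u"
      using assms by (intro mult_right_mono) auto
    then show ?thesis by (simp add: mult.assoc)
  qed
  show su: "summable (\<lambda>u. real (u + 1) ^ n * z ^ u)"
    using le assms by (intro summable_comparison_test'[OF sums_summable[OF s], of 0]) auto
  have "suminf (\<lambda>u. real (u + 1) ^ n * z ^ u) \<le> suminf (\<lambda>u. fact n * (real (u + n choose n) * z ^ u))"
    using le by (intro suminf_le su sums_summable[OF s])
  then show "suminf (\<lambda>u. real (u + 1) ^ n * z ^ u) \<le> fact n / (1 - z) ^ (n + 1)"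
    using sums_unique[OF s] by simp
qed

text \<open>The bound on \<open>f\<close> separates the variables, so the majorant is a sum of
  products of one-variable series: one with a pole of order n + 1 at 1, the other geometric.\<close>

lemma dsums_bounded:
  fixes f :: "nat \<Rightarrow> nat \<Rightarrow> real"
  assumes f: "\<And>u v. 0 \<le> f u v" "\<And>u v. f u v \<le> C * (real (u + 1) ^ n + real (v + 1) ^ n)"
    and C: "C \<ge> 0" and z: "0 \<le> z" "z < 1" and w: "0 \<le> w" "w < 1"
  shows "\<exists>s. dsums f z w s \<and> 0 \<le> s \<and>
    s \<le> C * (fact n / ((1 - z) ^ (n + 1) * (1 - w)) + fact n / ((1 - w) ^ (n + 1) * (1 - z)))"
proof -
  let ?S = "\<lambda>z. suminf (\<lambda>u. real (u + 1) ^ n * z ^ u)"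
  let ?b = "\<lambda>u. C * (real (u + 1) ^ n * (1 / (1 - w)) + ?S w)"
  have S: "(\<lambda>u. real (u + 1) ^ n * z ^ u) sums ?S z" if "0 \<le> z" "z < 1" for z
    using power_series_bound(1)[OF that] by (rule summable_sums)
  have g: "(\<lambda>u. z ^ u) sums (1 / (1 - z))" if "0 \<le> z" "z < 1" for z :: real
    using geometric_sums[of z] that by simp
  have row: "(\<lambda>v. C * (real (u + 1) ^ n * w ^ v + real (v + 1) ^ n * w ^ v)) sums ?b u" for u
    by (intro sums_mult sums_add S g w)
  have le: "f u v * w ^ v \<le> C * (real (u + 1) ^ n * w ^ v + real (v + 1) ^ n * w ^ v)" for u v
    using mult_right_mono[OF f(2)[of u v], of "w ^ v"] w by (simp add: algebra_simps)
  have sr: "summable (\<lambda>v. f u v * w ^ v)" for u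
    using f(1) w le by (intro summable_comparison_test'[OF sums_summable[OF row[of u]], of 0]) auto
  define r where "r u = suminf (\<lambda>v. f u v * w ^ v)" for u
  have r0: "0 \<le> r u" for u unfolding r_def using f(1) w by (intro suminf_nonneg sr) auto
  have rb: "r u \<le> ?b u" for u
  proof -
    have "r u \<le> suminf (\<lambda>v. C * (real (u + 1) ^ n * w ^ v + real (v + 1) ^ n * w ^ v))"
      unfolding r_def using le by (intro suminf_le sr sums_summable[OF row])
    then show ?thesis using sums_unique[OF row[of u]] by simp
  qed
  have col: "(\<lambda>u. C * (real (u + 1) ^ n * z ^ u * (1 / (1 - w)) + ?S w * z ^ u)) sums
      (C * (?S z * (1 / (1 - w)) + ?S w * (1 / (1 - z))))"
    by (intro sums_mult sums_add sums_mult2 S g z)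
  have le2: "r u * z ^ u \<le> C * (real (u + 1) ^ n * z ^ u * (1 / (1 - w)) + ?S w * z ^ u)" for u
    using mult_right_mono[OF rb[of u], of "z ^ u"] z by (simp add: algebra_simps)
  have sc: "summable (\<lambda>u. r u * z ^ u)"
    using r0 z le2 by (intro summable_comparison_test'[OF sums_summable[OF col], of 0]) auto
  let ?s = "suminf (\<lambda>u. r u * z ^ u)"
  have "dsums f z w ?s"
    by (rule dsumsI[of _ _ r]) (use sr in \<open>simp add: r_def summable_sums\<close>, rule summable_sums[OF sc])
  moreover have "0 \<le> ?s" using r0 z by (intro suminf_nonneg sc) auto
  moreover have "?s \<le> C * (?S z * (1 / (1 - w)) + ?S w * (1 / (1 - z)))"
    unfolding sums_unique[OF col] using le2 by (intro suminf_le sc sums_summable[OF col])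
  moreover have "C * (?S z * (1 / (1 - w)) + ?S w * (1 / (1 - z))) \<le>
      C * (fact n / (1 - z) ^ (n + 1) * (1 / (1 - w)) + fact n / (1 - w) ^ (n + 1) * (1 / (1 - z)))"
    using C z w by (intro mult_left_mono add_mono mult_right_mono power_series_bound(2)) auto
  ultimately show ?thesis by (intro exI[of _ ?s]) auto
qed

text \<open>Letting t tend to 0 from the right shows that the constant term vanishes; then divide by
  t and repeat.\<close>

lemma poly_low_coeffs_zero:
  fixes q :: "real poly"
  assumes "\<And>t. 0 < t \<Longrightarrow> t < 1 \<Longrightarrow> \<bar>poly q t\<bar> \<le> K * t ^ n" and "e < n"
  shows "Polynomial.coeff q e = 0"
  using assms
proof (induction n arbitrary: q e)
  case (Suc n)
  obtain a q' where q: "q = pCons a q'" by (cases q)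
  have lim: "(poly q \<longlongrightarrow> poly q 0) (at_right 0)"
    by (rule tendsto_within_subset[of _ _ _ UNIV]) (auto intro: poly_isCont[unfolded isCont_def])
  have "((\<lambda>t. K * t ^ Suc n) \<longlongrightarrow> K * 0 ^ Suc n) (at_right 0)"
    by (intro tendsto_intros)
  then have K0: "((\<lambda>t. K * t ^ Suc n) \<longlongrightarrow> 0) (at_right 0)" by simp
  have "(poly q \<longlongrightarrow> 0) (at_right 0)"
  proof (rule tendsto_0_le[OF K0])
    have "\<bar>poly q t\<bar> \<le> \<bar>K * t ^ Suc n\<bar>" if "0 < t" "t < 1" for t
      using Suc.prems(1)[OF that] by linarith
    then show "\<forall>\<^sub>F t in at_right 0. norm (poly q t) \<le> norm (K * t ^ Suc n) * 1"
      unfolding eventually_at_right_field by (intro exI[of _ 1]) auto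
  qed
  then have "poly q 0 = 0" using tendsto_unique[OF _ lim] by simp
  then have a: "a = 0" by (simp add: q)
  have "\<bar>poly q' t\<bar> \<le> K * t ^ n" if "0 < t" "t < 1" for t
  proof -
    have "t * \<bar>poly q' t\<bar> \<le> t * (K * t ^ n)"
      using Suc.prems(1)[OF that] that by (simp add: q a abs_mult ac_simps)
    then show ?thesis using that by simp
  qed
  then show ?case using Suc.IH[of q'] Suc.prems(2) by (cases e) (auto simp: q a)
qed simp

text \<open>On the line x = \<alpha> t, y = t the polynomial is of order t^n, so its coefficient of
  degree i + j vanishes. This coefficient is a polynomial in \<alpha> whose coefficients are those
  of total degree i + j, and it has infinitely many zeros.\<close>

lemma coeff2_zero_of_bound:
  assumes b: "\<And>x y. 0 < x \<Longrightarrow> x < 1 \<Longrightarrow> 0 < y \<Longrightarrow> y < 1 \<Longrightarrow> \<bar>eval2 p x y\<bar> \<le> K * (x ^ n + y ^ n)"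
    and K: "K \<ge> 0" and ij: "i + j < n"
  shows "coeff2 p i j = 0"
proof -
  obtain D where D: "\<forall>i j. i > D \<or> j > D \<longrightarrow> coeff2 p i j = 0" using coeff2_bound by blast
  let ?e = "i + j"
  \<comment> \<open>The coefficient of t^(i+j) on the line x = \<alpha> t, y = t, as a polynomial in
    \<alpha>.\<close>
  define R where "R = (\<Sum>k\<le>D. Polynomial.monom (if k \<le> ?e then real_of_int (coeff2 p k (?e - k)) else 0) k)"
  have "poly R \<alpha> = 0" if \<alpha>: "0 < \<alpha>" "\<alpha> < 1" for \<alpha>
  proof -
    define q where "q = (\<Sum>k\<le>D. \<Sum>l\<le>D. Polynomial.monom (real_of_int (coeff2 p k l) * \<alpha> ^ k) (k + l))"
    have q: "poly q t = eval2 p (\<alpha> * t) t" for t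
      unfolding eval2_eq_sum[OF D] q_def
      by (simp add: poly_sum poly_monom power_add power_mult_distrib sum_distrib_left sum_distrib_right ac_simps)
    \<comment> \<open>Both powers in the bound are at most t^n because \<alpha> < 1, hence the
      factor 2.\<close>
    have "\<bar>poly q t\<bar> \<le> (2 * K) * t ^ n" if t: "0 < t" "t < 1" for t
    proof -
      have "\<alpha> * t < 1 * 1" using \<alpha> t by (intro mult_strict_mono) auto
      then have "\<bar>eval2 p (\<alpha> * t) t\<bar> \<le> K * ((\<alpha> * t) ^ n + t ^ n)" using \<alpha> t by (intro b) auto
      also have "(\<alpha> * t) ^ n \<le> t ^ n" using \<alpha> t by (intro power_mono) (auto simp: mult_le_cancel_right1)
      then have "K * ((\<alpha> * t) ^ n + t ^ n) \<le> K * (t ^ n + t ^ n)" using K by (intro mult_left_mono) auto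
      finally show ?thesis by (simp add: q)
    qed
    then have "Polynomial.coeff q ?e = 0" using ij by (rule poly_low_coeffs_zero)
    moreover have "Polynomial.coeff q ?e = poly R \<alpha>"
    proof -
      have "(\<Sum>l\<le>D. Polynomial.coeff (Polynomial.monom (real_of_int (coeff2 p k l) * \<alpha> ^ k) (k + l)) ?e) =
          (if k \<le> ?e then real_of_int (coeff2 p k (?e - k)) else 0) * \<alpha> ^ k" for k
      proof -
        have "(\<Sum>l\<le>D. Polynomial.coeff (Polynomial.monom (real_of_int (coeff2 p k l) * \<alpha> ^ k) (k + l)) ?e) =
            (\<Sum>l\<le>D. if l = ?e - k \<and> k \<le> ?e then real_of_int (coeff2 p k l) * \<alpha> ^ k else 0)"
          by (rule sum.cong) auto
        also have "\<dots> = (if k \<le> ?e then real_of_int (coeff2 p k (?e - k)) else 0) * \<alpha> ^ k"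
          using D by (cases "k \<le> ?e") auto
        finally show ?thesis .
      qed
      then show ?thesis unfolding q_def R_def by (simp add: coeff_sum poly_sum poly_monom)
    qed
    ultimately show ?thesis by simp
  qed
  then have "{0<..<1} \<subseteq> {\<alpha>. poly R \<alpha> = 0}" by auto
  then have "infinite {\<alpha>. poly R \<alpha> = 0}" 
    by (rule infinite_super) (simp add: infinite_Ioo)
  then have R: "R = 0" using poly_roots_finite by blast
  show ?thesis
  proof (cases "i \<le> D")
    case True
    have "Polynomial.coeff R i = real_of_int (coeff2 p i j)"
      using True by (simp add: R_def coeff_sum)
    then show ?thesis using R by simp
  qed (use D in auto)
qed

context homogeneous_forms
begin

text \<open>At T_0 = 1 - x, T_1 = 1 - y the Hilbert series is bounded by a multiple of 1/(x^(n+1) y)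
  + 1/(y^(n+1) x), because its coefficients grow with order \<open>n\<close> only. Multiplying by
  x^(n+1) y^(n+1) to obtain the numerator leaves a multiple of x^n + y^n.\<close>

lemma multidegree_graph_low:
  assumes "i + j < n"
  shows "multidegree a n (graph_ideal a n f) i j = 0"
proof -
  let ?J = "graph_ideal a n f"
  let ?N = "hilbert_num a n ?J"
  \<comment> \<open>Comes from u + d v + 1 \<le> 2 (d + 1) max (u + 1) (v + 1); the n-th power of
    the maximum is at most the sum of the two n-th powers.\<close>
  define C :: real where "C = (2 * (real d + 1)) ^ n"
  have C: "C \<ge> 0" by (simp add: C_def)
  have H: "real_of_int (fps_nth (fps_nth (hilbert_series (xyvars a n) ?J) u) v) \<le>
      C * (real (u + 1) ^ n + real (v + 1) ^ n)" for u v
  proof -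
    have "u + d * v + 1 \<le> 2 * (d + 1) * max (u + 1) (v + 1)"
    proof -
      have "u + d * v + 1 \<le> (u + 1) + d * (v + 1)" by simp
      also have "\<dots> \<le> max (u + 1) (v + 1) + d * max (u + 1) (v + 1)"
        by (intro add_mono mult_left_mono) auto
      finally show ?thesis by (simp add: algebra_simps)
    qed
    then have "(u + d * v + 1) ^ n \<le> (2 * (d + 1) * max (u + 1) (v + 1)) ^ n" by (rule power_mono) simp
    also have "\<dots> = (2 * (d + 1)) ^ n * max (u + 1) (v + 1) ^ n" by (rule power_mult_distrib)
    also have "max (u + 1) (v + 1) ^ n \<le> (u + 1) ^ n + (v + 1) ^ n" by (simp add: max_def)
    finally have "hilbert_fun (xyvars a n) ?J u v \<le> (2 * (d + 1)) ^ n * ((u + 1) ^ n + (v + 1) ^ n)"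
      using hilbert_fun_graph_bound[of u v] by simp
    then have "real (hilbert_fun (xyvars a n) ?J u v) \<le> real ((2 * (d + 1)) ^ n * ((u + 1) ^ n + (v + 1) ^ n))"
      by (rule of_nat_mono)
    then show ?thesis by (simp add: C_def add.commute)
  qed
  have b: "\<bar>eval2 (subst_one_minus ?N) x y\<bar> \<le> (C * fact n) * (x ^ n + y ^ n)"
    if x: "0 < x" "x < 1" and y: "0 < y" "y < 1" for x y
  proof -
    obtain s where s: "dsums (\<lambda>u v. of_int (fps_nth (fps_nth (hilbert_series (xyvars a n) ?J) u) v)) (1 - x) (1 - y) s"
      "0 \<le> s" "s \<le> C * (fact n / (x ^ (n + 1) * y) + fact n / (y ^ (n + 1) * x))"
      using dsums_bounded[OF _ H C, of "1 - x" "1 - y"] x y by auto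
    have "dsums (\<lambda>u v. of_int (fps_nth (fps_nth (fps_of_poly2 ?N) u) v)) (1 - x) (1 - y)
        (y ^ (n + 1) * (x ^ (n + 1) * s))"
      unfolding hilbert_num[OF graph_ideal_is_ideal] using dsums_numerator[OF s(1), of "n + 1" "n + 1"] by simp
    then have e: "eval2 (subst_one_minus ?N) x y = y ^ (n + 1) * (x ^ (n + 1) * s)"
      unfolding eval2_subst_one_minus using dsums_unique dsums_poly by blast
    have "y ^ (n + 1) * (x ^ (n + 1) * s) \<le>
        y ^ (n + 1) * (x ^ (n + 1) * (C * (fact n / (x ^ (n + 1) * y) + fact n / (y ^ (n + 1) * x))))"
      using x y s(3) by (intro mult_left_mono) auto
    also have "\<dots> = (C * fact n) * (x ^ n + y ^ n)" using x y by (simp add: field_simps)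
    finally show ?thesis using e s(2) x y by simp
  qed
  have "coeff2 (subst_one_minus ?N) i j = 0"
    by (rule coeff2_zero_of_bound[OF b _ assms]) (use C in auto)
  then show ?thesis by (simp add: multidegree_def coeff2_def)
qed

end

section \<open>Products of numerators and the component of lowest degree\<close>

lemma subst_one_minus_mult: "subst_one_minus (p * q) = subst_one_minus p * subst_one_minus q"
proof -
  have "map_poly (\<lambda>q. pcompose q [:1, -1:]) (p * q) =
      map_poly (\<lambda>q. pcompose q [:1, -1:]) p * map_poly (\<lambda>q. pcompose q [:1, -1:]) q"
    by (rule poly_eqI) (simp add: coeff_map_poly coeff_mult pcompose_sum pcompose_mult)
  then show ?thesis by (simp add: subst_one_minus_def pcompose_mult)
qed

lemma coeff2_mult: "coeff2 (p * q) a b = (\<Sum>i\<le>a. \<Sum>j\<le>b. coeff2 p i j * coeff2 q (a - i) (b - j))"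
  by (simp add: coeff2_def coeff_mult coeff_sum)

text \<open>Below the codimensions \<open>m\<close>, \<open>m'\<close> there are no coefficients, so only pairs of exactly these
  total degrees contribute to total degree \<open>m + m'\<close>.\<close>

lemma convolution_top_degree:
  fixes c c' :: "nat \<Rightarrow> nat \<Rightarrow> int"
  assumes c: "\<And>i j. i + j < m \<Longrightarrow> c i j = 0" and c': "\<And>i j. i + j < m' \<Longrightarrow> c' i j = 0"
    and k: "k \<le> m + m'"
  shows "(\<Sum>i\<le>m + m' - k. \<Sum>j\<le>k. c i j * c' (m + m' - k - i) (k - j)) =
    (\<Sum>j=0..k. (if j \<le> m then c (m - j) j else 0) * (if k - j \<le> m' then c' (m' - (k - j)) (k - j) else 0))"
proof -
  define a where "a = m + m' - k"
  have "(\<Sum>i\<le>a. c i j * c' (a - i) (k - j)) =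
      (if j \<le> m then c (m - j) j else 0) * (if k - j \<le> m' then c' (m' - (k - j)) (k - j) else 0)"
    if j: "j \<le> k" for j
  proof -
    have z: "c i j * c' (a - i) (k - j) = 0" if "i \<le> a" "i + j \<noteq> m" for i
    proof (cases "i + j < m")
      case False
      \<comment> \<open>The two total degrees add up to m + m', so an excess over \<open>m\<close>
        in the first factor is a deficit below m' in the second.\<close>
      then have "(a - i) + (k - j) < m'" using that j k unfolding a_def by linarith
      then show ?thesis using c' by simp
    qed (use c in simp)
    show ?thesis
    proof (cases "j \<le> m \<and> k - j \<le> m'")
      case True
      then have i: "m - j \<le> a" and e: "a - (m - j) = m' - (k - j)"
        using j k unfolding a_def by linarith+
      have "(\<Sum>i\<le>a. c i j * c' (a - i) (k - j)) = (\<Sum>i\<in>{m - j}. c i j * c' (a - i) (k - j))"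
      proof (intro sum.mono_neutral_right ballI)
        fix x assume "x \<in> {..a} - {m - j}"
        then show "c x j * c' (a - x) (k - j) = 0" using True by (intro z) auto
      qed (use i in auto)
      then show ?thesis using True by (simp add: e)
    next
      case False
      have "(\<Sum>i\<le>a. c i j * c' (a - i) (k - j)) = 0"
      proof (rule sum.neutral, rule ballI)
        fix i assume "i \<in> {..a}"
        moreover from this have "i + j \<noteq> m" using False j k by (auto simp: a_def)
        ultimately show "c i j * c' (a - i) (k - j) = 0" using z by simp
      qed
      then show ?thesis using False by auto
    qed
  qed
  then show ?thesis unfolding a_def[symmetric] by (subst sum.swap) (simp add: atLeast0AtMost)
qed

text \<open>A zero component would lie in the ideal generated by the others, against the
  irredundancy of the generators in a minimal presentation.\<close>

lemma determinantal_forms: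
  assumes "determinantal a n f"
  shows "\<exists>d. homogeneous_forms a n d f" and "i \<le> n \<Longrightarrow> f i \<noteq> 0"
proof -
  obtain d where d: "\<And>i. i \<le> n \<Longrightarrow> f i \<in> polys (xvars a n)" "\<And>i. i \<le> n \<Longrightarrow> homogeneous (f i) d"
    using assms by (auto simp: determinantal_def rational_map_def Let_def)
  then have "f i \<in> bigraded_part (xvars a n) d 0" if "i \<le> n" for i
    using that by (simp add: bigraded_part_def homogeneous_def)
  then show "\<exists>d. homogeneous_forms a n d f" using homogeneous_forms.intro by blast
  obtain A where "minimal_presentation a n f A" using assms by (auto simp: determinantal_def)
  then have ni: "f i \<notin> Idl\<^bsub>poly_ring (xvars a n)\<^esub> (f ` ({0..n} - {i}))" if "i \<le> n"
    using that by (auto simp: minimal_presentation_def Let_def)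
  have "f ` ({0..n} - {i}) \<subseteq> polys (xvars a n)" using d(1) by auto
  then have "0 \<in> Idl\<^bsub>poly_ring (xvars a n)\<^esub> (f ` ({0..n} - {i}))"
    using is_idealD(2)[OF genideal_is_ideal] by blast
  then show "f i \<noteq> 0" if "i \<le> n" using ni[OF that] by auto
qed

lemma graph_saturated_ideal:
  assumes "determinantal a n f" "a \<le> m" "m \<le> a + n"
  shows "saturated_ideal m (xyvars a n) (graph_ideal a n f)"
proof
  show "finite (xyvars a n)" "Xvar m \<in> xyvars a n" "Yvar m \<in> xyvars a n"
    using assms by (auto simp: xyvars_def)
  have "f (m - a) \<noteq> 0" using determinantal_forms(2)[OF assms(1), of "m - a"] assms by simp
  then show "saturated m (xyvars a n) (graph_ideal a n f)" by (rule graph_ideal_saturated)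
qed (rule graph_ideal_is_ideal)

lemma xyvars_glue:
  "xyvars 0 m \<union> xyvars m m' = xyvars 0 (m + m')"
  "xyvars 0 m \<inter> xyvars m m' = {Xvar m, Yvar m}"
  by (auto simp: xyvars_def image_iff)

theorem proposition1:
  fixes g g' h :: "nat \<Rightarrow> 'k::field mpoly"
    and \<Phi> \<Phi>' :: "'k mpoly mat"
    and m m' :: nat
    and F :: "('k, 'b) free_complex"
    and F' :: "('k, 'c) free_complex"
  defines "S \<equiv> poly_ring (xyvars 0 (m + m')) :: 'k mpoly ring"
  assumes "m \<ge> 1" and "m' \<ge> 1"
    and "determinantal 0 m g" and "map_of_minors 0 m \<Phi> g"
    and "determinantal m m' g'" and "map_of_minors m m' \<Phi>' g'"
    and "rational_map 0 (m + m') h"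
    and "map_of_minors 0 (m + m') (glued_matrix m m' \<Phi> \<Phi>') h"
    and "free_resolution (xyvars 0 (m + m')) (Idl\<^bsub>S\<^esub> (graph_ideal 0 m g)) F"
    and "free_resolution (xyvars 0 (m + m')) (Idl\<^bsub>S\<^esub> (graph_ideal m m' g')) F'"
    and "free_resolution (xyvars 0 (m + m')) (graph_ideal 0 (m + m') h) (tensor_complex F F')"
  shows "\<forall>k\<in>{0..m + m'}. proj_degree 0 (m + m') h k =
           (\<Sum>p=0..k. proj_degree 0 m g p * proj_degree m m' g' (k - p))"
proof
  fix k assume "k \<in> {0..m + m'}"
  then have k: "k \<le> m + m'" by simp
  let ?J = "graph_ideal 0 m g" and ?J' = "graph_ideal m m' g'" and ?K = "graph_ideal 0 (m + m') h"
  obtain d where "homogeneous_forms 0 m d g"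
    using determinantal_forms(1)[OF \<open>determinantal 0 m g\<close>] by blast
  then interpret G: homogeneous_forms 0 m d g .
  obtain d' where "homogeneous_forms m m' d' g'"
    using determinantal_forms(1)[OF \<open>determinantal m m' g'\<close>] by blast
  then interpret G': homogeneous_forms m m' d' g' .
  \<comment> \<open>The shared index is the last one for \<open>g\<close> and the first one for
    \<open>g'\<close>, so saturation rests on g m \<noteq> 0 and g' 0 \<noteq> 0.\<close>
  interpret A: saturated_ideal m "xyvars 0 m" ?J
    by (rule graph_saturated_ideal[OF \<open>determinantal 0 m g\<close>]) auto
  interpret B: saturated_ideal m "xyvars m m'" ?J'
    by (rule graph_saturated_ideal[OF \<open>determinantal m m' g'\<close>]) auto
  interpret ideal_pair m "xyvars 0 m" "xyvars m m'" ?J ?J'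
    by unfold_locales (rule xyvars_glue G.graph_ideal_bigraded G'.graph_ideal_bigraded)+
  have ext: "Idl\<^bsub>S\<^esub> ?J = extA" "Idl\<^bsub>S\<^esub> ?J' = extB"
    unfolding S_def xyvars_glue(1)[symmetric]
    by (rule genideal_eq_ext_ideal[OF A.ideal] genideal_eq_ext_ideal[OF B.ideal], blast)+
  obtain \<epsilon> \<epsilon>' \<epsilon>'' where
    "coker_ideal (xyvars 0 (m + m')) F extA \<epsilon>" "coker_ideal (xyvars 0 (m + m')) F' extB \<epsilon>'"
    "coker_ideal (xyvars 0 (m + m')) (tensor_complex F F') ?K \<epsilon>''"
    using free_resolution_coker assms(10-12) unfolding ext by meson
  from tensor_coker[OF this(1,2)[unfolded xyvars_glue(1)] this(3)
      extA_ideal[unfolded xyvars_glue(1)] extB_ideal[unfolded xyvars_glue(1)] graph_ideal_is_ideal]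
  have K: "?K = sum_ideal" unfolding sum_ideal_def xyvars_glue(1) .
  let ?N = "hilbert_num 0 m ?J" and ?N' = "hilbert_num m m' ?J'"
  \<comment> \<open>Of the (m + 1) + (m' + 1) factors in each variable, one is used up by
    \<open>hilbert_series_sum_ideal\<close>, which leaves the m + m' + 1 factors required for the
    numerator of \<open>h\<close>.\<close>
  have "fps_of_poly2 (?N * ?N') = hilbert_series (xyvars 0 (m + m')) ?K *
      (1 - fps_X) ^ (m + m' + 1) * (fps_const (1 - fps_X)) ^ (m + m' + 1)"
    unfolding fps_of_poly2_mult hilbert_num[OF A.ideal] hilbert_num[OF B.ideal] K
      hilbert_series_sum_ideal[unfolded xyvars_glue(1)]
    by (simp only: power_add power_one_right ac_simps)
  then have N: "hilbert_num 0 (m + m') ?K = ?N * ?N'" by (rule hilbert_num_eqI)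
  let ?c = "multidegree 0 m ?J" and ?c' = "multidegree m m' ?J'"
  have "multidegree 0 (m + m') ?K (m + m' - k) k =
      (\<Sum>i\<le>m + m' - k. \<Sum>j\<le>k. ?c i j * ?c' (m + m' - k - i) (k - j))"
    using coeff2_mult[of "subst_one_minus ?N" "subst_one_minus ?N'"]
    by (simp add: multidegree_def N subst_one_minus_mult coeff2_def)
  also have "\<dots> = (\<Sum>p=0..k. proj_degree 0 m g p * proj_degree m m' g' (k - p))"
    unfolding proj_degree_def
    by (rule convolution_top_degree[OF G.multidegree_graph_low G'.multidegree_graph_low k])
  finally show "proj_degree 0 (m + m') h k =
      (\<Sum>p=0..k. proj_degree 0 m g p * proj_degree m m' g' (k - p))"
    using k by (simp add: proj_degree_def)
qed

end
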